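(* Let $Z^H\in\mathfrak h$ and let $\Lambda_1(z),\dots,\Lambda_r(z)$ be monic polynomials. There is a surjective map from the set of nondegenerate polynomial solutions $\{q^i_+(z),q^i_-(z)\}_{i=1,\dots,r}$ of the $qq$-system $$W(q^i_+,q^i_-)(z)+\langle\alpha_i,Z^H\rangle q^i_+(z)q^i_-(z)=\Lambda_i(z)\prod_{j\ne i}\big[q^j_+(z)\big]^{-a_{ji}},\qquad i=1,\dots,r,$$ to the set of nondegenerate $Z^H$-twisted Miura-Plücker opers, whose fibers consist of all solutions with fixed $q^i_+(z)$'s.
   Context: Let $G$ be a connected, simply connected, simple algebraic group over $\mathbb C$ of rank $r$ with Lie algebra $\mathfrak g$, opposite Borel subgroups $B_\pm$, maximal torus $H=B_+\cap B_-$, $N_\pm=[B_\pm,B_\pm]$, with Lie algebras $\mathfrak b_\pm,\mathfrak h,\mathfrak n_\pm$. Let $\alpha_i,\check\alpha_i$ be the simple roots and coroots (for $H\subset B_+$), $e_i,f_i,\check\alpha_i$ Chevalley generators, $a_{ij}=\langle\alpha_j,\check\alpha_i\rangle$. For an algebraic group $K$, $K(z)$ denotes its $\mathbb C(z)$-points. The gauge action of $g\in G(z)$ on $\partial_z+A(z)$ is $g(\partial_z+A)g^{-1}=\partial_z+gAg^{-1}+g\,\partial_z(g^{-1})$. Miura opers. The monic polynomials $\Lambda_1,\dots,\Lambda_r$ are fixed. A Miura $G$-oper on $\mathbb P^1$ with regular singularities determined by the $\Lambda_i$ can be written as a connection $\nabla=\partial_z+\sum_i\Lambda_i(z)e_i+\sum_i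 g_i(z)\check\alpha_i$ with $g_i\in\mathbb C(z)$ (with $B_\pm$-reductions the standard ones in this trivialization), and it is identified with this connection. Miura-Plücker opers. Write $Z^H=\sum_i\zeta_i\check\alpha_i\in\mathfrak h$. Let $V_i$ be the irreducible representation of highest weight $\omega_i$ (fundamental weight), with highest weight vector $\nu_{\omega_i}$, and let $W_i=\mathrm{span}(\nu_{\omega_i},f_i\nu_{\omega_i})\subset V_i$, which is $B_+$-stable. The Miura oper $\nabla$ is a $Z^H$-twisted Miura-Plücker oper if there is $v(z)\in B_+(z)$ with $\nabla|_{W_i}=v(z)(\partial_z+Z^H)v(z)^{-1}|_{W_i}$ for all $i=1,\dots,r$. In that case $g_i=\zeta_i-y_i^{-1}\partial_z y_i$ for some $y_i\in\mathbb C(z)^\times$, unique up to scalars. It is nondegenerate if the $y_i$ may be chosen to be monic polynomials such that: (a) no $y_i$ has a multiple root; (b) for each $i$, $y_i$ and $\Lambda_i$ have no common root; (c) if $i\ne j$ and $a_{ij}\neq0$, then $y_i$ and $y_j$ have no common root. $qq$-system. $W(q_+,q_-)=q_+\partial_zq_--q_-\partial_zq_+$. A polynomial solution $\{q^i_\pm\}$ is nondegenerate if each $q^i_+$ is monic and conditions (a), (b), (c) hold with $y_i=q^i_+$. *)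

theory Defs
  imports
    "HOL-Analysis.Analysis"
    "HOL-Algebra.Solvable_Groups"
    "HOL-Library.Poly_Mapping"
    "HOL-Computational_Algebra.Computational_Algebra"
begin

section \<open>Rational functions of z\<close>

type_synonym ratfun = "complex poly fract"

abbreviation ratfun_const :: "complex \<Rightarrow> ratfun" where
  "ratfun_const c \<equiv> to_fract [:c:]"

definition ratfun_deriv :: "ratfun \<Rightarrow> ratfun" where
  "ratfun_deriv x = (THE y. \<exists>a b. b \<noteq> 0 \<and> x = Fraction_Field.Fract a b \<and>
     y = Fraction_Field.Fract (pderiv a * b - a * pderiv b) (b * b))"

lemma ratfun_deriv_Fract:
  assumes "b \<noteq> 0"
  shows "ratfun_deriv (Fraction_Field.Fract a b)
     = Fraction_Field.Fract (pderiv a * b - a * pderiv b) (b * b)"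
proof -
  have "Fraction_Field.Fract (pderiv c * d - c * pderiv d) (d * d)
      = Fraction_Field.Fract (pderiv a * b - a * pderiv b) (b * b)"
    if d: "d \<noteq> 0" and "Fraction_Field.Fract a b = Fraction_Field.Fract c d" for c d
  proof -
    have eq: "a * d = c * b"
      using assms that by (simp add: eq_fract)
    then have "pderiv (a * d) = pderiv (c * b)" by simp
    then have eq': "pderiv a * d + a * pderiv d = pderiv c * b + c * pderiv b"
      by (simp add: pderiv_mult algebra_simps)
    have "(pderiv a * b - a * pderiv b) * (d * d) - (pderiv c * d - c * pderiv d) * (b * b)
        = b * d * ((pderiv a * d + a * pderiv d) - (pderiv c * b + c * pderiv b))
          - (a * d - c * b) * (pderiv b * d + pderiv d * b)"
      by (simp add: algebra_simps)
    also have "\<dots> = 0" using eq eq' by simp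
    finally show ?thesis
      using assms d by (simp add: eq_fract)
  qed
  then show ?thesis
    unfolding ratfun_deriv_def using assms by (intro the_equality) blast+
qed


section \<open>Regular functions on the general linear group\<close>

text \<open>
  A regular function on GL(n) is a polynomial in the entries of a matrix (variables
  Inl (i,j)) and the entries of its inverse (variables Inr (i,j)). Such a polynomial has
  coefficients in the complex numbers but is evaluated in various commutative algebras;
  iota is always the structure map of the algebra.
\<close>

type_synonym 'n gl_fun = "('n \<times> 'n + 'n \<times> 'n \<Rightarrow>\<^sub>0 nat) \<Rightarrow>\<^sub>0 complex"

definition poly_eval ::
  "(complex \<Rightarrow> 'a::comm_ring_1) \<Rightarrow> ('v \<Rightarrow> 'a) \<Rightarrow> (('v \<Rightarrow>\<^sub>0 nat) \<Rightarrow>\<^sub>0 complex) \<Rightarrow> 'a" where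
  "poly_eval \<iota> x p =
     (\<Sum>m\<in>Poly_Mapping.keys p. \<iota> (Poly_Mapping.lookup p m) *
        (\<Prod>v\<in>Poly_Mapping.keys m. x v ^ Poly_Mapping.lookup m v))"

definition gl_coords :: "'a^'n::finite^'n \<Rightarrow> 'a^'n^'n \<Rightarrow> 'n \<times> 'n + 'n \<times> 'n \<Rightarrow> 'a" where
  "gl_coords A B = case_sum (\<lambda>(i, j). A $ i $ j) (\<lambda>(i, j). B $ i $ j)"

definition gl_eval :: "(complex \<Rightarrow> 'a::comm_ring_1) \<Rightarrow> 'n::finite gl_fun \<Rightarrow> 'a^'n^'n \<Rightarrow> 'a" where
  "gl_eval \<iota> p A = poly_eval \<iota> (gl_coords A (matrix_inv A)) p"

text \<open>
  The derivative at the identity in the direction X: the coefficient of t in p(1 + tX),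
  where the inverse of 1 + tX is 1 - tX modulo t squared. It is linear in X over the algebra,
  so for the algebra C(z) it is the scalar extension of the complex derivative.
\<close>

definition gl_deriv :: "(complex \<Rightarrow> 'a::comm_ring_1) \<Rightarrow> 'n::finite gl_fun \<Rightarrow> 'a^'n^'n \<Rightarrow> 'a" where
  "gl_deriv \<iota> p X =
     coeff (poly_eval (\<lambda>c. [:\<iota> c:])
       (gl_coords (\<chi> i j. [:if i = j then 1 else 0, X $ i $ j:])
                  (\<chi> i j. [:if i = j then 1 else 0, - X $ i $ j:])) p) 1"

definition vanishing_ideal :: "(complex^'n::finite^'n) set \<Rightarrow> 'n gl_fun set" where
  "vanishing_ideal S = {p. \<forall>A\<in>S. gl_eval id p A = 0}"

definition zariski_closed :: "(complex^'n::finite^'n) set \<Rightarrow> bool" where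
  "zariski_closed S \<longleftrightarrow> (\<exists>P. S = {A. invertible A \<and> (\<forall>p\<in>P. gl_eval id p A = 0)})"


section \<open>Linear algebraic groups\<close>

definition matrix_group :: "(complex^'n::finite^'n) set \<Rightarrow> (complex^'n^'n) monoid" where
  "matrix_group S = \<lparr>carrier = S, monoid.mult = (**), one = mat 1\<rparr>"

definition algebraic_group :: "(complex^'n::finite^'n) set \<Rightarrow> bool" where
  "algebraic_group S \<longleftrightarrow> zariski_closed S \<and> group (matrix_group S)"

definition ratfun_points :: "(complex^'n::finite^'n) set \<Rightarrow> (ratfun^'n^'n) set" where
  "ratfun_points S =
     {A. invertible A \<and> (\<forall>p\<in>vanishing_ideal S. gl_eval ratfun_const p A = 0)}"

definition lie_algebra :: "(complex^'n::finite^'n) set \<Rightarrow> (complex^'n^'n) set" where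
  "lie_algebra S = {X. \<forall>p\<in>vanishing_ideal S. gl_deriv id p X = 0}"

definition smat :: "'a::times \<Rightarrow> 'a^'n^'m \<Rightarrow> 'a^'n::finite^'m::finite" where
  "smat c A = map_matrix ((*) c) A"

definition bracket :: "complex^'n::finite^'n \<Rightarrow> complex^'n^'n \<Rightarrow> complex^'n^'n" where
  "bracket X Y = X ** Y - Y ** X"

definition lie_subalgebra :: "(complex^'n::finite^'n) set \<Rightarrow> bool" where
  "lie_subalgebra L \<longleftrightarrow> 0 \<in> L \<and>
     (\<forall>X\<in>L. \<forall>Y\<in>L. X + Y \<in> L \<and> bracket X Y \<in> L) \<and> (\<forall>c. \<forall>X\<in>L. smat c X \<in> L)"

text \<open>
  Connectedness and simple connectedness are those of the classical topology on the complex
  points. For a complex algebraic group, being connected in the classical and in the Zariski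
  topology is the same, and being simply connected as an algebraic group means that the complex
  points are simply connected.
\<close>

definition closed_connected_subgroup ::
  "(complex^'n::finite^'n) set \<Rightarrow> (complex^'n^'n) set \<Rightarrow> bool" where
  "closed_connected_subgroup G K \<longleftrightarrow>
     subgroup K (matrix_group G) \<and> zariski_closed K \<and> connected K"

definition simple_algebraic_group :: "(complex^'n::finite^'n) set \<Rightarrow> bool" where
  "simple_algebraic_group G \<longleftrightarrow>
     algebraic_group G \<and> connected G \<and> \<not> comm_group (matrix_group G) \<and>
     (\<forall>K. closed_connected_subgroup G K \<and> K \<lhd> matrix_group G \<longrightarrow> K = {mat 1} \<or> K = G)"

definition borel_subgroup ::
  "(complex^'n::finite^'n) set \<Rightarrow> (complex^'n^'n) set \<Rightarrow> bool" where
  "borel_subgroup G B \<longleftrightarrow>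
     closed_connected_subgroup G B \<and> solvable (matrix_group B) \<and>
     (\<forall>K. closed_connected_subgroup G K \<and> solvable (matrix_group K) \<and> B \<subseteq> K \<longrightarrow> K = B)"

definition torus :: "(complex^'n::finite^'n) set \<Rightarrow> (complex^'n^'n) set \<Rightarrow> bool" where
  "torus G T \<longleftrightarrow>
     closed_connected_subgroup G T \<and>
     (\<exists>P :: complex^'n^'n. invertible P \<and>
        (\<forall>A\<in>T. \<forall>i j. i \<noteq> j \<longrightarrow> (P ** A ** matrix_inv P) $ i $ j = 0))"

definition maximal_torus ::
  "(complex^'n::finite^'n) set \<Rightarrow> (complex^'n^'n) set \<Rightarrow> bool" where
  "maximal_torus G T \<longleftrightarrow> torus G T \<and> (\<forall>K. torus G K \<and> T \<subseteq> K \<longrightarrow> K = T)"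

definition opposite_borels ::
  "(complex^'n::finite^'n) set \<Rightarrow> (complex^'n^'n) set \<Rightarrow> (complex^'n^'n) set \<Rightarrow> bool" where
  "opposite_borels G Bp Bm \<longleftrightarrow>
     borel_subgroup G Bp \<and> borel_subgroup G Bm \<and> maximal_torus G (Bp \<inter> Bm)"

definition nilradical :: "(complex^'n::finite^'n) set \<Rightarrow> (complex^'n^'n) set" where
  "nilradical B = lie_algebra (derived (matrix_group B) B)"

definition cartan_subalgebra ::
  "(complex^'n::finite^'n) set \<Rightarrow> (complex^'n^'n) set \<Rightarrow> (complex^'n^'n) set" where
  "cartan_subalgebra Bp Bm = lie_algebra (Bp \<inter> Bm)"


section \<open>Simple roots and Chevalley generators\<close>

text \<open>Weights are functions on matrices of which only the values on the Cartan subalgebra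
  matter.\<close>

definition positive_root ::
  "(complex^'n::finite^'n) set \<Rightarrow> (complex^'n^'n) set \<Rightarrow> (complex^'n^'n \<Rightarrow> complex) \<Rightarrow> bool" where
  "positive_root Bp Bm \<beta> \<longleftrightarrow>
     (\<exists>X\<in>nilradical Bp. X \<noteq> 0 \<and>
        (\<forall>T\<in>cartan_subalgebra Bp Bm. bracket T X = smat (\<beta> T) X))"

definition simple_root ::
  "(complex^'n::finite^'n) set \<Rightarrow> (complex^'n^'n) set \<Rightarrow> (complex^'n^'n \<Rightarrow> complex) \<Rightarrow> bool" where
  "simple_root Bp Bm \<beta> \<longleftrightarrow>
     positive_root Bp Bm \<beta> \<and>
     \<not> (\<exists>\<gamma> \<delta>. positive_root Bp Bm \<gamma> \<and> positive_root Bp Bm \<delta> \<and>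
          (\<forall>T\<in>cartan_subalgebra Bp Bm. \<beta> T = \<gamma> T + \<delta> T))"

definition simple_roots ::
  "(complex^'n::finite^'n) set \<Rightarrow> (complex^'n^'n) set \<Rightarrow> ('r \<Rightarrow> complex^'n^'n \<Rightarrow> complex) \<Rightarrow> bool"
  where
  "simple_roots Bp Bm \<alpha> \<longleftrightarrow>
     (\<forall>i. simple_root Bp Bm (\<alpha> i)) \<and>
     (\<forall>\<beta>. simple_root Bp Bm \<beta> \<longrightarrow>
        (\<exists>!i. \<forall>T\<in>cartan_subalgebra Bp Bm. \<beta> T = \<alpha> i T))"

text \<open>The third family h consists of the simple coroots.\<close>

definition chevalley_generators ::
  "(complex^'n::finite^'n) set \<Rightarrow> (complex^'n^'n) set \<Rightarrow> (complex^'n^'n) set \<Rightarrow>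
   ('r::finite \<Rightarrow> complex^'n^'n \<Rightarrow> complex) \<Rightarrow>
   ('r \<Rightarrow> complex^'n^'n) \<Rightarrow> ('r \<Rightarrow> complex^'n^'n) \<Rightarrow> ('r \<Rightarrow> complex^'n^'n) \<Rightarrow> bool" where
  "chevalley_generators G Bp Bm \<alpha> e f h \<longleftrightarrow>
     (\<forall>i. e i \<in> nilradical Bp \<and> f i \<in> nilradical Bm \<and> h i \<in> cartan_subalgebra Bp Bm) \<and>
     (\<forall>i. \<forall>T\<in>cartan_subalgebra Bp Bm.
        bracket T (e i) = smat (\<alpha> i T) (e i) \<and> bracket T (f i) = smat (- \<alpha> i T) (f i)) \<and>
     (\<forall>i j. bracket (e i) (f j) = (if i = j then h i else 0)) \<and>
     (\<forall>i. \<alpha> i (h i) = 2) \<and>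
     (\<forall>T\<in>cartan_subalgebra Bp Bm. \<exists>!c. T = (\<Sum>i\<in>UNIV. smat (c i) (h i))) \<and>
     (\<forall>L. lie_subalgebra L \<and> (\<forall>i. e i \<in> L \<and> f i \<in> L) \<longrightarrow> lie_algebra G \<subseteq> L)"

definition cartan_matrix ::
  "('r \<Rightarrow> complex^'n::finite^'n \<Rightarrow> complex) \<Rightarrow> ('r \<Rightarrow> complex^'n^'n) \<Rightarrow> ('r \<Rightarrow> 'r \<Rightarrow> int) \<Rightarrow> bool"
  where
  "cartan_matrix \<alpha> h a \<longleftrightarrow> (\<forall>i j. of_int (a i j) = \<alpha> j (h i))"


section \<open>Rational representations\<close>

text \<open>A rational representation is given by a matrix of regular functions on GL(n), of which
  only the restrictions to G matter.\<close>

definition rep_eval ::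
  "(complex \<Rightarrow> 'a::comm_ring_1) \<Rightarrow> ('n::finite gl_fun)^'m::finite^'m \<Rightarrow> 'a^'n^'n \<Rightarrow> 'a^'m^'m" where
  "rep_eval \<iota> \<rho> A = (\<chi> i j. gl_eval \<iota> (\<rho> $ i $ j) A)"

definition rep_deriv ::
  "(complex \<Rightarrow> 'a::comm_ring_1) \<Rightarrow> ('n::finite gl_fun)^'m::finite^'m \<Rightarrow> 'a^'n^'n \<Rightarrow> 'a^'m^'m" where
  "rep_deriv \<iota> \<rho> X = (\<chi> i j. gl_deriv \<iota> (\<rho> $ i $ j) X)"

definition rational_representation ::
  "(complex^'n::finite^'n) set \<Rightarrow> ('n gl_fun)^'m::finite^'m \<Rightarrow> bool" where
  "rational_representation G \<rho> \<longleftrightarrow>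
     rep_eval id \<rho> (mat 1) = mat 1 \<and>
     (\<forall>A\<in>G. \<forall>B\<in>G. rep_eval id \<rho> (A ** B) = rep_eval id \<rho> A ** rep_eval id \<rho> B)"

definition submodule ::
  "(complex^'n::finite^'n) set \<Rightarrow> ('n gl_fun)^'m::finite^'m \<Rightarrow> (complex^'m) set \<Rightarrow> bool" where
  "submodule G \<rho> U \<longleftrightarrow> vec.subspace U \<and> (\<forall>A\<in>G. \<forall>u\<in>U. rep_eval id \<rho> A *v u \<in> U)"

definition irreducible_submodule ::
  "(complex^'n::finite^'n) set \<Rightarrow> ('n gl_fun)^'m::finite^'m \<Rightarrow> (complex^'m) set \<Rightarrow> bool" where
  "irreducible_submodule G \<rho> U \<longleftrightarrow>
     submodule G \<rho> U \<and> U \<noteq> {0} \<and> (\<forall>U'. submodule G \<rho> U' \<and> U' \<subseteq> U \<longrightarrow> U' = {0} \<or> U' = U)"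

text \<open>
  The fundamental representations V i, with highest weight vectors nu i, are realised as
  submodules of one rational representation rho (for instance of their direct sum). The
  fundamental weight omega i takes the value 1 at the coroot h i and 0 at the other coroots.
\<close>

definition fundamental_representations ::
  "(complex^'n::finite^'n) set \<Rightarrow> (complex^'n^'n) set \<Rightarrow> ('r \<Rightarrow> complex^'n^'n) \<Rightarrow>
   ('n gl_fun)^'m::finite^'m \<Rightarrow> ('r \<Rightarrow> (complex^'m) set) \<Rightarrow> ('r \<Rightarrow> complex^'m) \<Rightarrow> bool" where
  "fundamental_representations G Bp h \<rho> V \<nu> \<longleftrightarrow>
     rational_representation G \<rho> \<and>
     (\<forall>i. irreducible_submodule G \<rho> (V i) \<and> \<nu> i \<in> V i \<and> \<nu> i \<noteq> 0 \<and>
        (\<forall>X\<in>nilradical Bp. rep_deriv id \<rho> X *v \<nu> i = 0) \<and>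
        (\<forall>j. rep_deriv id \<rho> (h j) *v \<nu> i = (if j = i then 1 else 0) *s \<nu> i))"


section \<open>Miura-Pluecker opers\<close>

definition const_matrix :: "complex^'n::finite^'n \<Rightarrow> ratfun^'n^'n" where
  "const_matrix = map_matrix ratfun_const"

definition const_vector :: "complex^'m::finite \<Rightarrow> ratfun^'m" where
  "const_vector v = (\<chi> i. ratfun_const (v $ i))"

text \<open>A connection d/dz + A(z) is represented by A.\<close>

definition miura_connection ::
  "('r::finite \<Rightarrow> complex poly) \<Rightarrow> ('r \<Rightarrow> complex^'n::finite^'n) \<Rightarrow> ('r \<Rightarrow> complex^'n^'n) \<Rightarrow>
   ('r \<Rightarrow> ratfun) \<Rightarrow> ratfun^'n^'n" where
  "miura_connection \<Lambda> e h g =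
     (\<Sum>i\<in>UNIV. smat (to_fract (\<Lambda> i)) (const_matrix (e i))) +
     (\<Sum>i\<in>UNIV. smat (g i) (const_matrix (h i)))"

definition miura_opers ::
  "('r::finite \<Rightarrow> complex poly) \<Rightarrow> ('r \<Rightarrow> complex^'n::finite^'n) \<Rightarrow> ('r \<Rightarrow> complex^'n^'n) \<Rightarrow>
   (ratfun^'n^'n) set" where
  "miura_opers \<Lambda> e h = {miura_connection \<Lambda> e h g |g. True}"

definition covariant_deriv :: "ratfun^'m::finite^'m \<Rightarrow> ratfun^'m \<Rightarrow> ratfun^'m" where
  "covariant_deriv A w = (\<chi> i. ratfun_deriv (w $ i)) + A *v w"

text \<open>W i with scalars extended to C(z).\<close>

definition plucker_space ::
  "('r \<Rightarrow> complex^'n::finite^'n) \<Rightarrow> ('n gl_fun)^'m::finite^'m \<Rightarrow> ('r \<Rightarrow> complex^'m) \<Rightarrow> 'r \<Rightarrow>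
   (ratfun^'m) set" where
  "plucker_space f \<rho> \<nu> i =
     vec.span {const_vector (\<nu> i), const_vector (rep_deriv id \<rho> (f i) *v \<nu> i)}"

text \<open>The two sides of the equation are the actions on W i of d/dz + A and of the conjugate
  of d/dz + Z by v.\<close>

definition miura_plucker ::
  "(complex^'n::finite^'n) set \<Rightarrow> ('r \<Rightarrow> complex^'n^'n) \<Rightarrow> ('n gl_fun)^'m::finite^'m \<Rightarrow>
   ('r \<Rightarrow> complex^'m) \<Rightarrow> complex^'n^'n \<Rightarrow> ratfun^'n^'n \<Rightarrow> bool" where
  "miura_plucker Bp f \<rho> \<nu> Z A \<longleftrightarrow>
     (\<exists>v\<in>ratfun_points Bp. \<forall>i. \<forall>w\<in>plucker_space f \<rho> \<nu> i.
        covariant_deriv (rep_deriv ratfun_const \<rho> A) w =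
        rep_eval ratfun_const \<rho> v *v
          covariant_deriv (rep_deriv ratfun_const \<rho> (const_matrix Z))
            (matrix_inv (rep_eval ratfun_const \<rho> v) *v w))"

definition nondegenerate_polys ::
  "('r \<Rightarrow> 'r \<Rightarrow> int) \<Rightarrow> ('r \<Rightarrow> complex poly) \<Rightarrow> ('r \<Rightarrow> complex poly) \<Rightarrow> bool" where
  "nondegenerate_polys a \<Lambda> y \<longleftrightarrow>
     (\<forall>i. lead_coeff (y i) = 1) \<and>
     (\<forall>i. rsquarefree (y i)) \<and>
     (\<forall>i. \<not> (\<exists>x. poly (y i) x = 0 \<and> poly (\<Lambda> i) x = 0)) \<and>
     (\<forall>i j. i \<noteq> j \<and> a i j \<noteq> 0 \<longrightarrow> \<not> (\<exists>x. poly (y i) x = 0 \<and> poly (y j) x = 0))"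

definition nondegenerate_oper ::
  "('r::finite \<Rightarrow> 'r \<Rightarrow> int) \<Rightarrow> ('r \<Rightarrow> complex poly) \<Rightarrow>
   ('r \<Rightarrow> complex^'n::finite^'n) \<Rightarrow> ('r \<Rightarrow> complex^'n^'n) \<Rightarrow> complex^'n^'n \<Rightarrow>
   ratfun^'n^'n \<Rightarrow> bool" where
  "nondegenerate_oper a \<Lambda> e h Z A \<longleftrightarrow>
     (\<exists>\<zeta> y. Z = (\<Sum>i\<in>UNIV. smat (\<zeta> i) (h i)) \<and> nondegenerate_polys a \<Lambda> y \<and>
        A = miura_connection \<Lambda> e h
              (\<lambda>i. ratfun_const (\<zeta> i) -
                 inverse (to_fract (y i)) * ratfun_deriv (to_fract (y i))))"

definition nondegenerate_miura_plucker_opers ::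
  "(complex^'n::finite^'n) set \<Rightarrow> ('r::finite \<Rightarrow> 'r \<Rightarrow> int) \<Rightarrow>
   ('r \<Rightarrow> complex^'n^'n) \<Rightarrow> ('r \<Rightarrow> complex^'n^'n) \<Rightarrow> ('r \<Rightarrow> complex^'n^'n) \<Rightarrow>
   ('n gl_fun)^'m::finite^'m \<Rightarrow> ('r \<Rightarrow> complex^'m) \<Rightarrow> ('r \<Rightarrow> complex poly) \<Rightarrow>
   complex^'n^'n \<Rightarrow> (ratfun^'n^'n) set" where
  "nondegenerate_miura_plucker_opers Bp a e f h \<rho> \<nu> \<Lambda> Z =
     {A \<in> miura_opers \<Lambda> e h. miura_plucker Bp f \<rho> \<nu> Z A \<and> nondegenerate_oper a \<Lambda> e h Z A}"


section \<open>The qq-system\<close>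

definition wronskian :: "complex poly \<Rightarrow> complex poly \<Rightarrow> complex poly" where
  "wronskian p q = p * pderiv q - q * pderiv p"

text \<open>The off-diagonal entries of a Cartan matrix are nonpositive, so nat does not truncate.\<close>

definition nondegenerate_qq_solutions ::
  "('r::finite \<Rightarrow> 'r \<Rightarrow> int) \<Rightarrow> ('r \<Rightarrow> complex^'n::finite^'n \<Rightarrow> complex) \<Rightarrow>
   ('r \<Rightarrow> complex poly) \<Rightarrow> complex^'n^'n \<Rightarrow> (('r \<Rightarrow> complex poly) \<times> ('r \<Rightarrow> complex poly)) set" where
  "nondegenerate_qq_solutions a \<alpha> \<Lambda> Z =
     {(qp, qm).
        (\<forall>i. wronskian (qp i) (qm i) + smult (\<alpha> i Z) (qp i * qm i) =
           \<Lambda> i * (\<Prod>j\<in>UNIV - {i}. qp j ^ nat (- a j i))) \<and>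
        nondegenerate_polys a \<Lambda> qp}"

end

theory Submission
  imports
    Defs
    "HOL-Complex_Analysis.Complex_Analysis"
    "HOL-Computational_Algebra.Field_as_Ring"
begin

text \<open>
  On W i the oper is upper triangular, and being gauge equivalent to the constant connection there
  amounts to a first order linear equation for the off-diagonal entry; its rational solutions are
  minus the quotients of the two polynomials of a solution of the qq-system, and since
  the y i have no multiple roots, all poles of such a solution are cancelled by y i.

  Given a solution, the gauge transformation is a product of coroots, evaluated at the y i, and of
  exponentials of the e i. Rational points of a closed subgroup are recognised by their values at
  all but finitely many z, and one-parameter subgroups with tangent vector in the Lie algebra lie
  in the group because all derivatives at 0 of an equation along them vanish.

  Conversely, the inverse of v embeds W i (not necessarily onto itself) into a system with constant
  coefficients, which is semisimple over the field of rational functions; hence W i splits, which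
  solves the off-diagonal equation.
\<close>

section \<open>Rational functions and their values\<close>

text \<open>In the basis of W i rescaled by the diagonal gauge transformation, the oper has the
  constant diagonal entries \<zeta>_i and \<zeta>_i - \<alpha>_i(Z), like the constant connection,
  and the off-diagonal entry rhs / y^2, where y = y i and rhs is the right-hand side of the
  qq-equation. Since (q / y)' + \<alpha>_i(Z) q / y = (W(y, q) + \<alpha>_i(Z) y q) / y^2, removing
  this entry amounts to solving the qq-equation for q.

  Two obstacles shape the rest. The coroots are given only as matrices \<open>h i\<close>;
  evaluating their exponentials at a rational function needs integral eigenvalues, which come from
  sl2 acting on the defining space. And the v of a Miura-Pluecker oper is an arbitrary rational
  point of B_+, given by equations and not as a product of exponentials; only the invertibility of
  its image is used, hence the detour through an embedding. Constant systems split because exp (z T)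
  is polynomial in z for nilpotent T, so the nilpotent part of the coefficient matrix can be gauged
  away.\<close>

lemma ratfun_deriv_to_fract [simp]: "ratfun_deriv (to_fract p) = to_fract (pderiv p)"
  unfolding to_fract_def by (simp add: ratfun_deriv_Fract)

lemma ratfun_deriv_0 [simp]: "ratfun_deriv 0 = 0"
  using ratfun_deriv_to_fract[of 0] by simp

lemma ratfun_deriv_1 [simp]: "ratfun_deriv 1 = 0"
  using ratfun_deriv_to_fract[of 1] by simp

lemma ratfun_deriv_add: "ratfun_deriv (x + y) = ratfun_deriv x + ratfun_deriv y"
proof (cases x, cases y)
  fix a b c d :: "complex poly"
  assume xy: "x = Fraction_Field.Fract a b" "b \<noteq> 0" "y = Fraction_Field.Fract c d" "d \<noteq> 0"
  have "ratfun_deriv (x + y)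
      = Fraction_Field.Fract (pderiv (a * d + c * b) * (b * d) - (a * d + c * b) * pderiv (b * d))
          ((b * d) * (b * d))"
    using xy by (simp add: ratfun_deriv_Fract)
  also have "\<dots> = ratfun_deriv x + ratfun_deriv y"
    using xy by (simp add: ratfun_deriv_Fract eq_fract pderiv_add pderiv_mult algebra_simps)
  finally show ?thesis .
qed

lemma ratfun_deriv_mult: "ratfun_deriv (x * y) = ratfun_deriv x * y + x * ratfun_deriv y"
proof (cases x, cases y)
  fix a b c d :: "complex poly"
  assume xy: "x = Fraction_Field.Fract a b" "b \<noteq> 0" "y = Fraction_Field.Fract c d" "d \<noteq> 0"
  have "ratfun_deriv (x * y)
      = Fraction_Field.Fract (pderiv (a * c) * (b * d) - (a * c) * pderiv (b * d))
          ((b * d) * (b * d))"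
    using xy by (simp add: ratfun_deriv_Fract)
  also have "\<dots> = ratfun_deriv x * y + x * ratfun_deriv y"
    using xy by (simp add: ratfun_deriv_Fract eq_fract pderiv_mult algebra_simps)
  finally show ?thesis .
qed

lemma ratfun_deriv_const_mult: "ratfun_deriv (ratfun_const c * x) = ratfun_const c * ratfun_deriv x"
  by (simp add: ratfun_deriv_mult)

lemma ratfun_deriv_uminus: "ratfun_deriv (- x) = - ratfun_deriv x"
  using ratfun_deriv_add[of x "- x"] by (simp add: add_eq_0_iff)

lemma ratfun_deriv_sum: "ratfun_deriv (\<Sum>i\<in>I. f i) = (\<Sum>i\<in>I. ratfun_deriv (f i))"
  by (induction I rule: infinite_finite_induct) (simp_all add: ratfun_deriv_add)

lemma ratfun_deriv_power:
  "ratfun_deriv (x ^ n) = of_nat n * x ^ (n - 1) * ratfun_deriv x"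
proof (induction n)
  case (Suc n)
  then show ?case
    by (cases n) (simp_all add: ratfun_deriv_mult algebra_simps)
qed simp

lemma fract_coprime_cases:
  fixes x :: ratfun
  obtains a b where "b \<noteq> 0" "coprime a b" "x = to_fract a / to_fract b"
proof -
  obtain a b where ab: "quot_of_fract x = (a, b)" by (cases "quot_of_fract x")
  have "coprime a b" "b \<noteq> 0"
    using coprime_quot_of_fract[of x] snd_quot_of_fract_nonzero[of x] ab by simp_all
  moreover have "x = to_fract a / to_fract b"
    using to_fract_quot_of_fract[of x] ab by (metis Fract_conv_to_fract Fract_quot_of_fract fst_conv snd_conv)
  ultimately show thesis using that by blast
qed

text \<open>In lowest terms a / b, a zero derivative makes b divide a b', hence b', which forces b
  to be constant by degrees.\<close>

lemma ratfun_deriv_eq_0_iff: "ratfun_deriv x = 0 \<longleftrightarrow> (\<exists>c. x = ratfun_const c)"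
proof
  assume D: "ratfun_deriv x = 0"
  obtain a b where ab: "b \<noteq> 0" "coprime a b" "x = to_fract a / to_fract b"
    by (rule fract_coprime_cases)
  then have x: "x = Fraction_Field.Fract a b" by (simp add: Fract_conv_to_fract)
  have eq: "pderiv a * b = a * pderiv b"
    using D ab(1) by (simp add: x ratfun_deriv_Fract[OF ab(1)] Zero_fract_def eq_fract del: ratfun_deriv_to_fract)
  then have "b dvd a * pderiv b" by (metis dvd_triv_right)
  then have "b dvd pderiv b" using ab coprime_dvd_mult_right_iff coprime_commute by blast
  then have "degree b = 0" by simp
  then obtain c where c: "b = [:c:]" by (rule degree_eq_zeroE)
  then have "pderiv a = 0" using eq ab by simp
  then obtain d where d: "a = [:d:]" using pderiv_iszero by blast
  have "x = ratfun_const (d / c)"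
    using ab unfolding x c d by (simp add: to_fract_def eq_fract)
  then show "\<exists>c. x = ratfun_const c" ..
qed auto

text \<open>The logarithmic derivative. At 0 it is 0 / 0 = 0, so the rules for inverses and powers
  hold without a nonvanishing hypothesis.\<close>

definition ratfun_ldiff :: "ratfun \<Rightarrow> ratfun" where
  "ratfun_ldiff x = ratfun_deriv x / x"

lemma ratfun_ldiff_1 [simp]: "ratfun_ldiff 1 = 0"
  by (simp add: ratfun_ldiff_def)

lemma ratfun_ldiff_mult:
  "x \<noteq> 0 \<Longrightarrow> y \<noteq> 0 \<Longrightarrow> ratfun_ldiff (x * y) = ratfun_ldiff x + ratfun_ldiff y"
  by (simp add: ratfun_ldiff_def ratfun_deriv_mult field_simps)

lemma ratfun_ldiff_inverse: "ratfun_ldiff (inverse x) = - ratfun_ldiff x"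
proof (cases "x = 0")
  case False
  then have "ratfun_ldiff x + ratfun_ldiff (inverse x) = 0"
    using ratfun_ldiff_mult[of x "inverse x"] by simp
  then show ?thesis by (simp add: eq_neg_iff_add_eq_0 add.commute)
qed (simp add: ratfun_ldiff_def)

lemma ratfun_ldiff_power: "ratfun_ldiff (x ^ n) = of_nat n * ratfun_ldiff x"
proof (cases "x = 0")
  case False
  then show ?thesis
    by (induction n) (simp_all add: ratfun_ldiff_mult algebra_simps)
qed (simp add: ratfun_ldiff_def power_0_left)

lemma ratfun_ldiff_powi: "ratfun_ldiff (x powi n) = of_int n * ratfun_ldiff x"
proof (cases "n \<ge> 0")
  case False
  then have "ratfun_ldiff (x powi n) = - of_nat (nat (- n)) * ratfun_ldiff x"
    by (simp add: power_int_def ratfun_ldiff_power ratfun_ldiff_inverse)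
  then show ?thesis using False by simp
qed (simp add: power_int_def ratfun_ldiff_power)

lemma ratfun_ldiff_prod:
  "(\<And>i. i \<in> I \<Longrightarrow> f i \<noteq> 0) \<Longrightarrow> ratfun_ldiff (\<Prod>i\<in>I. f i) = (\<Sum>i\<in>I. ratfun_ldiff (f i))"
  by (induction I rule: infinite_finite_induct) (simp_all add: ratfun_ldiff_mult)

text \<open>The value at a pole is junk, so identities between values only hold outside a finite set.\<close>

definition ev :: "ratfun \<Rightarrow> complex \<Rightarrow> complex" where
  "ev x z = poly (fst (quot_of_fract x)) z / poly (snd (quot_of_fract x)) z"

lemma eventually_poly_nonzero: "p \<noteq> 0 \<Longrightarrow> \<forall>\<^sub>F z in cofinite. poly (p :: complex poly) z \<noteq> 0"
  by (simp add: eventually_cofinite poly_roots_finite)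

lemma ev_to_fract [simp]: "ev (to_fract p) z = poly p z"
  by (simp add: ev_def)

lemma to_fract_power: "to_fract (p ^ n) = to_fract p ^ n"
  by (induction n) simp_all

lemma ev_0 [simp]: "ev 0 z = 0"
  using ev_to_fract[of 0 z] by simp

lemma ev_1 [simp]: "ev 1 z = 1"
  using ev_to_fract[of 1 z] by simp

lemma ev_Fract:
  assumes "b \<noteq> 0"
  shows "\<forall>\<^sub>F z in cofinite. ev (Fraction_Field.Fract a b) z = poly a z / poly b z"
proof -
  define c d where "c = fst (quot_of_fract (Fraction_Field.Fract a b))"
    and "d = snd (quot_of_fract (Fraction_Field.Fract a b))"
  have d: "d \<noteq> 0" by (simp add: d_def)
  have "Fraction_Field.Fract a b = Fraction_Field.Fract c d"
    by (simp add: c_def d_def Fract_quot_of_fract)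
  then have "a * d = c * b" using d assms by (simp add: eq_fract)
  then have *: "poly a z * poly d z = poly c z * poly b z" for z by (metis poly_mult)
  show ?thesis
    using eventually_poly_nonzero[OF d] eventually_poly_nonzero[OF assms]
  proof eventually_elim
    case (elim z)
    then show ?case using *[of z] by (simp add: ev_def c_def d_def field_simps)
  qed
qed

lemma ev_add: "\<forall>\<^sub>F z in cofinite. ev (x + y) z = ev x z + ev y z"
proof (cases x, cases y)
  fix a b c d :: "complex poly"
  assume xy: "x = Fraction_Field.Fract a b" "b \<noteq> 0" "y = Fraction_Field.Fract c d" "d \<noteq> 0"
  have bd: "b * d \<noteq> 0" using xy by simp
  show ?thesis
    using ev_Fract[OF xy(2), of a] ev_Fract[OF xy(4), of c] ev_Fract[OF bd, of "a * d + c * b"]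
      eventually_poly_nonzero[OF xy(2)] eventually_poly_nonzero[OF xy(4)]
    by eventually_elim (simp add: xy add_frac_eq mult.commute)
qed

lemma ev_mult: "\<forall>\<^sub>F z in cofinite. ev (x * y) z = ev x z * ev y z"
proof (cases x, cases y)
  fix a b c d :: "complex poly"
  assume xy: "x = Fraction_Field.Fract a b" "b \<noteq> 0" "y = Fraction_Field.Fract c d" "d \<noteq> 0"
  have bd: "b * d \<noteq> 0" using xy by simp
  show ?thesis
    using ev_Fract[OF xy(2), of a] ev_Fract[OF xy(4), of c] ev_Fract[OF bd, of "a * c"]
    by eventually_elim (simp add: xy)
qed

lemma ev_nonzero:
  assumes "x \<noteq> 0"
  shows "\<forall>\<^sub>F z in cofinite. ev x z \<noteq> 0"
proof -
  have "\<forall>\<^sub>F z in cofinite. ev (x * inverse x) z = ev x z * ev (inverse x) z"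
    by (rule ev_mult)
  then show ?thesis using assms by (auto elim: eventually_mono)
qed

lemma ev_uminus: "\<forall>\<^sub>F z in cofinite. ev (- x) z = - ev x z"
  using ev_add[of x "- x"] by (auto elim!: eventually_mono simp: add_eq_0_iff)

lemma ev_inverse: "\<forall>\<^sub>F z in cofinite. ev (inverse x) z = inverse (ev x z)"
proof (cases "x = 0")
  case False
  then show ?thesis
    using ev_mult[of x "inverse x"] by (auto elim!: eventually_mono simp: inverse_unique)
qed simp

lemma ev_diff: "\<forall>\<^sub>F z in cofinite. ev (x - y) z = ev x z - ev y z"
  using ev_add[of x "- y"] ev_uminus[of y] by eventually_elim simp

text \<open>Frequently in the cofinite filter means at infinitely many points, and a nonzero
  rational function vanishes only finitely often.\<close>

lemma ev_eqI:
  assumes "\<exists>\<^sub>F z in cofinite. ev x z = ev y z"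
  shows "x = y"
proof (rule ccontr)
  assume "x \<noteq> y"
  then have "\<forall>\<^sub>F z in cofinite. ev (x - y) z \<noteq> 0" by (intro ev_nonzero) simp
  then have "\<forall>\<^sub>F z in cofinite. ev x z \<noteq> ev y z"
    using ev_diff[of x y] by eventually_elim simp
  then show False using assms by (simp add: frequently_def)
qed

lemma cofinite_complex [simp]: "cofinite \<noteq> (bot :: complex filter)"
  by (simp add: infinite_UNIV_char_0)

lemma ev_eqI': "\<forall>\<^sub>F z in cofinite. ev x z = ev y z \<Longrightarrow> x = y"
  by (intro ev_eqI eventually_frequently cofinite_complex)

lemma ev_sum: "\<forall>\<^sub>F z in cofinite. ev (\<Sum>i\<in>I. f i) z = (\<Sum>i\<in>I. ev (f i) z)"
proof (induction I rule: infinite_finite_induct)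
  case (insert i I)
  have "\<forall>\<^sub>F z in cofinite. ev (f i + sum f I) z = ev (f i) z + (\<Sum>i\<in>I. ev (f i) z)"
    using ev_add[of "f i" "sum f I"] insert.IH by eventually_elim simp
  then show ?case using insert.hyps by simp
qed simp_all

lemma ev_power: "\<forall>\<^sub>F z in cofinite. ev (x ^ n) z = ev x z ^ n"
proof (induction n)
  case (Suc n)
  have "\<forall>\<^sub>F z in cofinite. ev (x * x ^ n) z = ev x z * ev x z ^ n"
    using ev_mult[of x "x ^ n"] Suc.IH by eventually_elim simp
  then show ?case by simp
qed simp

lemma ev_powi: "\<forall>\<^sub>F z in cofinite. ev (x powi n) z = ev x z powi n"
  using ev_power[of x "nat n"] ev_power[of "inverse x" "nat (- n)"] ev_inverse[of x]
  by eventually_elim (simp add: power_int_def)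

section \<open>Values of vectors and matrices of rational functions\<close>

definition evv :: "ratfun^'m::finite \<Rightarrow> complex \<Rightarrow> complex^'m" where
  "evv w z = (\<chi> i. ev (w $ i) z)"

definition evm :: "ratfun^'m::finite^'n::finite \<Rightarrow> complex \<Rightarrow> complex^'m^'n" where
  "evm A z = (\<chi> i j. ev (A $ i $ j) z)"

lemma evm_nth [simp]: "evm A z $ i $ j = ev (A $ i $ j) z"
  by (simp add: evm_def)

lemma evv_nth [simp]: "evv A z $ i = ev (A $ i) z"
  by (simp add: evv_def)

lemma evm_eqI:
  assumes "\<forall>\<^sub>F z in cofinite. evm A z = evm B z"
  shows "A = B"
proof -
  have "A $ i $ j = B $ i $ j" for i j
    by (rule ev_eqI', rule eventually_mono[OF assms]) (metis evm_nth)
  then show ?thesis by (simp add: vec_eq_iff)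
qed

lemma evv_eqI:
  assumes "\<forall>\<^sub>F z in cofinite. evv A z = evv B z"
  shows "A = B"
proof -
  have "A $ i = B $ i" for i
    by (rule ev_eqI', rule eventually_mono[OF assms]) (metis evv_nth)
  then show ?thesis by (simp add: vec_eq_iff)
qed

lemma ev_sum_mult:
  "\<forall>\<^sub>F z in cofinite. ev (\<Sum>k\<in>(UNIV::'k::finite set). f k * g k) z = (\<Sum>k\<in>UNIV. ev (f k) z * ev (g k) z)"
proof -
  have "\<forall>\<^sub>F z in cofinite. \<forall>k::'k. ev (f k * g k) z = ev (f k) z * ev (g k) z"
    by (intro eventually_all_finite ev_mult)
  then show ?thesis using ev_sum[of "\<lambda>k. f k * g k" UNIV] by eventually_elim simp
qed

lemma evm_mult: "\<forall>\<^sub>F z in cofinite. evm (A ** B) z = evm A z ** evm B z"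
proof -
  have "\<forall>\<^sub>F z in cofinite. \<forall>i j. ev ((A ** B) $ i $ j) z = (\<Sum>k\<in>UNIV. ev (A $ i $ k) z * ev (B $ k $ j) z)"
    by (intro eventually_all_finite) (simp add: matrix_matrix_mult_def ev_sum_mult)
  then show ?thesis
    by (rule eventually_mono) (simp add: vec_eq_iff matrix_matrix_mult_def)
qed

lemma evv_mult: "\<forall>\<^sub>F z in cofinite. evv (A *v w) z = evm A z *v evv w z"
proof -
  have "\<forall>\<^sub>F z in cofinite. \<forall>i. ev ((A *v w) $ i) z = (\<Sum>k\<in>UNIV. ev (A $ i $ k) z * ev (w $ k) z)"
    by (intro eventually_all_finite) (simp add: matrix_vector_mult_def ev_sum_mult)
  then show ?thesis
    by (rule eventually_mono) (simp add: vec_eq_iff matrix_vector_mult_def)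
qed

lemma evm_add: "\<forall>\<^sub>F z in cofinite. evm (A + B) z = evm A z + evm B z"
proof -
  have "\<forall>\<^sub>F z in cofinite. \<forall>i j. ev ((A + B) $ i $ j) z = ev (A $ i $ j) z + ev (B $ i $ j) z"
    by (intro eventually_all_finite) (simp add: ev_add)
  then show ?thesis by (rule eventually_mono) (simp add: vec_eq_iff)
qed

lemma evv_add: "\<forall>\<^sub>F z in cofinite. evv (A + B) z = evv A z + evv B z"
proof -
  have "\<forall>\<^sub>F z in cofinite. \<forall>i. ev ((A + B) $ i) z = ev (A $ i) z + ev (B $ i) z"
    by (intro eventually_all_finite) (simp add: ev_add)
  then show ?thesis by (rule eventually_mono) (simp add: vec_eq_iff)
qed

lemma evv_scale: "\<forall>\<^sub>F z in cofinite. evv (c *s A) z = ev c z *s evv A z"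
proof -
  have "\<forall>\<^sub>F z in cofinite. \<forall>i. ev ((c *s A) $ i) z = ev c z * ev (A $ i) z"
    by (intro eventually_all_finite) (simp add: ev_mult)
  then show ?thesis by (rule eventually_mono) (simp add: vec_eq_iff)
qed

lemma evm_smat: "\<forall>\<^sub>F z in cofinite. evm (smat c A) z = smat (ev c z) (evm A z)"
proof -
  have "\<forall>\<^sub>F z in cofinite. \<forall>i j. ev (smat c A $ i $ j) z = ev c z * ev (A $ i $ j) z"
    by (intro eventually_all_finite) (simp add: ev_mult smat_def map_matrix_def)
  then show ?thesis by (rule eventually_mono) (simp add: vec_eq_iff smat_def map_matrix_def)
qed

lemma evm_sum: "\<forall>\<^sub>F z in cofinite. evm (\<Sum>i\<in>I. f i) z = (\<Sum>i\<in>I. evm (f i) z)"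
proof (induction I rule: infinite_finite_induct)
  case (insert i I)
  have "\<forall>\<^sub>F z in cofinite. evm (f i + sum f I) z = evm (f i) z + (\<Sum>i\<in>I. evm (f i) z)"
    using evm_add[of "f i" "sum f I"] insert.IH by eventually_elim simp
  then show ?case using insert.hyps by simp
qed (simp_all add: vec_eq_iff)

lemma evm_const [simp]: "evm (const_matrix A) z = A"
  by (simp add: vec_eq_iff const_matrix_def map_matrix_def)

lemma evv_const [simp]: "evv (const_vector A) z = A"
  by (simp add: vec_eq_iff const_vector_def)

lemma evm_mat_1 [simp]: "evm (mat 1) z = mat 1"
  by (simp add: vec_eq_iff mat_def)

lemma matrix_inv_eqI:
  fixes A B :: "'a::field^'n::finite^'n"
  assumes AB: "A ** B = mat 1"
  shows "matrix_inv A = B" "invertible A"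
proof -
  have BA: "B ** A = mat 1" using AB by (simp add: matrix_left_right_inverse)
  then show "invertible A" using AB by (auto simp: invertible_def)
  have "A ** matrix_inv A = mat 1 \<and> matrix_inv A ** A = mat 1"
    unfolding matrix_inv_def 
    by (rule someI[of "\<lambda>X. A ** X = mat 1 \<and> X ** A = mat 1" B]) (simp add: AB BA)
  then have "B ** (A ** matrix_inv A) = B" by simp
  then have "B ** A ** matrix_inv A = B" by (simp only: matrix_mul_assoc)
  then show "matrix_inv A = B" by (simp add: BA matrix_mul_lid)
qed

lemma matrix_inv_right:
  fixes A :: "'a::field^'n::finite^'n"
  assumes "invertible A"
  shows "A ** matrix_inv A = mat 1" "matrix_inv A ** A = mat 1"
proof -
  obtain B where B: "A ** B = mat 1" "B ** A = mat 1" using assms by (auto simp: invertible_def)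
  then show "A ** matrix_inv A = mat 1" "matrix_inv A ** A = mat 1"
    using matrix_inv_eqI(1)[OF B(1)] by simp_all
qed

text \<open>The identity A A^-1 = 1 specialises at almost every z, and a one-sided inverse of a
  square matrix is the inverse.\<close>

lemma evm_inv:
  fixes A :: "ratfun^'n::finite^'n"
  assumes "invertible A"
  shows "\<forall>\<^sub>F z in cofinite. invertible (evm A z) \<and> matrix_inv (evm A z) = evm (matrix_inv A) z"
  using evm_mult[of A "matrix_inv A"]
proof eventually_elim
  case (elim z)
  then have "evm A z ** evm (matrix_inv A) z = mat 1"
    using matrix_inv_right(1)[OF assms] by (metis evm_mat_1)
  then show ?case using matrix_inv_eqI by blast
qed

section \<open>Regular functions\<close>

text \<open>The induction principle behind the later statements on polynomial evaluation: a relation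
  that contains constants and coordinates and respects the ring operations contains all evaluations.
  It relates families rather than elements, so that \<open>Q\<close> may speak of derivatives or of
  almost all z. A property of one family alone is obtained with a dummy second family over
  \<open>unit\<close>.\<close>

lemma poly_eval_rel:
  fixes \<iota> :: "'t \<Rightarrow> complex \<Rightarrow> 'a::comm_ring_1" and \<kappa> :: "'s \<Rightarrow> complex \<Rightarrow> 'b::comm_ring_1"
  assumes zero: "Q (\<lambda>_. 0) (\<lambda>_. 0)" and one: "Q (\<lambda>_. 1) (\<lambda>_. 1)"
    and add: "\<And>f f' g g'. Q f g \<Longrightarrow> Q f' g' \<Longrightarrow> Q (\<lambda>t. f t + f' t) (\<lambda>s. g s + g' s)"
    and mult: "\<And>f f' g g'. Q f g \<Longrightarrow> Q f' g' \<Longrightarrow> Q (\<lambda>t. f t * f' t) (\<lambda>s. g s * g' s)"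
    and const: "\<And>c. Q (\<lambda>t. \<iota> t c) (\<lambda>s. \<kappa> s c)"
    and var: "\<And>v. Q (\<lambda>t. x t v) (\<lambda>s. y s v)"
  shows "Q (\<lambda>t. poly_eval (\<iota> t) (x t) p) (\<lambda>s. poly_eval (\<kappa> s) (y s) p)"
proof -
  have sum: "Q (\<lambda>t. \<Sum>i\<in>I. f i t) (\<lambda>s. \<Sum>i\<in>I. g i s)" if "\<And>i. Q (f i) (g i)"
    for f g and I :: "('c \<Rightarrow>\<^sub>0 nat) set"
  proof (induction I rule: infinite_finite_induct)
    case (insert i I)
    then show ?case using add[OF that[of i] insert.IH] by simp
  qed (simp_all add: zero)
  have prod: "Q (\<lambda>t. \<Prod>i\<in>I. f i t) (\<lambda>s. \<Prod>i\<in>I. g i s)" if "\<And>i. Q (f i) (g i)"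
    for f g and I :: "'c set"
  proof (induction I rule: infinite_finite_induct)
    case (insert i I)
    then show ?case using mult[OF that[of i] insert.IH] by simp
  qed (simp_all add: one)
  have power: "Q (\<lambda>t. f t ^ n) (\<lambda>s. g s ^ n)" if "Q f g" for f g n
    by (induction n) (simp_all add: one mult[OF that])
  show ?thesis
    unfolding poly_eval_def by (intro sum mult const prod power var)
qed

section \<open>Complex evaluation as a ring homomorphism\<close>

lemma prod_keys_superset:
  assumes "finite S" "Poly_Mapping.keys m \<subseteq> S"
  shows "(\<Prod>v\<in>Poly_Mapping.keys m. x v ^ Poly_Mapping.lookup m v)
       = (\<Prod>v\<in>S. (x v :: 'a::comm_monoid_mult) ^ Poly_Mapping.lookup m v)"
  using assms by (intro prod.mono_neutral_left) (auto simp: in_keys_iff)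

lemma prod_keys_add:
  "(\<Prod>v\<in>Poly_Mapping.keys (m + n). x v ^ Poly_Mapping.lookup (m + n) v) =
   (\<Prod>v\<in>Poly_Mapping.keys m. (x v :: 'a::comm_monoid_mult) ^ Poly_Mapping.lookup m v) *
   (\<Prod>v\<in>Poly_Mapping.keys n. x v ^ Poly_Mapping.lookup n v)"
proof -
  let ?S = "Poly_Mapping.keys m \<union> Poly_Mapping.keys n"
  have "Poly_Mapping.keys (m + n) \<subseteq> ?S" by (rule keys_add)
  then have "(\<Prod>v\<in>Poly_Mapping.keys (m + n). x v ^ Poly_Mapping.lookup (m + n) v)
     = (\<Prod>v\<in>?S. x v ^ Poly_Mapping.lookup (m + n) v)"
    by (intro prod_keys_superset) auto
  then show ?thesis
    by (simp add: prod_keys_superset[of ?S m] prod_keys_superset[of ?S n]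
        lookup_add power_add prod.distrib)
qed

lemma poly_eval_superset:
  assumes "finite S" "Poly_Mapping.keys p \<subseteq> S"
  shows "poly_eval id x p = (\<Sum>m\<in>S. Poly_Mapping.lookup p m *
           (\<Prod>v\<in>Poly_Mapping.keys m. x v ^ Poly_Mapping.lookup m v))"
  unfolding poly_eval_def using assms
  by (simp, intro sum.mono_neutral_left) (auto simp: in_keys_iff)

lemma poly_eval_0 [simp]: "poly_eval id x 0 = 0"
  by (simp add: poly_eval_def)

lemma poly_eval_add: "poly_eval id x (p + q) = poly_eval id x p + poly_eval id x q"
proof -
  let ?S = "Poly_Mapping.keys p \<union> Poly_Mapping.keys q"
  have "Poly_Mapping.keys (p + q) \<subseteq> ?S" by (rule keys_add)
  then show ?thesis
    by (simp add: poly_eval_superset[of ?S] lookup_add sum.distrib distrib_right)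
qed

lemma poly_eval_sum: "poly_eval id x (sum p I) = (\<Sum>i\<in>I. poly_eval id x (p i))"
  using sum_comp_morphism[of "poly_eval id x" p I] by (simp add: poly_eval_add o_def)

lemma poly_eval_single:
  "poly_eval id x (Poly_Mapping.single m c)
     = c * (\<Prod>v\<in>Poly_Mapping.keys m. x v ^ Poly_Mapping.lookup m v)"
  by (cases "c = 0") (simp_all add: poly_eval_def)

lemma poly_mapping_eq_sum_single:
  "p = (\<Sum>m\<in>Poly_Mapping.keys p. Poly_Mapping.single m (Poly_Mapping.lookup p m))"
proof (rule poly_mapping_eqI)
  fix k
  show "Poly_Mapping.lookup p k
      = Poly_Mapping.lookup (\<Sum>m\<in>Poly_Mapping.keys p. Poly_Mapping.single m (Poly_Mapping.lookup p m)) k"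
    by (simp add: lookup_sum lookup_single when_def in_keys_iff)
qed

lemma poly_eval_mult:
  "poly_eval id x (p * q) = poly_eval id x p * poly_eval id x q"
proof -
  have "poly_eval id x (p * q) = poly_eval id x
     ((\<Sum>m\<in>Poly_Mapping.keys p. Poly_Mapping.single m (Poly_Mapping.lookup p m)) *
      (\<Sum>n\<in>Poly_Mapping.keys q. Poly_Mapping.single n (Poly_Mapping.lookup q n)))"
    using poly_mapping_eq_sum_single[of p] poly_mapping_eq_sum_single[of q] by simp
  also have "\<dots> = poly_eval id x p * poly_eval id x q"
    by (simp add: sum_product mult_single poly_eval_sum poly_eval_single prod_keys_add)
      (simp add: poly_eval_def sum_product mult_ac)
  finally show ?thesis .
qed

abbreviation pair_eval :: "'n::finite gl_fun \<Rightarrow> complex^'n^'n \<Rightarrow> complex^'n^'n \<Rightarrow> complex" where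
  "pair_eval p A B \<equiv> poly_eval id (gl_coords A B) p"

text \<open>The second argument stands for the inverse of the first but is kept independent.
  Translation and differentiation are then polynomial operations on pairs, and curves whose partners
  are inverse only to first order are allowed.\<close>

definition regular :: "(complex^'n::finite^'n \<Rightarrow> complex^'n^'n \<Rightarrow> complex) \<Rightarrow> bool" where
  "regular F \<longleftrightarrow> (\<exists>p. \<forall>A B. F A B = pair_eval p A B)"

lemma regularE:
  assumes "regular F"
  obtains p where "\<And>A B. F A B = pair_eval p A B"
  using assms unfolding regular_def by blast

lemma regular_pair_eval: "regular (pair_eval p)"
  unfolding regular_def by blast

lemma regular_const: "regular (\<lambda>A B. c)"
  unfolding regular_def
  by (rule exI[of _ "Poly_Mapping.single 0 c"]) (simp add: poly_eval_single)

lemma regular_add: "regular F \<Longrightarrow> regular F' \<Longrightarrow> regular (\<lambda>A B. F A B + F' A B)"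
  unfolding regular_def using poly_eval_add by metis

lemma regular_mult: "regular F \<Longrightarrow> regular F' \<Longrightarrow> regular (\<lambda>A B. F A B * F' A B)"
  unfolding regular_def using poly_eval_mult by metis

lemma regular_sum: "(\<And>i. regular (F i)) \<Longrightarrow> regular (\<lambda>A B. \<Sum>i\<in>I. F i A B)"
  by (induction I rule: infinite_finite_induct) (simp_all add: regular_const regular_add)

lemma regular_coord:
  "regular (\<lambda>A B. gl_coords A B v)"
  unfolding regular_def
  by (rule exI[of _ "Poly_Mapping.single (Poly_Mapping.single v 1) 1"])
    (simp add: poly_eval_single)

lemma regular_fst: "regular (\<lambda>A B. A $ i $ j)"
  using regular_coord[of "Inl (i, j)"] by (simp add: gl_coords_def)

lemma regular_snd: "regular (\<lambda>A B. B $ i $ j)"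
  using regular_coord[of "Inr (i, j)"] by (simp add: gl_coords_def)

text \<open>Left translation by A, with B in the role of the inverse of A: the inverse of A U is
  then V B.\<close>

lemma regular_translate:
  assumes "regular F"
  shows "regular (\<lambda>U V. F (A ** U) (V ** B))"
proof -
  obtain p where p: "\<And>A B. F A B = pair_eval p A B" using regularE[OF assms] by blast
  have v: "regular (\<lambda>U V. gl_coords (A ** U) (V ** B) v)" for v
  proof (cases v)
    case (Inl w)
    then show ?thesis
      by (cases w) (auto simp: gl_coords_def matrix_matrix_mult_def
          intro!: regular_sum regular_mult regular_const regular_fst)
  next
    case (Inr w)
    then show ?thesis
      by (cases w) (auto simp: gl_coords_def matrix_matrix_mult_def
          intro!: regular_sum regular_mult regular_const regular_snd)
  qed
  have "(\<lambda>(f :: _ \<Rightarrow> complex) (g :: unit \<Rightarrow> complex). regular (\<lambda>U V. f (U, V)))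
     (\<lambda>t. poly_eval id (gl_coords (A ** fst t) (snd t ** B)) p)
     (\<lambda>s. poly_eval id (\<lambda>_. 0) p)"
    by (rule poly_eval_rel[where \<iota> = "\<lambda>_. id" and \<kappa> = "\<lambda>_. id" and y = "\<lambda>_ _. 0"
          and x = "\<lambda>t. gl_coords (A ** fst t) (snd t ** B)"])
      (auto intro: regular_const regular_add regular_mult v)
  then show ?thesis by (simp add: p)
qed

section \<open>Derivatives of regular functions\<close>

definition entry_deriv ::
  "(complex \<Rightarrow> complex^'m::finite^'n::finite) \<Rightarrow> complex^'m^'n \<Rightarrow> complex \<Rightarrow> bool" where
  "entry_deriv c D t \<longleftrightarrow> (\<forall>i j. ((\<lambda>s. c s $ i $ j) has_field_derivative D $ i $ j) (at t))"

lemma entry_deriv_mult: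
  assumes "entry_deriv c C t" "entry_deriv d D t"
  shows "entry_deriv (\<lambda>s. c s ** d s) (C ** d t + c t ** D) t"
  using assms unfolding entry_deriv_def matrix_matrix_mult_def
  by (auto intro!: derivative_eq_intros simp: sum.distrib mult.commute)

lemma entry_deriv_const: "entry_deriv (\<lambda>s. A) 0 t"
  by (simp add: entry_deriv_def)

lemma entry_deriv_unique: "entry_deriv c C t \<Longrightarrow> entry_deriv c D t \<Longrightarrow> C = D"
  unfolding entry_deriv_def vec_eq_iff using DERIV_unique by blast

lemma entry_deriv_line: "entry_deriv (\<lambda>s. A + smat s X) X t"
  unfolding entry_deriv_def smat_def map_matrix_def
  by (auto intro!: derivative_eq_intros)

lemma entry_deriv_reflect:
  assumes "entry_deriv c C (- t)"
  shows "entry_deriv (\<lambda>s. c (- s)) (- C) t"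
  unfolding entry_deriv_def
proof (intro allI)
  fix i j
  have "((\<lambda>s. c s $ i $ j) has_field_derivative C $ i $ j) (at (- t))"
    using assms unfolding entry_deriv_def by blast
  then have "((\<lambda>s. c (- s) $ i $ j) has_field_derivative C $ i $ j * (- 1)) (at t)"
    by (intro DERIV_chain2[where g = uminus and f = "\<lambda>s. c s $ i $ j"])
      (auto intro!: derivative_eq_intros)
  then show "((\<lambda>s. c (- s) $ i $ j) has_field_derivative (- C) $ i $ j) (at t)" by simp
qed

text \<open>At time t, the curve c follows the left-invariant vector field of X, and d satisfies the
  equation (c^-1)' = - X c^-1 of its inverse.\<close>

definition tangent_curve ::
  "complex^'n::finite^'n \<Rightarrow> (complex \<Rightarrow> complex^'n^'n) \<Rightarrow> (complex \<Rightarrow> complex^'n^'n) \<Rightarrow> complex \<Rightarrow> bool"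
  where
  "tangent_curve X c d t \<longleftrightarrow> entry_deriv c (c t ** X) t \<and> entry_deriv d (- (X ** d t)) t"

lemma regular_uminus: "regular F \<Longrightarrow> regular (\<lambda>A B. - F A B)"
  using regular_mult[OF regular_const[of "- 1"], of F] by simp

definition left_deriv ::
  "complex^'n::finite^'n \<Rightarrow> (complex^'n^'n \<Rightarrow> complex^'n^'n \<Rightarrow> complex) \<Rightarrow>
   (complex^'n^'n \<Rightarrow> complex^'n^'n \<Rightarrow> complex) \<Rightarrow> bool" where
  "left_deriv X F D \<longleftrightarrow> (\<forall>c d t. tangent_curve X c d t \<longrightarrow>
     ((\<lambda>s. F (c s) (d s)) has_field_derivative D (c t) (d t)) (at t))"

text \<open>Left-invariant derivations preserve regular functions: they send the coordinate A_ij to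
  (A X)_ij and B_ij to - (X B)_ij, and the product rule does the rest. This makes iterated
  derivatives along a curve accessible.\<close>

lemma regular_left_deriv:
  fixes X :: "complex^'n::finite^'n"
  obtains q where "left_deriv X (pair_eval p) (pair_eval q)"
proof -
  \<comment> \<open>Regularity of the function itself is carried along because the product rule
    multiplies each derivative by the other factor.\<close>
  define Q where "Q = (\<lambda>(f :: (complex^'n^'n) \<times> (complex^'n^'n) \<Rightarrow> complex) (g :: unit \<Rightarrow> complex).
     regular (curry f) \<and> (\<exists>D. regular D \<and> left_deriv X (curry f) D))"
  have const: "Q (\<lambda>_. a) (\<lambda>_. b)" for a b
    unfolding Q_def left_deriv_def
    by (auto simp: curry_def intro!: regular_const exI[of _ "\<lambda>A B. 0"])
  have add: "Q (\<lambda>t. f t + f' t) (\<lambda>s. g s + g' s)" if QQ: "Q f g" "Q f' g'" for f f' g g'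
  proof -
    obtain D D' where D: "regular D" "regular D'" "left_deriv X (curry f) D" "left_deriv X (curry f') D'"
      using QQ unfolding Q_def by blast
    then have "left_deriv X (curry (\<lambda>t. f t + f' t)) (\<lambda>A B. D A B + D' A B)"
      unfolding left_deriv_def by (auto intro: DERIV_add)
    moreover have "regular (curry (\<lambda>t. f t + f' t))"
      using QQ unfolding Q_def curry_def by (auto intro: regular_add)
    ultimately show ?thesis
      unfolding Q_def using regular_add[OF D(1,2)] by blast
  qed
  have mult: "Q (\<lambda>t. f t * f' t) (\<lambda>s. g s * g' s)" if QQ: "Q f g" "Q f' g'" for f f' g g'
  proof -
    obtain D D' where D: "regular D" "regular D'" "left_deriv X (curry f) D" "left_deriv X (curry f') D'"
      using QQ unfolding Q_def by blast
    have reg: "regular (curry f)" "regular (curry f')" using QQ unfolding Q_def by auto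
    have "left_deriv X (curry (\<lambda>t. f t * f' t)) (\<lambda>A B. D A B * curry f' A B + D' A B * curry f A B)"
      using D(3,4) unfolding left_deriv_def by (auto intro: DERIV_mult)
    moreover have "regular (curry (\<lambda>t. f t * f' t))"
      using reg unfolding curry_def by (auto intro: regular_mult)
    moreover have "regular (\<lambda>A B. D A B * curry f' A B + D' A B * curry f A B)"
      by (intro regular_add regular_mult D reg)
    ultimately show ?thesis unfolding Q_def by blast
  qed
  have var: "Q (\<lambda>t. gl_coords (fst t) (snd t) v) (\<lambda>s. 0)" for v
  proof (cases v)
    case (Inl w)
    obtain i j where w: "w = (i, j)" by (cases w)
    have "regular (\<lambda>A B. (A ** X) $ i $ j)"
      unfolding matrix_matrix_mult_def
      by (auto intro!: regular_sum regular_mult regular_const regular_fst)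
    moreover have c: "curry (\<lambda>t. gl_coords (fst t) (snd t) v) = (\<lambda>A B. A $ i $ j)"
      by (auto simp: fun_eq_iff Inl w gl_coords_def)
    moreover have "left_deriv X (\<lambda>A B. A $ i $ j) (\<lambda>A B. (A ** X) $ i $ j)"
      unfolding left_deriv_def tangent_curve_def entry_deriv_def by blast
    ultimately show ?thesis unfolding Q_def c using regular_fst[of i j] by blast
  next
    case (Inr w)
    obtain i j where w: "w = (i, j)" by (cases w)
    have "regular (\<lambda>A B. (- (X ** B)) $ i $ j)"
      unfolding matrix_matrix_mult_def
      by (auto intro!: regular_uminus regular_sum regular_mult regular_const regular_snd)
    moreover have c: "curry (\<lambda>t. gl_coords (fst t) (snd t) v) = (\<lambda>A B. B $ i $ j)"
      by (auto simp: fun_eq_iff Inr w gl_coords_def)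
    moreover have "left_deriv X (\<lambda>A B. B $ i $ j) (\<lambda>A B. (- (X ** B)) $ i $ j)"
      unfolding left_deriv_def tangent_curve_def entry_deriv_def by blast
    ultimately show ?thesis unfolding Q_def c using regular_snd[of i j] by blast
  qed
  have "Q (\<lambda>t. poly_eval id (gl_coords (fst t) (snd t)) p) (\<lambda>s. poly_eval id (\<lambda>_. 0) p)"
    by (rule poly_eval_rel[where \<iota> = "\<lambda>_. id" and \<kappa> = "\<lambda>_. id" and y = "\<lambda>_ _. 0"
          and x = "\<lambda>t. gl_coords (fst t) (snd t)"])
      (use const var in \<open>auto intro: add mult\<close>)
  then obtain D where D: "regular D" "left_deriv X (pair_eval p) D"
    unfolding Q_def by (auto simp: curry_def)
  obtain q where "\<And>A B. D A B = pair_eval q A B" using regularE[OF D(1)] by blast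
  then have "D = pair_eval q" by (intro ext)
  then show thesis using D(2) that by blast
qed

lemma coeff_mult_1: "coeff (p * q) 1 = coeff p 0 * coeff q 1 + coeff p 1 * coeff q 0"
  by (simp add: coeff_mult)

text \<open>Polynomials modulo t^2 compute with values and first derivatives, so
  \<open>gl_deriv\<close> is the derivative along every pair of curves through the identity with
  velocities X and - X.\<close>

lemma gl_deriv_curve:
  assumes c: "entry_deriv c X t" "c t = mat 1" and d: "entry_deriv d (- X) t" "d t = mat 1"
  shows "((\<lambda>s. pair_eval p (c s) (d s)) has_field_derivative gl_deriv id p X) (at t)"
proof -
  define Q where "Q = (\<lambda>(f :: complex \<Rightarrow> complex) (g :: unit \<Rightarrow> complex poly).
     f t = coeff (g ()) 0 \<and> (f has_field_derivative coeff (g ()) 1) (at t))"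
  let ?C = "(\<chi> i j. [:if i = j then 1 else 0, X $ i $ j:])"
  let ?D = "(\<chi> i j. [:if i = j then 1 else 0, - X $ i $ j:])"
  have "Q (\<lambda>s. pair_eval p (c s) (d s))
     (\<lambda>_. poly_eval (\<lambda>c. [:id c:]) (gl_coords ?C ?D) p)"
  proof (rule poly_eval_rel[where \<iota> = "\<lambda>_. id" and \<kappa> = "\<lambda>_ c. [:id c:]"
        and x = "\<lambda>s. gl_coords (c s) (d s)" and y = "\<lambda>_. gl_coords ?C ?D"])
    show "Q (\<lambda>s. f s * f' s) (\<lambda>s. g s * g' s)" if QQ: "Q f g" "Q f' g'" for f f' g g'
      using QQ unfolding Q_def coeff_mult_1 coeff_mult_0
      by (auto intro!: derivative_eq_intros)
    show "Q (\<lambda>s. f s + f' s) (\<lambda>s. g s + g' s)" if QQ: "Q f g" "Q f' g'" for f f' g g'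
      using QQ unfolding Q_def coeff_add by (auto intro!: derivative_eq_intros)
    show "Q (\<lambda>s. gl_coords (c s) (d s) v) (\<lambda>_. gl_coords ?C ?D v)" for v
    proof (cases v)
      case (Inl w)
      obtain i j where w: "w = (i, j)" by (cases w)
      show ?thesis using c unfolding Inl w Q_def gl_coords_def entry_deriv_def
        by (simp add: mat_def)
    next
      case (Inr w)
      obtain i j where w: "w = (i, j)" by (cases w)
      show ?thesis using d unfolding Inr w Q_def gl_coords_def entry_deriv_def
        by (simp add: mat_def)
    qed
  qed (auto simp: Q_def)
  then show ?thesis by (simp add: Q_def gl_deriv_def id_def)
qed

lemma gl_deriv_linear:
  fixes p :: "'n::finite gl_fun"
  shows "gl_deriv id p (X + Y) = gl_deriv id p X + gl_deriv id p Y"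
    and "gl_deriv id p (smat a X) = a * gl_deriv id p X"
proof -
  \<comment> \<open>Coefficient 1 of a product contains the constant coefficients of the factors. It
    stays linear in X only if these do not depend on X, so the first clause is part of the
    induction.\<close>
  define Q where "Q = (\<lambda>(f :: complex^'n^'n \<Rightarrow> complex poly) (g :: unit \<Rightarrow> complex).
     (\<forall>X Y. coeff (f X) 0 = coeff (f Y) 0) \<and>
     (\<forall>X Y. coeff (f (X + Y)) 1 = coeff (f X) 1 + coeff (f Y) 1) \<and>
     (\<forall>a X. coeff (f (smat a X)) 1 = a * coeff (f X) 1))"
  let ?C = "\<lambda>X :: complex^'n^'n. \<chi> i j. [:if i = j then 1 else 0, X $ i $ j:]"
  let ?D = "\<lambda>X :: complex^'n^'n. \<chi> i j. [:if i = j then 1 else 0, - X $ i $ j:]"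
  have "Q (\<lambda>X. poly_eval (\<lambda>c. [:id c:]) (gl_coords (?C X) (?D X)) p) (\<lambda>_. poly_eval id (\<lambda>_. 0) p)"
  proof (rule poly_eval_rel[where \<kappa> = "\<lambda>_. id" and \<iota> = "\<lambda>_ c. [:id c:]"
        and x = "\<lambda>X. gl_coords (?C X) (?D X)" and y = "\<lambda>_ _. 0"])
    show "Q (\<lambda>s. f s * f' s) (\<lambda>s. g s * g' s)" if QQ: "Q f g" "Q f' g'" for f f' g g'
    proof -
      obtain k k' where k: "\<And>X. coeff (f X) 0 = k" "\<And>X. coeff (f' X) 0 = k'"
        using QQ unfolding Q_def by metis
      show ?thesis
        using QQ unfolding Q_def coeff_mult_1 coeff_mult_0 k
        by (simp add: algebra_simps)
    qed
    show "Q (\<lambda>s. f s + f' s) (\<lambda>s. g s + g' s)" if QQ: "Q f g" "Q f' g'" for f f' g g'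
    proof -
      obtain k k' where k: "\<And>X. coeff (f X) 0 = k" "\<And>X. coeff (f' X) 0 = k'"
        using QQ unfolding Q_def by metis
      show ?thesis
        using QQ unfolding Q_def coeff_add k by (simp add: algebra_simps)
    qed
    show "Q (\<lambda>X. gl_coords (?C X) (?D X) v) (\<lambda>_. 0)" for v
      unfolding Q_def gl_coords_def smat_def map_matrix_def
      by (cases v) (auto split: prod.splits)
  qed (auto simp: Q_def algebra_simps)
  then show "gl_deriv id p (X + Y) = gl_deriv id p X + gl_deriv id p Y"
    and "gl_deriv id p (smat a X) = a * gl_deriv id p X"
    unfolding Q_def gl_deriv_def by (auto simp: id_def)
qed

section \<open>Algebraic groups and their rational points\<close>

lemma matrix_groupD:
  assumes "group (matrix_group S)"
  shows "mat 1 \<in> S" "A \<in> S \<Longrightarrow> B \<in> S \<Longrightarrow> A ** B \<in> S"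
    "A \<in> S \<Longrightarrow> invertible A" "A \<in> S \<Longrightarrow> matrix_inv A \<in> S"
proof -
  interpret group "matrix_group S" by fact
  show "mat 1 \<in> S" using one_closed by (simp add: matrix_group_def)
  show "A \<in> S \<Longrightarrow> B \<in> S \<Longrightarrow> A ** B \<in> S" using m_closed[of A B] by (simp add: matrix_group_def)
  have *: "\<exists>B\<in>S. A ** B = mat 1" if "A \<in> S" for A
    using r_inv_ex[of A] that by (simp add: matrix_group_def)
  then show "A \<in> S \<Longrightarrow> invertible A" "A \<in> S \<Longrightarrow> matrix_inv A \<in> S"
    using matrix_inv_eqI by metis+
qed

lemma gl_eval_pair: "A ** B = mat 1 \<Longrightarrow> gl_eval id p A = pair_eval p A B"
  by (simp add: gl_eval_def matrix_inv_eqI)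

lemma vanishing_ideal_iff: "p \<in> vanishing_ideal S \<longleftrightarrow> (\<forall>A\<in>S. gl_eval id p A = 0)"
  by (simp add: vanishing_ideal_def)

lemma zariski_closedI_mem:
  assumes "zariski_closed S" "invertible A" "\<And>p. p \<in> vanishing_ideal S \<Longrightarrow> gl_eval id p A = 0"
  shows "A \<in> S"
proof -
  obtain P where P: "S = {A. invertible A \<and> (\<forall>p\<in>P. gl_eval id p A = 0)}"
    using assms(1) unfolding zariski_closed_def by blast
  then have "P \<subseteq> vanishing_ideal S" by (auto simp: vanishing_ideal_iff)
  then show ?thesis using assms(2,3) P by blast
qed

lemma lie_algebra_mono: "T \<subseteq> S \<Longrightarrow> lie_algebra T \<subseteq> lie_algebra S"
  unfolding lie_algebra_def vanishing_ideal_def by blast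

lemma lie_algebra_regular:
  assumes F: "regular F" "\<And>A. A \<in> S \<Longrightarrow> F A (matrix_inv A) = 0" and X: "X \<in> lie_algebra S"
    and c: "entry_deriv c X t" "c t = mat 1" and d: "entry_deriv d (- X) t" "d t = mat 1"
  shows "((\<lambda>s. F (c s) (d s)) has_field_derivative 0) (at t)"
proof -
  obtain p where p: "\<And>A B. F A B = pair_eval p A B" using regularE[OF F(1)] by blast
  then have "p \<in> vanishing_ideal S" using F(2) by (simp add: vanishing_ideal_iff gl_eval_def)
  then have "gl_deriv id p X = 0" using X by (simp add: lie_algebra_def)
  then show ?thesis using gl_deriv_curve[OF c d, of p] by (simp add: p)
qed

lemma smat_matrix_mult:
  fixes A :: "'a::comm_ring_1^'n::finite^'m::finite" and B :: "'a^'k::finite^'n"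
  shows "smat c A ** B = smat c (A ** B)" "A ** smat c B = smat c (A ** B)"
  by (simp_all add: vec_eq_iff smat_def map_matrix_def matrix_matrix_mult_def sum_distrib_left
      mult.assoc mult.left_commute)

lemma matrix_mult_uminus:
  fixes A :: "'a::comm_ring_1^'n::finite^'m::finite" and B :: "'a^'k::finite^'n"
  shows "(- A) ** B = - (A ** B)" "A ** (- B) = - (A ** B)"
  by (simp_all add: vec_eq_iff matrix_matrix_mult_def sum_negf)

lemma smat_nth [simp]: "smat c A $ i $ j = c * A $ i $ j"
  by (simp add: smat_def map_matrix_def)

lemma smat_0 [simp]: "smat 0 (A :: 'a::mult_zero^'n::finite^'m::finite) = 0"
  by (simp add: vec_eq_iff)

text \<open>The function U \<mapsto> p (A U) vanishes on S when A is in S, and its derivative at the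
  identity in the direction X is the left-invariant derivative of p at A.\<close>

lemma vanishing_ideal_left_deriv:
  assumes S: "group (matrix_group S)" and X: "X \<in> lie_algebra S" and p: "p \<in> vanishing_ideal S"
    and q: "left_deriv X (pair_eval p) (pair_eval q)"
  shows "q \<in> vanishing_ideal S"
  unfolding vanishing_ideal_iff
proof
  fix A assume A: "A \<in> S"
  let ?B = "matrix_inv A"
  \<comment> \<open>Inverse to each other only to first order, which is all that
    \<open>tangent_curve\<close> at 0 requires.\<close>
  let ?c = "\<lambda>s. mat 1 + smat s X" and ?d = "\<lambda>s. mat 1 + smat s (- X)"
  have c: "entry_deriv ?c X 0" "?c 0 = mat 1" and d: "entry_deriv ?d (- X) 0" "?d 0 = mat 1"
    using entry_deriv_line by simp_all
  have F: "regular (\<lambda>U V. pair_eval p (A ** U) (V ** ?B))"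
    by (rule regular_translate[OF regular_pair_eval])
  have "((\<lambda>s. pair_eval p (A ** ?c s) (?d s ** ?B)) has_field_derivative 0) (at 0)"
  proof (rule lie_algebra_regular[OF F _ X c d])
    fix U assume U: "U \<in> S"
    have "(A ** U) ** (matrix_inv U ** ?B) = A ** (U ** matrix_inv U) ** ?B"
      by (simp add: matrix_mul_assoc)
    also have "\<dots> = mat 1"
      using matrix_inv_right(1)[OF matrix_groupD(3)[OF S A]]
        matrix_inv_right(1)[OF matrix_groupD(3)[OF S U]] by simp
    finally show "pair_eval p (A ** U) (matrix_inv U ** ?B) = 0"
      using p matrix_groupD(2)[OF S A U] by (metis gl_eval_pair vanishing_ideal_iff)
  qed
  moreover have "tangent_curve X (\<lambda>s. A ** ?c s) (\<lambda>s. ?d s ** ?B) 0"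
    unfolding tangent_curve_def
    using entry_deriv_mult[OF entry_deriv_const c(1), of A]
      entry_deriv_mult[OF d(1) entry_deriv_const, of ?B]
    by (simp add: c(2) d(2) matrix_mult_uminus)
  then have "((\<lambda>s. pair_eval p (A ** ?c s) (?d s ** ?B)) has_field_derivative pair_eval q A ?B) (at 0)"
    using q c(2) d(2) unfolding left_deriv_def by fastforce
  ultimately show "gl_eval id q A = 0"
    unfolding gl_eval_def using DERIV_unique by blast
qed

text \<open>The properties of t \<mapsto> exp (t X) that the proof uses. They are established
  separately for nilpotent X, with a finite series, and for diagonalisable X.\<close>

locale one_parameter_curve =
  fixes X :: "complex^'n::finite^'n" and \<gamma> :: "complex \<Rightarrow> complex^'n^'n"
  assumes deriv: "entry_deriv \<gamma> (\<gamma> t ** X) t"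
    and comm: "\<gamma> t ** X = X ** \<gamma> t"
    and inv: "\<gamma> t ** \<gamma> (- t) = mat 1"
    and zero: "\<gamma> 0 = mat 1"
begin

lemma deriv_inv: "entry_deriv (\<lambda>s. \<gamma> (- s)) (- (X ** \<gamma> (- t))) t"
  using entry_deriv_reflect[OF deriv[of "- t"]] by (simp add: comm)

lemma tangent_curve: "tangent_curve X \<gamma> (\<lambda>s. \<gamma> (- s)) t"
  using deriv deriv_inv by (simp add: tangent_curve_def)

lemma mem_closed_group:
  assumes S: "zariski_closed S" "group (matrix_group S)" and X: "X \<in> lie_algebra S"
  shows "\<gamma> t \<in> S"
proof (rule zariski_closedI_mem[OF S(1)])
  show "invertible (\<gamma> t)" using inv matrix_inv_eqI(2) by blast
  fix p assume p: "p \<in> vanishing_ideal S"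
  define \<phi> where "\<phi> = (\<lambda>p s. pair_eval p (\<gamma> s) (\<gamma> (- s)))"
  have \<phi>: "\<exists>q\<in>vanishing_ideal S. \<forall>s. (\<phi> p has_field_derivative \<phi> q s) (at s)"
    if "p \<in> vanishing_ideal S" for p
  proof -
    obtain q where q: "left_deriv X (pair_eval p) (pair_eval q)" by (rule regular_left_deriv)
    then have "\<forall>s. (\<phi> p has_field_derivative \<phi> q s) (at s)"
      unfolding left_deriv_def \<phi>_def using tangent_curve by blast
    then show ?thesis using vanishing_ideal_left_deriv[OF S(2) X that q] by blast
  qed
  \<comment> \<open>Each derivative of an equation along the curve is again an equation of S, and
    equations of S vanish at the identity.\<close>
  have "\<exists>q\<in>vanishing_ideal S. (deriv ^^ n) (\<phi> p) = \<phi> q" for n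
  proof (induction n)
    case (Suc n)
    then obtain q q' where "q' \<in> vanishing_ideal S" "(deriv ^^ n) (\<phi> p) = \<phi> q"
      "\<forall>s. (\<phi> q has_field_derivative \<phi> q' s) (at s)"
      using \<phi> by blast
    then show ?case by (intro bexI[of _ q']) (auto intro: DERIV_imp_deriv)
  qed (use p in auto)
  moreover have "\<phi> q 0 = 0" if "q \<in> vanishing_ideal S" for q
    using that matrix_groupD(1)[OF S(2)] gl_eval_pair[of "mat 1" "mat 1" q]
    by (simp add: \<phi>_def zero vanishing_ideal_iff)
  ultimately have "(deriv ^^ n) (\<phi> p) 0 = 0" for n by metis
  moreover have "\<phi> p holomorphic_on UNIV"
    using \<phi>[OF p] by (auto simp: holomorphic_on_def field_differentiable_def)
  ultimately have "\<phi> p t = 0"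
    by (intro holomorphic_fun_eq_0_on_connected[of "\<phi> p" UNIV 0]) auto
  then show "gl_eval id p (\<gamma> t) = 0"
    using gl_eval_pair[OF inv] by (simp add: \<phi>_def)
qed

end

section \<open>Specialisation of rational points and representations\<close>

lemma ev_poly_eval:
  "\<forall>\<^sub>F z in cofinite. ev (poly_eval ratfun_const x p) z = poly_eval id (\<lambda>v. ev (x v) z) p"
proof -
  have "(\<lambda>(f :: unit \<Rightarrow> ratfun) g. \<forall>\<^sub>F z in cofinite. ev (f ()) z = g z)
     (\<lambda>_. poly_eval ratfun_const x p) (\<lambda>z. poly_eval id (\<lambda>v. ev (x v) z) p)"
  proof (rule poly_eval_rel[where \<iota> = "\<lambda>_. ratfun_const" and \<kappa> = "\<lambda>_. id"
        and x = "\<lambda>_. x" and y = "\<lambda>z v. ev (x v) z"])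
    fix f f' :: "unit \<Rightarrow> ratfun" and g g' :: "complex \<Rightarrow> complex"
    assume fg: "\<forall>\<^sub>F z in cofinite. ev (f ()) z = g z" "\<forall>\<^sub>F z in cofinite. ev (f' ()) z = g' z"
    show "\<forall>\<^sub>F z in cofinite. ev (f () + f' ()) z = g z + g' z"
      using fg ev_add[of "f ()" "f' ()"] by eventually_elim simp
    show "\<forall>\<^sub>F z in cofinite. ev (f () * f' ()) z = g z * g' z"
      using fg ev_mult[of "f ()" "f' ()"] by eventually_elim simp
  qed auto
  then show ?thesis by simp
qed

lemma ev_gl_eval:
  assumes "invertible v"
  shows "\<forall>\<^sub>F z in cofinite. ev (gl_eval ratfun_const p v) z = gl_eval id p (evm v z)"
  using ev_poly_eval[of "gl_coords v (matrix_inv v)" p] evm_inv[OF assms]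
proof eventually_elim
  case (elim z)
  have "gl_coords (evm v z) (matrix_inv (evm v z)) = (\<lambda>w. ev (gl_coords v (matrix_inv v) w) z)"
    using elim by (auto simp: fun_eq_iff gl_coords_def split: sum.splits)
  then show ?case using elim by (simp add: gl_eval_def)
qed

lemma ev_gl_deriv:
  "\<forall>\<^sub>F z in cofinite. ev (gl_deriv ratfun_const p X) z = gl_deriv id p (evm X z)"
proof -
  let ?C = "\<lambda>X. (\<chi> i j. [:if i = j then 1 else 0, X $ i $ j:])"
  let ?D = "\<lambda>X. (\<chi> i j. [:if i = j then 1 else 0, - X $ i $ j:])"
  \<comment> \<open>Only coefficients 0 and 1 are compared, since coefficient 1 of a product
    involves no others.\<close>
  define Q where "Q = (\<lambda>(f :: unit \<Rightarrow> ratfun poly) g. \<forall>\<^sub>F z in cofinite.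
     ev (coeff (f ()) 0) z = coeff (g z) 0 \<and> ev (coeff (f ()) 1) z = coeff (g z) 1)"
  have "Q (\<lambda>_. poly_eval (\<lambda>c. [:ratfun_const c:]) (gl_coords (?C X) (?D X)) p)
      (\<lambda>z. poly_eval (\<lambda>c. [:id c:]) (gl_coords (?C (evm X z)) (?D (evm X z))) p)"
  proof (rule poly_eval_rel[where \<iota> = "\<lambda>_ c. [:ratfun_const c:]" and \<kappa> = "\<lambda>_ c. [:id c:]"
        and x = "\<lambda>_. gl_coords (?C X) (?D X)"
        and y = "\<lambda>z. gl_coords (?C (evm X z)) (?D (evm X z))"])
    show "Q (\<lambda>s. f s + f' s) (\<lambda>s. g s + g' s)" if QQ: "Q f g" "Q f' g'" for f f' g g'
      using QQ ev_add[of "coeff (f ()) 0" "coeff (f' ()) 0"]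
        ev_add[of "coeff (f ()) 1" "coeff (f' ()) 1"]
      unfolding Q_def by eventually_elim simp
    show "Q (\<lambda>s. f s * f' s) (\<lambda>s. g s * g' s)" if QQ: "Q f g" "Q f' g'" for f f' g g'
      using QQ ev_mult[of "coeff (f ()) 0" "coeff (f' ()) 0"]
        ev_mult[of "coeff (f ()) 0" "coeff (f' ()) 1"] ev_mult[of "coeff (f ()) 1" "coeff (f' ()) 0"]
        ev_add[of "coeff (f ()) 0 * coeff (f' ()) 1" "coeff (f ()) 1 * coeff (f' ()) 0"]
      unfolding Q_def coeff_mult_0 coeff_mult_1 by eventually_elim simp
    show "Q (\<lambda>_. gl_coords (?C X) (?D X) v) (\<lambda>z. gl_coords (?C (evm X z)) (?D (evm X z)) v)" for v
    proof (cases v)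
      case (Inl w)
      then show ?thesis by (cases w) (auto simp: Q_def gl_coords_def)
    next
      case (Inr w)
      obtain i j where w: "w = (i, j)" by (cases w)
      show ?thesis using ev_uminus[of "X $ i $ j"]
        unfolding Q_def Inr w by eventually_elim (simp add: gl_coords_def)
    qed
  qed (auto simp: Q_def)
  then show ?thesis unfolding Q_def gl_deriv_def by eventually_elim simp
qed

lemma evm_rep_eval:
  assumes "invertible v"
  shows "\<forall>\<^sub>F z in cofinite. evm (rep_eval ratfun_const \<rho> v) z = rep_eval id \<rho> (evm v z)"
proof -
  have "\<forall>\<^sub>F z in cofinite. \<forall>i j. ev (gl_eval ratfun_const (\<rho> $ i $ j) v) z
       = gl_eval id (\<rho> $ i $ j) (evm v z)"
    by (intro eventually_all_finite ev_gl_eval assms)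
  then show ?thesis by (rule eventually_mono) (simp add: vec_eq_iff rep_eval_def)
qed

lemma evm_rep_deriv:
  "\<forall>\<^sub>F z in cofinite. evm (rep_deriv ratfun_const \<rho> X) z = rep_deriv id \<rho> (evm X z)"
proof -
  have "\<forall>\<^sub>F z in cofinite. \<forall>i j. ev (gl_deriv ratfun_const (\<rho> $ i $ j) X) z
       = gl_deriv id (\<rho> $ i $ j) (evm X z)"
    by (intro eventually_all_finite ev_gl_deriv)
  then show ?thesis by (rule eventually_mono) (simp add: vec_eq_iff rep_deriv_def)
qed

lemma ratfun_pointsI:
  assumes "invertible v" "\<forall>\<^sub>F z in cofinite. evm v z \<in> S"
  shows "v \<in> ratfun_points S"
  unfolding ratfun_points_def
proof (intro CollectI conjI ballI assms(1))
  fix p assume p: "p \<in> vanishing_ideal S"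
  have "\<forall>\<^sub>F z in cofinite. ev (gl_eval ratfun_const p v) z = ev 0 z"
    using ev_gl_eval[OF assms(1), of p] assms(2)
    by eventually_elim (use p in \<open>simp add: vanishing_ideal_iff\<close>)
  then show "gl_eval ratfun_const p v = 0" by (rule ev_eqI')
qed

lemma common_denominator:
  fixes x :: "'v::finite \<Rightarrow> ratfun"
  obtains b N where "b \<noteq> 0" "\<And>v. x v = to_fract (N v) / to_fract b"
proof -
  have "\<exists>a b. b \<noteq> 0 \<and> x v = to_fract a / to_fract b" for v
    by (metis fract_coprime_cases)
  then obtain a b where ab: "\<And>v. b v \<noteq> 0" "\<And>v. x v = to_fract (a v) / to_fract (b v)" by metis
  have "x v = to_fract (a v * (\<Prod>u\<in>UNIV - {v}. b u)) / to_fract (\<Prod>u\<in>UNIV. b u)" for v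
  proof -
    have "(\<Prod>u\<in>UNIV. b u) = b v * (\<Prod>u\<in>UNIV - {v}. b u)"
      by (simp add: prod.remove)
    moreover have "(\<Prod>u\<in>UNIV - {v}. b u) \<noteq> 0" using ab by simp
    ultimately show ?thesis using ab by simp
  qed
  then show thesis
    using ab by (intro that[of "\<Prod>u\<in>UNIV. b u" "\<lambda>v. a v * (\<Prod>u\<in>UNIV - {v}. b u)"]) auto
qed

text \<open>
  The exceptional set must not depend on the (infinitely many) equations of S. It consists of the
  zeros of a common denominator of the entries of v and of its inverse.
\<close>

lemma ratfun_points_ev:
  fixes v :: "ratfun^'n::finite^'n"
  assumes "v \<in> ratfun_points S" "zariski_closed S"
  shows "\<forall>\<^sub>F z in cofinite. evm v z \<in> S"
proof -
  have v: "invertible v" "\<And>p. p \<in> vanishing_ideal S \<Longrightarrow> gl_eval ratfun_const p v = 0"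
    using assms(1) by (auto simp: ratfun_points_def)
  let ?x = "gl_coords v (matrix_inv v)"
  obtain b N where b: "b \<noteq> 0" and N: "\<And>w. ?x w = to_fract (N w) / to_fract b"
    using common_denominator[of ?x] by blast
  \<comment> \<open>The same numerator M and exponent k must serve over C(z) and at every z with
    b(z) nonzero. The denominators are thus powers of the fixed b, whatever the polynomial
    p.\<close>
  define Q where "Q = (\<lambda>(f :: unit \<Rightarrow> ratfun) g. \<exists>M k. f () = to_fract M / to_fract b ^ k \<and>
     (\<forall>z. poly b z \<noteq> 0 \<longrightarrow> g z = poly M z / poly b z ^ k))"
  have Q: "Q (\<lambda>_. poly_eval ratfun_const ?x p) (\<lambda>z. poly_eval id (\<lambda>w. poly (N w) z / poly b z) p)" for p
  proof (rule poly_eval_rel[where \<iota> = "\<lambda>_. ratfun_const" and \<kappa> = "\<lambda>_. id"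
        and x = "\<lambda>_. ?x" and y = "\<lambda>z w. poly (N w) z / poly b z"])
    show "Q (\<lambda>s. f s + f' s) (\<lambda>s. g s + g' s)" if QQ: "Q f g" "Q f' g'" for f f' g g'
    proof -
      obtain M k M' k' where M: "f () = to_fract M / to_fract b ^ k"
        "\<forall>z. poly b z \<noteq> 0 \<longrightarrow> g z = poly M z / poly b z ^ k"
        "f' () = to_fract M' / to_fract b ^ k'"
        "\<forall>z. poly b z \<noteq> 0 \<longrightarrow> g' z = poly M' z / poly b z ^ k'"
        using QQ unfolding Q_def by blast
      show ?thesis unfolding Q_def
        by (rule exI[of _ "M * b ^ k' + M' * b ^ k"], rule exI[of _ "k + k'"])
          (use M b in \<open>auto simp: to_fract_power power_add add_frac_eq mult_ac\<close>)
    qed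
    show "Q (\<lambda>s. f s * f' s) (\<lambda>s. g s * g' s)" if QQ: "Q f g" "Q f' g'" for f f' g g'
    proof -
      obtain M k M' k' where M: "f () = to_fract M / to_fract b ^ k"
        "\<forall>z. poly b z \<noteq> 0 \<longrightarrow> g z = poly M z / poly b z ^ k"
        "f' () = to_fract M' / to_fract b ^ k'"
        "\<forall>z. poly b z \<noteq> 0 \<longrightarrow> g' z = poly M' z / poly b z ^ k'"
        using QQ unfolding Q_def by blast
      show ?thesis unfolding Q_def
        by (rule exI[of _ "M * M'"], rule exI[of _ "k + k'"])
          (use M b in \<open>auto simp: power_add\<close>)
    qed
    show "Q (\<lambda>_. ?x w) (\<lambda>z. poly (N w) z / poly b z)" for w
      unfolding Q_def by (rule exI[of _ "N w"], rule exI[of _ 1]) (simp add: N)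
    show "Q (\<lambda>_. ratfun_const c) (\<lambda>_. id c)" for c
      unfolding Q_def by (rule exI[of _ "[:c:]"], rule exI[of _ 0]) simp
    show "Q (\<lambda>_. 0) (\<lambda>_. 0)"
      unfolding Q_def by (rule exI[of _ 0], rule exI[of _ 0]) simp
    show "Q (\<lambda>_. 1) (\<lambda>_. 1)"
      unfolding Q_def by (rule exI[of _ 1], rule exI[of _ 0]) simp
  qed
  have "\<forall>\<^sub>F z in cofinite. \<forall>w. ev (?x w) z = poly (N w) z / poly b z"
    unfolding N Fract_conv_to_fract[symmetric] by (intro eventually_all_finite ev_Fract b)
  then show ?thesis
    using evm_inv[OF v(1)] eventually_poly_nonzero[OF b]
  proof eventually_elim
    case (elim z)
    have x: "gl_coords (evm v z) (matrix_inv (evm v z)) = (\<lambda>w. poly (N w) z / poly b z)"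
      using elim by (auto simp: fun_eq_iff gl_coords_def split: sum.splits)
    show ?case
    proof (rule zariski_closedI_mem[OF assms(2)])
      show "invertible (evm v z)" using elim by blast
      fix p assume p: "p \<in> vanishing_ideal S"
      obtain M k where M: "poly_eval ratfun_const ?x p = to_fract M / to_fract b ^ k"
        "poly_eval id (\<lambda>w. poly (N w) z / poly b z) p = poly M z / poly b z ^ k"
        using Q[of p] elim(3) unfolding Q_def by blast
      \<comment> \<open>Vanishing over C(z) kills the numerator itself, so the value at the given z
        vanishes too.\<close>
      have "M = 0" using M(1) v(2)[OF p] b by (simp add: gl_eval_def)
      then show "gl_eval id p (evm v z) = 0" using M(2) by (simp add: gl_eval_def x)
    qed
  qed
qed

lemma ratfun_points_mult:
  assumes "v \<in> ratfun_points S" "w \<in> ratfun_points S" "zariski_closed S" "group (matrix_group S)"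
  shows "v ** w \<in> ratfun_points S"
proof (rule ratfun_pointsI)
  show "invertible (v ** w)"
    using assms(1,2) by (auto simp: ratfun_points_def intro: invertible_mult)
  show "\<forall>\<^sub>F z in cofinite. evm (v ** w) z \<in> S"
    using ratfun_points_ev[OF assms(1,3)] ratfun_points_ev[OF assms(2,3)] evm_mult[of v w]
    by eventually_elim (simp add: matrix_groupD(2)[OF assms(4)])
qed

text \<open>The representation is multiplicative only on complex points of G; the identity is
  transferred through the values of v and w, which lie in S at almost every z.\<close>

lemma rep_eval_ratfun_mult:
  assumes v: "v \<in> ratfun_points S" and w: "w \<in> ratfun_points S"
    and S: "zariski_closed S" "S \<subseteq> G"
    and rep: "rational_representation G \<rho>"
  shows "rep_eval ratfun_const \<rho> (v ** w) = rep_eval ratfun_const \<rho> v ** rep_eval ratfun_const \<rho> w"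
proof (rule evm_eqI)
  have inv: "invertible v" "invertible w"
    using v w by (auto simp: ratfun_points_def)
  show "\<forall>\<^sub>F z in cofinite. evm (rep_eval ratfun_const \<rho> (v ** w)) z =
      evm (rep_eval ratfun_const \<rho> v ** rep_eval ratfun_const \<rho> w) z"
    using ratfun_points_ev[OF v S(1)] ratfun_points_ev[OF w S(1)] evm_mult[of v w]
      evm_mult[of "rep_eval ratfun_const \<rho> v" "rep_eval ratfun_const \<rho> w"]
      evm_rep_eval[OF inv(1), of \<rho>] evm_rep_eval[OF inv(2), of \<rho>]
      evm_rep_eval[OF invertible_mult[OF inv], of \<rho>]
    by eventually_elim (use rep S(2) in \<open>auto simp: rational_representation_def\<close>)
qed

lemma invertible_rep_eval_ratfun:
  assumes v: "v \<in> ratfun_points S" and S: "zariski_closed S" "S \<subseteq> G" "group (matrix_group S)"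
    and rep: "rational_representation G \<rho>"
  shows "invertible (rep_eval ratfun_const \<rho> v)"
proof (rule matrix_inv_eqI(2), rule evm_eqI)
  let ?w = "matrix_inv v"
  have inv: "invertible v" using v by (auto simp: ratfun_points_def)
  have inv': "invertible ?w" using matrix_inv_right[OF inv] matrix_inv_eqI(2) by blast
  show "\<forall>\<^sub>F z in cofinite. evm (rep_eval ratfun_const \<rho> v ** rep_eval ratfun_const \<rho> ?w) z
     = evm (mat 1) z"
    using ratfun_points_ev[OF v S(1)] evm_inv[OF inv]
      evm_mult[of "rep_eval ratfun_const \<rho> v" "rep_eval ratfun_const \<rho> ?w"]
      evm_rep_eval[OF inv, of \<rho>] evm_rep_eval[OF inv', of \<rho>]
  proof eventually_elim
    case (elim z)
    let ?A = "evm v z"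
    have A: "?A \<in> G" "matrix_inv ?A \<in> G"
      using elim(1) matrix_groupD(4)[OF S(3)] S(2) by blast+
    have "rep_eval id \<rho> ?A ** rep_eval id \<rho> (matrix_inv ?A) = rep_eval id \<rho> (?A ** matrix_inv ?A)"
      using rep A unfolding rational_representation_def by simp
    also have "\<dots> = mat 1"
      using rep elim(2) matrix_inv_right(1) unfolding rational_representation_def by metis
    finally show ?case using elim by simp
  qed
qed

section \<open>Weights of sl2\<close>

text \<open>Otherwise there would be more independent eigenvectors than the dimension
  allows.\<close>

lemma distinct_eigenvalues_vanish:
  fixes A :: "complex^'k::finite^'k" and u :: "nat \<Rightarrow> complex^'k"
  assumes "inj c" "\<And>n. A *v u n = c n *s u n"
  shows "\<exists>n. u n = 0"
proof (rule ccontr)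
  assume "\<nexists>n. u n = 0"
  then have nz: "u n \<noteq> 0" for n by blast
  have indep: "a k = 0" if "(\<Sum>k<n. a k *s u k) = 0" "k < n" for a k n
    using that
  proof (induction n arbitrary: a k)
    case (Suc n)
    let ?S = "\<Sum>k<n. a k *s u k"
    have S: "?S = - (a n *s u n)" using Suc.prems(1) by (simp add: add_eq_0_iff)
    \<comment> \<open>Applying A - c n removes the last term of the relation and leaves a shorter
      one.\<close>
    have "(\<Sum>k<n. (a k * (c k - c n)) *s u k) = A *v ?S - c n *s ?S"
      by (simp add: vec.sum vec.scale assms(2) vec.scale_sum_right sum_subtractf[symmetric]
          algebra_simps)
    also have "\<dots> = 0"
      by (simp only: S) (simp add: vec.neg vec.scale assms(2) mult.commute)
    finally have "a k * (c k - c n) = 0" if "k < n" for k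
      by (rule Suc.IH[OF _ that])
    then have a: "a k = 0" if "k < n" for k
      using that assms(1) by (metis eq_iff_diff_eq_0 injD less_irrefl mult_eq_0_iff)
    then have "a n *s u n = 0" using Suc.prems(1) by simp
    then have "a n = 0" using nz by simp
    then show ?case using a Suc.prems(2) less_Suc_eq by auto
  qed simp
  have inj: "inj u"
  proof (rule injI)
    fix m n assume eq: "u m = u n"
    then have "c m *s u m = c n *s u m" using assms(2) by metis
    then show "m = n" using nz assms(1) by (simp add: inj_eq)
  qed
  let ?N = "Suc CARD('k)"
  have inj': "inj_on u {..<?N}" using inj by (rule inj_on_subset) simp
  have "vec.independent (u ` {..<?N})"
  proof (rule vec.independent_if_scalars_zero)
    fix g x assume *: "(\<Sum>x\<in>u ` {..<?N}. g x *s x) = 0" "x \<in> u ` {..<?N}"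
    then have "(\<Sum>k<?N. g (u k) *s u k) = 0"
      by (simp only: sum.reindex[OF inj'] o_def)
    then show "g x = 0" using indep[of "\<lambda>k. g (u k)" ?N] *(2) by blast
  qed simp
  then have "card (u ` {..<?N}) \<le> vec.dim (UNIV :: (complex^'k) set)"
    by (intro vec.independent_card_le_dim) auto
  moreover have "card (u ` {..<?N}) = ?N"
    by (simp only: card_image[OF inj'] card_lessThan)
  ultimately show False by (simp add: card_cart_basis)
qed

lemma smat_vector_mult:
  fixes A :: "'a::comm_ring_1^'k::finite^'m::finite"
  shows "smat c A *v x = c *s (A *v x)"
  by (simp add: vec_eq_iff matrix_vector_mult_def sum_distrib_left mult.assoc)

lemma bracket_vector: "bracket X Y *v w = X *v (Y *v w) - Y *v (X *v w)"
  by (simp add: bracket_def matrix_vector_mult_diff_rdistrib matrix_vector_mul_assoc)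

lemma bracket_eigen:
  assumes "bracket H F = smat c F" "H *v w = a *s w"
  shows "H *v (F *v w) = (a + c) *s (F *v w)"
proof -
  have "H *v (F *v w) = F *v (H *v w) + c *s (F *v w)"
    using bracket_vector[of H F w] assms(1) by (simp add: smat_vector_mult algebra_simps)
  then show ?thesis by (simp add: assms(2) vec.scale algebra_simps)
qed

lemma bracket_eigen_power:
  assumes "bracket H F = smat c F" "H *v w = a *s w"
  shows "H *v (((*v) F ^^ n) w) = (a + of_nat n * c) *s (((*v) F ^^ n) w)"
proof (induction n)
  case (Suc n)
  then show ?case using bracket_eigen[OF assms(1) Suc.IH] by (simp add: algebra_simps)
qed (simp add: assms(2))

text \<open>F shifts eigenvalues of H by c, so the powers of F applied to w belong to distinct
  eigenvalues and eventually vanish. The vector obtained is the last nonzero one of the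
  string.\<close>

lemma bracket_power_vanish:
  assumes "bracket H F = smat c F" "H *v w = a *s w" "c \<noteq> 0" "w \<noteq> 0"
  obtains n where "((*v) F ^^ n) w \<noteq> 0" "F *v (((*v) F ^^ n) w) = 0"
proof -
  let ?u = "\<lambda>n. ((*v) F ^^ n) w"
  have "inj (\<lambda>n. a + of_nat n * c)" using assms(3) by (auto intro: injI)
  then have ex: "\<exists>n. ?u n = 0"
    by (rule distinct_eigenvalues_vanish) (rule bracket_eigen_power[OF assms(1,2)])
  define k where "k = (LEAST n. ?u n = 0)"
  have k: "?u k = 0" unfolding k_def using ex by (rule LeastI_ex)
  then obtain m where m: "k = Suc m" using assms(4) by (cases k) auto
  have "?u m \<noteq> 0" using not_less_Least[of m "\<lambda>n. ?u n = 0"] m unfolding k_def by simp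
  then show thesis using that[of m] k m by simp
qed

text \<open>E F^(n+1) w = (n+1) (\<mu> - n) F^n w. At the end of the string the left side is zero
  while F^n w is not, which forces \<mu> = n.\<close>

lemma sl2_highest_weight:
  fixes E F H :: "complex^'k::finite^'k"
  assumes EF: "bracket E F = H" and HF: "bracket H F = smat (- 2) F"
    and w: "w \<noteq> 0" "E *v w = 0" "H *v w = \<mu> *s w"
  shows "\<exists>n::nat. \<mu> = of_nat n"
proof -
  let ?u = "\<lambda>n. ((*v) F ^^ n) w"
  have E: "E *v ?u (Suc n) = (of_nat (Suc n) * (\<mu> - of_nat n)) *s ?u n" for n
  proof (induction n)
    case 0
    show ?case using bracket_vector[of E F w] w EF by simp
  next
    case (Suc n)
    have "E *v ?u (Suc (Suc n)) = F *v (E *v ?u (Suc n)) + H *v ?u (Suc n)"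
      using bracket_vector[of E F "?u (Suc n)"] EF by simp
    also have "\<dots> = (of_nat (Suc n) * (\<mu> - of_nat n)) *s ?u (Suc n)
        + (\<mu> + of_nat (Suc n) * (- 2)) *s ?u (Suc n)"
      unfolding Suc.IH bracket_eigen_power[OF HF w(3)] by (simp add: vec.scale)
    also have "\<dots> = (of_nat (Suc (Suc n)) * (\<mu> - of_nat (Suc n))) *s ?u (Suc n)"
      unfolding vec.scale_left_distrib[symmetric] by (simp add: algebra_simps)
    finally show ?case .
  qed
  obtain n where "?u n \<noteq> 0" "F *v ?u n = 0"
    by (rule bracket_power_vanish[OF HF w(3) _ w(1)]) auto
  then have "(of_nat (Suc n) * (\<mu> - of_nat n)) *s ?u n = 0" using E[of n] by simp
  then have "\<mu> = of_nat n" using \<open>?u n \<noteq> 0\<close> by (simp del: of_nat_Suc)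
  then show ?thesis by blast
qed

text \<open>Applying E as often as possible reaches a highest weight vector of weight \<mu> + 2
  m.\<close>

lemma sl2_weight_int:
  fixes E F H :: "complex^'k::finite^'k"
  assumes EF: "bracket E F = H" and HE: "bracket H E = smat 2 E" and HF: "bracket H F = smat (- 2) F"
    and w: "w \<noteq> 0" "H *v w = \<mu> *s w"
  shows "\<exists>n::int. \<mu> = of_int n"
proof -
  obtain m where m: "((*v) E ^^ m) w \<noteq> 0" "E *v (((*v) E ^^ m) w) = 0"
    by (rule bracket_power_vanish[OF HE w(2) _ w(1)]) auto
  obtain n where "\<mu> + of_nat m * 2 = of_nat n"
    using sl2_highest_weight[OF EF HF m bracket_eigen_power[OF HE w(2)]] by blast
  then have "\<mu> = of_int (int n - 2 * int m)" by (simp add: eq_diff_eq mult.commute)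
  then show ?thesis by blast
qed

section \<open>Exponentials\<close>

lemma entry_deriv_zero_const:
  assumes "\<And>t. entry_deriv c 0 t"
  shows "c s = c t"
proof -
  have "c s $ i $ j = c t $ i $ j" for i j
  proof -
    have "((\<lambda>s. c s $ i $ j) has_field_derivative 0) (at t within UNIV)" for t
      using assms unfolding entry_deriv_def by simp
    then show ?thesis
      using has_field_derivative_zero_constant[of UNIV "\<lambda>s. c s $ i $ j"] by auto
  qed
  then show ?thesis by (simp add: vec_eq_iff)
qed

text \<open>The inverse law needs no separate hypothesis: commutation makes the two terms in the
  derivative of \<open>\<gamma> s ** \<gamma> (- s)\<close> cancel.\<close>

lemma one_parameter_curveI:
  assumes deriv: "\<And>t. entry_deriv \<gamma> (\<gamma> t ** X) t"
    and comm: "\<And>t. \<gamma> t ** X = X ** \<gamma> t"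
    and zero: "\<gamma> 0 = mat 1"
  shows "one_parameter_curve X \<gamma>"
proof
  fix t
  have "entry_deriv (\<lambda>s. \<gamma> s ** \<gamma> (- s)) 0 t" for t
    using entry_deriv_mult[OF deriv[of t] entry_deriv_reflect[OF deriv[of "- t"]]]
    by (simp add: comm[of "- t"] matrix_mult_uminus matrix_mul_assoc)
  then have "\<gamma> t ** \<gamma> (- t) = \<gamma> 0 ** \<gamma> (- 0)" by (rule entry_deriv_zero_const)
  then show "\<gamma> t ** \<gamma> (- t) = mat 1" by (simp add: zero)
qed (fact assms)+

section \<open>Exponentials of nilpotent matrices\<close>

definition mpow :: "complex^'n::finite^'n \<Rightarrow> nat \<Rightarrow> complex^'n^'n" where
  "mpow X k = ((**) X ^^ k) (mat 1)"

lemma mpow_0 [simp]: "mpow X 0 = mat 1"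
  by (simp add: mpow_def)

lemma mpow_Suc: "mpow X (Suc k) = X ** mpow X k"
  by (simp add: mpow_def)

lemma mpow_Suc2: "mpow X (Suc k) = mpow X k ** X"
  by (induction k) (simp_all add: mpow_Suc matrix_mul_assoc)

lemma mpow_vector: "mpow X k *v w = ((*v) X ^^ k) w"
  by (induction k) (simp_all add: mpow_Suc matrix_vector_mul_assoc[symmetric])

lemma mpow_add: "mpow X (j + k) = mpow X j ** mpow X k"
  by (induction j) (simp_all add: mpow_Suc matrix_mul_assoc)

text \<open>For X^N = 0 this is exp (t X). Being polynomial in t, it also makes sense for a rational
  function in place of t.\<close>

definition nil_exp :: "nat \<Rightarrow> complex^'n::finite^'n \<Rightarrow> complex \<Rightarrow> complex^'n^'n" where
  "nil_exp N X t = (\<Sum>k<N. smat (t ^ k / fact k) (mpow X k))"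

lemma matrix_mult_sum:
  fixes A :: "'a::comm_ring_1^'n::finite^'m::finite" and f :: "'i \<Rightarrow> 'a^'k::finite^'n"
    and g :: "'i \<Rightarrow> 'a^'n::finite^'m::finite" and B :: "'a^'k::finite^'n"
  shows "A ** (\<Sum>i\<in>I. f i) = (\<Sum>i\<in>I. A ** f i)" "(\<Sum>i\<in>I. g i) ** B = (\<Sum>i\<in>I. g i ** B)"
  by (induction I rule: infinite_finite_induct)
    (simp_all add: vec_eq_iff matrix_matrix_mult_def distrib_left distrib_right sum.distrib)

lemma nil_exp_deriv:
  assumes "mpow X N = 0"
  shows "entry_deriv (nil_exp N X) (nil_exp N X t ** X) t"
proof -
  define d where "d = (\<lambda>k. case k of 0 \<Rightarrow> 0 | Suc k \<Rightarrow> t ^ k / fact k)"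
  have d: "((\<lambda>s. s ^ k / fact k) has_field_derivative d k) (at t)" for k
  proof (cases k)
    case (Suc m)
    have "((\<lambda>s. s ^ Suc m / fact (Suc m)) has_field_derivative
        of_nat (Suc m) * t ^ m / fact (Suc m)) (at t)"
      by (rule DERIV_cdivide, rule DERIV_cong[OF DERIV_power[OF DERIV_ident]]) simp
    also have "of_nat (Suc m) * t ^ m / fact (Suc m) = d k"
      unfolding fact_Suc nonzero_mult_divide_mult_cancel_left[OF of_nat_neq_0] by (simp add: d_def Suc)
    finally show ?thesis by (simp add: Suc)
  qed (simp add: d_def)
  have "entry_deriv (nil_exp N X) (\<Sum>k<N. smat (d k) (mpow X k)) t"
    unfolding entry_deriv_def nil_exp_def sum_component smat_nth
    by (intro allI DERIV_sum DERIV_cmult_right d)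
  \<comment> \<open>The added term k = N vanishes because X^N = 0. It makes room for the index
    shift, in which the term k = 0 drops out by \<open>d 0 = 0\<close>.\<close>
  also have "(\<Sum>k<N. smat (d k) (mpow X k)) = (\<Sum>k<Suc N. smat (d k) (mpow X k))"
    using assms by (simp add: vec_eq_iff)
  also have "\<dots> = (\<Sum>k<N. smat (d (Suc k)) (mpow X (Suc k)))"
    by (subst sum.lessThan_Suc_shift) (simp add: d_def)
  also have "\<dots> = nil_exp N X t ** X"
    by (simp add: nil_exp_def matrix_mult_sum d_def mpow_Suc2 smat_matrix_mult)
  finally show ?thesis .
qed

lemma nil_exp_curve:
  assumes "mpow X N = 0"
  shows "one_parameter_curve X (nil_exp N X)"
proof (rule one_parameter_curveI)
  show "entry_deriv (nil_exp N X) (nil_exp N X t ** X) t" for t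
    by (rule nil_exp_deriv[OF assms])
  show "nil_exp N X t ** X = X ** nil_exp N X t" for t
    by (simp add: nil_exp_def matrix_mult_sum smat_matrix_mult mpow_Suc2[symmetric] mpow_Suc[symmetric])
  show "nil_exp N X 0 = mat 1"
  proof (cases N)
    \<comment> \<open>With N = 0 the hypothesis says that the identity matrix is zero, which is
      impossible as the index type is nonempty.\<close>
    case 0
    then have "(mat 1 :: complex^'a^'a) = 0" using assms by simp
    then have "(mat 1 :: complex^'a^'a) $ i $ i = 0" for i by simp
    then show ?thesis by (simp add: mat_def)
  next
    case (Suc M)
    show ?thesis unfolding nil_exp_def Suc
      by (subst sum.lessThan_Suc_shift) (simp add: vec_eq_iff)
  qed
qed

section \<open>Exponentials of diagonalisable matrices\<close>

definition diag_mat :: "('n \<Rightarrow> 'a::zero) \<Rightarrow> 'a^'n::finite^'n" where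
  "diag_mat d = (\<chi> i j. if i = j then d i else 0)"

lemma diag_mat_mult: "diag_mat a ** diag_mat b = (diag_mat (\<lambda>i. a i * b i) :: 'a::semiring_1^'n::finite^'n)"
  by (simp add: diag_mat_def matrix_matrix_mult_def vec_eq_iff if_distrib[of "\<lambda>x. x * _"]
      if_distrib[of "(*) _"] sum.If_cases cong: if_cong)

lemma matrix_vector_mult_axis:
  fixes A :: "'a::semiring_1^'n::finite^'m::finite"
  shows "(A *v axis j 1) $ i = A $ i $ j"
  by (simp add: matrix_vector_mult_def axis_def if_distrib[of "(*) _"] sum.If_cases cong: if_cong)

lemma diag_exp_curve:
  fixes P R :: "complex^'n::finite^'n"
  assumes PR: "P ** R = mat 1" "R ** P = mat 1"
  shows "one_parameter_curve (R ** diag_mat d ** P) (\<lambda>t. R ** diag_mat (\<lambda>i. exp (t * d i)) ** P)"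
proof (rule one_parameter_curveI)
  have conj: "(R ** A ** P) ** (R ** B ** P) = R ** (A ** B) ** P" for A B :: "complex^'n^'n"
  proof -
    have "(R ** A ** P) ** (R ** B ** P) = R ** A ** (P ** R) ** B ** P"
      by (simp only: matrix_mul_assoc)
    then show ?thesis by (simp add: PR matrix_mul_assoc)
  qed
  fix t
  have "entry_deriv (\<lambda>t. diag_mat (\<lambda>i. exp (t * d i))) (diag_mat (\<lambda>i. exp (t * d i) * d i)) t"
    unfolding entry_deriv_def diag_mat_def
    by (auto intro!: derivative_eq_intros)
  from entry_deriv_mult[OF entry_deriv_mult[OF entry_deriv_const[of R] this] entry_deriv_const[of P]]
  show "entry_deriv (\<lambda>t. R ** diag_mat (\<lambda>i. exp (t * d i)) ** P)
     (R ** diag_mat (\<lambda>i. exp (t * d i)) ** P ** (R ** diag_mat d ** P)) t"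
    by (simp add: conj diag_mat_mult)
  show "R ** diag_mat (\<lambda>i. exp (t * d i)) ** P ** (R ** diag_mat d ** P)
    = R ** diag_mat d ** P ** (R ** diag_mat (\<lambda>i. exp (t * d i)) ** P)"
    by (simp add: conj diag_mat_mult mult.commute)
  have "diag_mat (\<lambda>i. 1) = (mat 1 :: complex^'n^'n)" by (simp add: diag_mat_def mat_def)
  then show "R ** diag_mat (\<lambda>i. exp (0 * d i)) ** P = mat 1" by (simp add: PR)
qed

lemma diag_eigenvector:
  fixes P R :: "complex^'n::finite^'n"
  assumes "P ** R = mat 1"
  shows "(R ** diag_mat d ** P) *v (R *v axis j 1) = d j *s (R *v axis j 1)" "R *v axis j 1 \<noteq> 0"
proof -
  have PR: "P *v (R *v axis j 1) = axis j 1" by (simp add: matrix_vector_mul_assoc assms)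
  have "diag_mat d *v axis j 1 = d j *s axis j 1"
    by (simp add: vec_eq_iff diag_mat_def matrix_vector_mult_def axis_def if_distrib[of "\<lambda>x. x * _"]
      if_distrib[of "(*) _"] sum.If_cases cong: if_cong)
  then show "(R ** diag_mat d ** P) *v (R *v axis j 1) = d j *s (R *v axis j 1)"
    by (simp add: matrix_vector_mul_assoc[symmetric] PR vec.scale)
  show "R *v axis j 1 \<noteq> 0" using PR by (metis axis_eq_0_iff matrix_vector_mult_0_right zero_neq_one)
qed

text \<open>X sends eigenvectors of the diagonalisable matrix to eigenvectors with eigenvalue
  shifted by c, or to zero. Hence some power of X kills each vector of the eigenbasis, and the sum
  of the exponents kills all of them.\<close>

lemma ad_eigenvector_nilpotent:
  fixes P R :: "complex^'n::finite^'n"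
  assumes PR: "P ** R = mat 1" "R ** P = mat 1" and X: "bracket (R ** diag_mat d ** P) X = smat c X" "c \<noteq> 0"
  shows "\<exists>N. mpow X N = 0"
proof -
  let ?u = "\<lambda>j. R *v axis j 1"
  have "\<exists>N. mpow X N *v ?u j = 0" for j
  proof -
    obtain n where "X *v (((*v) X ^^ n) (?u j)) = 0"
      using bracket_power_vanish[OF X(1) diag_eigenvector(1)[OF PR(1)] X(2) diag_eigenvector(2)[OF PR(1)]]
      by metis
    then show ?thesis by (intro exI[of _ "Suc n"]) (simp add: mpow_vector)
  qed
  then obtain N where N: "\<And>j. mpow X (N j) *v ?u j = 0" by metis
  let ?N = "\<Sum>j\<in>UNIV. N j"
  have 0: "mpow X ?N *v ?u j = 0" for j
  proof -
    have "?N = (\<Sum>j\<in>UNIV - {j}. N j) + N j" by (simp add: sum.remove[of UNIV j])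
    then have "mpow X ?N *v ?u j = mpow X (\<Sum>j\<in>UNIV - {j}. N j) *v (mpow X (N j) *v ?u j)"
      by (simp add: mpow_add matrix_vector_mul_assoc matrix_mul_assoc)
    then show ?thesis by (simp add: N)
  qed
  have "(mpow X ?N ** R) *v axis j 1 = 0" for j
    using 0[of j] by (simp add: matrix_vector_mul_assoc)
  then have "(mpow X ?N ** R) $ i $ j = 0" for i j
    by (metis matrix_vector_mult_axis zero_index)
  then have "mpow X ?N ** R = 0" by (simp add: vec_eq_iff)
  then have "mpow X ?N ** R ** P = 0" by simp
  then show ?thesis by (auto simp: matrix_mul_assoc[symmetric] PR)
qed

section \<open>Rational solutions of linear differential equations\<close>

lemma poly_cancel_left:
  fixes p :: "complex poly"
  shows "p * q = p * q' \<Longrightarrow> p \<noteq> 0 \<Longrightarrow> q = q'"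
  by simp

text \<open>Suppose \<psi> has a pole of order m + 1 at r. If y(r) is nonzero, the pole of y \<psi>'
  of order m + 2 cannot be cancelled. If r is a simple root of y, the leading terms of y \<psi>' and
  - \<psi> y' add up with the nonzero factor - (m + 2).\<close>

lemma wronskian_solution_polynomial:
  fixes \<psi> :: ratfun and y S :: "complex poly"
  assumes y: "rsquarefree y"
    and eq: "to_fract y * ratfun_deriv \<psi> - \<psi> * to_fract (pderiv y)
        + ratfun_const \<alpha> * (to_fract y * \<psi>) = to_fract S"
  shows "\<exists>q. \<psi> = to_fract q"
proof -
  obtain c d where cd: "d \<noteq> 0" "coprime c d" "\<psi> = to_fract c / to_fract d"
    by (rule fract_coprime_cases)
  have D: "ratfun_deriv \<psi> = to_fract (pderiv c * d - c * pderiv d) / to_fract (d * d)"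
    using cd ratfun_deriv_Fract[OF cd(1), of c] by (simp add: Fract_conv_to_fract)
  have "to_fract ((pderiv c * d - c * pderiv d) * y - c * d * pderiv y + [:\<alpha>:] * c * d * y)
      = to_fract (S * d * d)"
  proof -
    have fld: "X * y - c * d * y' + \<alpha> * c * d * y = S * d * d"
      if "y * (X / (d * d)) - c / d * y' + \<alpha> * (y * (c / d)) = S" "d \<noteq> 0"
      for y X d c y' \<alpha> S :: ratfun
      using that by (simp add: field_simps)
    show ?thesis
      using fld[OF eq[unfolded D, unfolded cd(3) to_fract_mult]] cd(1)
      by (simp only: to_fract_mult to_fract_diff to_fract_add to_fract_eq_0_iff simp_thms)
  qed
  then have main: "(pderiv c * d - c * pderiv d) * y - c * d * pderiv y + [:\<alpha>:] * c * d * y = S * d * d"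
    by (simp only: to_fract_eq_iff)
  have "degree d = 0"
  proof (rule ccontr)
    assume "degree d \<noteq> 0"
    then obtain r where r: "poly d r = 0"
      using Fundamental_Theorem_Algebra.fundamental_theorem_of_algebra[of d] by (auto simp: constant_degree)
    define L where "L = [:- r, 1:]"
    have L: "pderiv L = 1" "poly L r = 0" "L \<noteq> 0"
      by (simp_all add: L_def pderiv_pCons one_pCons)
    have cr: "poly c r \<noteq> 0"
      using cd(2) r by (metis coprime_poly_0)
    obtain d1 where d1: "d = L ^ Polynomial.order r d * d1" "\<not> L dvd d1"
      using order_decomp[OF cd(1)] unfolding L_def by blast
    then have d1r: "poly d1 r \<noteq> 0" by (simp add: poly_eq_0_iff_dvd L_def)
    obtain m where m: "Polynomial.order r d = Suc m"
      using r cd(1) by (metis not0_implies_Suc order_root)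
    have d: "d = L ^ m * (L * d1)" using d1(1) unfolding m by (simp add: mult_ac)
    have d': "pderiv d = L ^ m * ([:of_nat (Suc m):] * d1 + L * pderiv d1)"
    proof -
      have "pderiv d = L ^ Suc m * pderiv d1 + d1 * pderiv (L ^ Suc m)"
        using arg_cong[OF d1(1), of pderiv] unfolding m pderiv_mult .
      also have "pderiv (L ^ Suc m) = [:of_nat (Suc m):] * L ^ m"
        by (simp only: pderiv_power_Suc L) simp
      finally show ?thesis by (simp only: algebra_simps power_Suc)
    qed
    have "L ^ m * ((pderiv c * L * d1 - c * ([:of_nat (Suc m):] * d1 + L * pderiv d1)) * y
         - c * L * d1 * pderiv y + [:\<alpha>:] * c * L * d1 * y) = L ^ m * (S * d * L * d1)"
    proof -
      have "L ^ m * ((pderiv c * L * d1 - c * ([:of_nat (Suc m):] * d1 + L * pderiv d1)) * y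
         - c * L * d1 * pderiv y + [:\<alpha>:] * c * L * d1 * y)
         = (pderiv c * (L ^ m * (L * d1)) - c * (L ^ m * ([:of_nat (Suc m):] * d1 + L * pderiv d1))) * y
         - c * (L ^ m * (L * d1)) * pderiv y + [:\<alpha>:] * c * (L ^ m * (L * d1)) * y"
        by (simp only: algebra_simps)
      also have "\<dots> = S * d * (L ^ m * (L * d1))"
        using main unfolding d'[symmetric] d[symmetric] .
      finally show ?thesis by (simp only: mult_ac)
    qed
    then have m1: "(pderiv c * L * d1 - c * ([:of_nat (Suc m):] * d1 + L * pderiv d1)) * y
         - c * L * d1 * pderiv y + [:\<alpha>:] * c * L * d1 * y = S * d * L * d1"
      by (rule poly_cancel_left) (simp add: L)
    \<comment> \<open>All terms except c (m + 1) d1 y contain L and vanish at r.\<close>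
    from arg_cong[OF this, of "\<lambda>p. poly p r"]
    have "of_nat (Suc m) * (poly c r * poly d1 r * poly y r) = 0"
      using r by (simp add: L algebra_simps add_eq_0_iff)
    then have yr: "poly y r = 0"
      using cr d1r by (simp del: of_nat_Suc)
    then obtain y1 where y1: "y = L * y1" by (auto simp: poly_eq_0_iff_dvd L_def elim: dvdE)
    have y': "poly (pderiv y) r = poly y1 r"
      unfolding y1 pderiv_mult by (simp add: L)
    have "L * ((pderiv c * L * d1 - c * ([:of_nat (Suc m):] * d1 + L * pderiv d1)) * y1
         - c * d1 * pderiv y + [:\<alpha>:] * c * L * d1 * y1) = L * (S * d * d1)"
      using m1 unfolding y1 by (simp only: algebra_simps)
    then have "(pderiv c * L * d1 - c * ([:of_nat (Suc m):] * d1 + L * pderiv d1)) * y1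
         - c * d1 * pderiv y + [:\<alpha>:] * c * L * d1 * y1 = S * d * d1"
      by (rule poly_cancel_left) (simp add: L)
    \<comment> \<open>The right-hand side vanishes since d does. The factor m + 2 is the previous m
      + 1 plus one from y', whose value at r is that of y1.\<close>
    from arg_cong[OF this, of "\<lambda>p. poly p r"]
    have "of_nat (Suc (Suc m)) * (poly c r * poly d1 r * poly y1 r) = 0"
      using r by (simp add: y' L algebra_simps) (simp add: add_eq_0_iff)
    then have "poly y1 r = 0" using cr d1r by (simp del: of_nat_Suc)
    then show False using y yr y' by (auto simp: rsquarefree_roots)
  qed
  then obtain k where k: "d = [:k:]" by (rule degree_eq_zeroE)
  have "\<psi> = to_fract (smult (1 / k) c)"
    using cd(1) unfolding cd(3) k by (simp add: to_fract_def eq_fract)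
  then show ?thesis by blast
qed

lemma wronskian_ratfun_iff:
  "wronskian p q + smult \<alpha> (p * q) = S \<longleftrightarrow>
   to_fract p * ratfun_deriv (to_fract q) - to_fract q * to_fract (pderiv p)
        + ratfun_const \<alpha> * (to_fract p * to_fract q) = to_fract S"
proof -
  have "to_fract (wronskian p q + smult \<alpha> (p * q)) =
    to_fract p * ratfun_deriv (to_fract q) - to_fract q * to_fract (pderiv p)
        + to_fract [:\<alpha>:] * (to_fract p * to_fract q)"
    unfolding wronskian_def ratfun_deriv_to_fract to_fract_mult[symmetric] to_fract_diff[symmetric]
      to_fract_add[symmetric] by simp
  then show ?thesis by (metis to_fract_eq_iff)
qed

text \<open>Equal logarithmic derivatives make p / q constant, and leading coefficients 1 make the
  constant 1.\<close>

lemma ldiff_monic_unique: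
  fixes p q :: "complex poly"
  assumes "ratfun_ldiff (to_fract p) = ratfun_ldiff (to_fract q)" "lead_coeff p = 1" "lead_coeff q = 1"
  shows "p = q"
proof -
  have nz: "p \<noteq> 0" "q \<noteq> 0" using assms by auto
  have "ratfun_ldiff (to_fract p * inverse (to_fract q)) = 0"
    using nz assms(1) by (simp add: ratfun_ldiff_mult ratfun_ldiff_inverse)
  then have "ratfun_deriv (to_fract p * inverse (to_fract q)) = 0"
    using nz by (simp add: ratfun_ldiff_def)
  then obtain c where "to_fract p * inverse (to_fract q) = ratfun_const c"
    unfolding ratfun_deriv_eq_0_iff by blast
  then have "to_fract p = to_fract ([:c:] * q)"
    using nz unfolding to_fract_mult by (simp add: field_simps)
  then have "p = [:c:] * q" by (simp only: to_fract_eq_iff)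
  then show ?thesis using assms(2,3) by (metis lead_coeff_smult mult.right_neutral
      mult_pCons_left mult_zero_left pCons_0_0 add_0_right smult_1_left)
qed

text \<open>Fitting's lemma: once the kernels of the powers of T are stationary, the kernel and the
  image of T^M meet only in 0. The generalised null vector x is then outside the image, and R is any
  linear map that kills the image and fixes x; it need not commute with T.\<close>

lemma fitting_projection:
  fixes T :: "complex^'m::finite^'m"
  assumes x: "x \<noteq> 0" and K: "mpow T K *v x = 0"
  obtains M R where "R ** mpow T M = 0" "R *v x = x"
proof -
  let ?ker = "\<lambda>k. {w. mpow T k *v w = 0}"
  have sub: "vec.subspace (?ker k)" for k
    by (auto simp: vec.subspace_def vec.add vec.scale)
  \<comment> \<open>Kernel dimensions are bounded by that of the whole space, so one of them is
    maximal.\<close>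
  have "\<exists>M. True \<and> (\<forall>k. True \<longrightarrow> vec.dim (?ker k) \<le> vec.dim (?ker M))"
  proof (rule ex_has_greatest_nat[of "\<lambda>_. True" 0 _ "Suc CARD('m)"])
    show "\<forall>k. True \<longrightarrow> vec.dim (?ker k) < Suc CARD('m)"
      using dim_subset_UNIV_cart_gen by (auto simp only: less_Suc_eq_le)
  qed simp
  then obtain M where M: "\<And>k. vec.dim (?ker k) \<le> vec.dim (?ker M)" by blast
  let ?S = "mpow T M"
  have notin: "x \<notin> range ((*v) ?S)"
  proof
    assume "x \<in> range ((*v) ?S)"
    then obtain w where w: "x = ?S *v w" by blast
    have "?ker M \<subseteq> ?ker (K + M)"
      by (auto simp: mpow_add matrix_vector_mul_assoc[symmetric])
    then have "?ker M = ?ker (K + M)"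
      by (rule vec.subspace_dim_equal[OF sub sub _ M])
    moreover have "w \<in> ?ker (K + M)"
      using K by (simp add: mpow_add matrix_vector_mul_assoc[symmetric] w)
    ultimately show False using x w by blast
  qed
  have subr: "vec.subspace (range ((*v) ?S))"
    by (rule vec.subspace_image) simp
  obtain B where B: "B \<subseteq> range ((*v) ?S)" "vec.independent B" "range ((*v) ?S) \<subseteq> vec.span B"
    by (rule vec.basis_exists) blast
  have "vec.span B \<subseteq> range ((*v) ?S)" using vec.span_minimal[OF B(1) subr] .
  then have xB: "x \<notin> vec.span B" using notin by blast
  then have "vec.independent (insert x B)" using B(2) by (simp add: vec.independent_insert)
  then obtain g where g: "Vector_Spaces.linear (*s) (*s) g"
    "\<forall>b\<in>insert x B. g b = (if b = x then x else 0)"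
    using vec.linear_independent_extend[of "insert x B" "\<lambda>b. if b = x then x else 0"] by blast
  have gR: "matrix g *v w = g w" for w by (rule matrix_works[OF g(1)])
  have "g b = 0" if "b \<in> B" for b
    using g(2) that xB vec.span_base by auto
  then have "g w = 0" if "w \<in> vec.span B" for w
    using vec.linear_eq_0_on_span[OF g(1)] that by blast
  then have "matrix g ** ?S = 0"
    using B(3) by (auto simp: matrix_eq matrix_vector_mul_assoc[symmetric] gR)
  moreover have "matrix g *v x = x" using g(2) by (simp add: gR)
  ultimately show thesis by (rule that)
qed

definition vec_deriv :: "ratfun^'m::finite \<Rightarrow> ratfun^'m" where
  "vec_deriv u = (\<chi> i. ratfun_deriv (u $ i))"

lemma vec_deriv_nth [simp]: "vec_deriv u $ i = ratfun_deriv (u $ i)"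
  by (simp add: vec_deriv_def)

lemma const_matrix_vector_nth:
  "(const_matrix T *v u) $ i = (\<Sum>j\<in>UNIV. ratfun_const (T $ i $ j) * u $ j)"
  by (simp add: const_matrix_def map_matrix_def matrix_vector_mult_def)

text \<open>At a pole u' has a higher order than T u. The induction on the degree of a common
  denominator cancels one of its roots from all entries at a time.\<close>

lemma constant_system_polynomial:
  fixes u :: "ratfun^'m::finite"
  assumes u: "vec_deriv u + const_matrix T *v u = 0"
  obtains p where "\<And>i. u $ i = to_fract (p i)"
proof -
  have Du: "ratfun_deriv (u $ i) = - (\<Sum>j\<in>UNIV. ratfun_const (T $ i $ j) * u $ j)" for i
    using u by (simp add: vec_eq_iff const_matrix_vector_nth add_eq_0_iff2)
  have "\<exists>p. \<forall>i. u $ i = to_fract (p i)"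
    if "b \<noteq> 0" "\<And>i. u $ i = to_fract (N i) / to_fract b" for b N
    using that
  proof (induction "degree b" arbitrary: b N rule: less_induct)
    case less
    show ?case
    proof (cases "degree b = 0")
      case True
      then obtain k where k: "b = [:k:]" by (rule degree_eq_zeroE)
      have "u $ i = to_fract (smult (1 / k) (N i))" for i
        using less.prems unfolding k by (simp add: to_fract_def eq_fract)
      then show ?thesis by (intro exI[of _ "\<lambda>i. smult (1 / k) (N i)"]) blast
    next
      case False
      then obtain r where r: "poly b r = 0"
        using Fundamental_Theorem_Algebra.fundamental_theorem_of_algebra[of b] by (auto simp: constant_degree)
      let ?L = "[:- r, 1:]"
      have "?L dvd N i" for i
      proof (cases "N i = 0")
        case Ni: False
        have "ratfun_deriv (u $ i) = to_fract (pderiv (N i) * b - N i * pderiv b) / to_fract (b * b)"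
          using less.prems(2)[of i] ratfun_deriv_Fract[OF less.prems(1), of "N i"]
          by (simp add: Fract_conv_to_fract)
        moreover have "ratfun_deriv (u $ i) = - to_fract (\<Sum>j\<in>UNIV. [:T $ i $ j:] * N j) / to_fract b"
          unfolding Du to_fract_sum to_fract_mult by (simp add: less.prems(2)[of "_ :: 'm"] sum_divide_distrib)
        ultimately have "to_fract (pderiv (N i) * b - N i * pderiv b)
            = to_fract (- (\<Sum>j\<in>UNIV. [:T $ i $ j:] * N j) * b)"
          using less.prems(1) by (simp add: field_simps)
        then have "pderiv (N i) * b - N i * pderiv b = - (\<Sum>j\<in>UNIV. [:T $ i $ j:] * N j) * b"
          by (simp only: to_fract_eq_iff)
        then have "N i * pderiv b = b * (pderiv (N i) + (\<Sum>j\<in>UNIV. [:T $ i $ j:] * N j))"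
          by (simp add: algebra_simps)
        \<comment> \<open>The order of r in b exceeds its order in b' by one, so \<open>N i\<close>
          has to supply a factor that vanishes at r.\<close>
        then have dvd: "b dvd N i * pderiv b" by simp
        have b': "pderiv b \<noteq> 0" using False by (simp add: pderiv_eq_0_iff)
        have ord: "Polynomial.order r b = Suc (Polynomial.order r (pderiv b))"
          by (rule order_pderiv[OF less.prems(1) r])
        have "Polynomial.order r b \<le> Polynomial.order r (N i * pderiv b)"
          using dvd_imp_order_le[OF _ dvd] Ni b' by simp
        also have "\<dots> = Polynomial.order r (N i) + Polynomial.order r (pderiv b)"
          by (rule order_mult) (use Ni b' in simp)
        finally have "Polynomial.order r (N i) \<noteq> 0" using ord by simp
        then have "poly (N i) r = 0" by (simp add: order_root)
        then show ?thesis by (simp add: poly_eq_0_iff_dvd)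
      qed simp
      then have "\<forall>i. \<exists>n. N i = ?L * n" unfolding dvd_def by blast
      then obtain N' where N': "\<And>i. N i = ?L * N' i" by (auto dest!: choice)
      have "?L dvd b" using r by (simp only: poly_eq_0_iff_dvd)
      then obtain b' where b': "b = ?L * b'" by (rule dvdE)
      have nz: "b' \<noteq> 0" using less.prems(1) b' by auto
      have "degree b' < degree b"
        unfolding b' using nz by (subst degree_mult_eq) auto
      moreover have "u $ i = to_fract (N' i) / to_fract b'" for i
      proof -
        have "to_fract ?L \<noteq> 0" by simp
        then show ?thesis
          unfolding less.prems(2)[of i] N'[of i] b' to_fract_mult
          by (rule nonzero_mult_divide_mult_cancel_left)
      qed
      ultimately show ?thesis using less.hyps nz by blast
    qed
  qed
  moreover obtain b N where "b \<noteq> 0" "\<And>i. u $ i = to_fract (N i) / to_fract b"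
    using common_denominator[of "($) u"] by blast
  ultimately show thesis using that by blast
qed

lemma pderiv_sum: "pderiv (\<Sum>i\<in>I. f i) = (\<Sum>i\<in>I. pderiv (f i))"
  by (induction I rule: infinite_finite_induct) (simp_all add: pderiv_add)

text \<open>For a solution p of p' = - T p, the vector T^k p is up to sign the k-th derivative of p,
  which vanishes beyond the degrees.\<close>

lemma constant_system_nilpotent:
  fixes T :: "complex^'m::finite^'m"
  assumes p: "\<And>i. pderiv (p i) = - (\<Sum>j\<in>UNIV. smult (T $ i $ j) (p j))"
  shows "\<exists>K. mpow T K *v (\<chi> i. poly (p i) z) = 0"
proof -
  define P where "P = (\<lambda>k. \<chi> i. poly ((pderiv ^^ k) (p i)) z)"
  have p': "(pderiv ^^ Suc k) (p i) = - (\<Sum>j\<in>UNIV. smult (T $ i $ j) ((pderiv ^^ k) (p j)))" for k i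
  proof (induction k)
    case (Suc k)
    then show ?case by (simp add: pderiv_minus pderiv_smult pderiv_sum)
  qed (simp add: p)
  have step: "T *v P k = - P (Suc k)" for k
    unfolding vec_eq_iff
    by (simp only: P_def p') (simp add: matrix_vector_mult_def poly_sum)
  have pow: "mpow T k *v P 0 = (- 1) ^ k *s P k" for k
  proof (induction k)
    case (Suc k)
    have "mpow T (Suc k) *v P 0 = T *v (mpow T k *v P 0)"
      by (simp add: mpow_Suc matrix_vector_mul_assoc)
    also have "\<dots> = (- 1) ^ Suc k *s P (Suc k)"
      by (simp add: Suc.IH vec.scale step vec_eq_iff)
    finally show ?case .
  qed simp
  let ?K = "Suc (\<Sum>i\<in>UNIV. degree (p i))"
  have "(pderiv ^^ ?K) (p i) = 0" for i
  proof -
    have "degree (p i) \<le> (\<Sum>i\<in>UNIV. degree (p i))" by (rule member_le_sum) auto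
    then have "degree ((pderiv ^^ (?K - 1)) (p i)) = 0" by (simp add: degree_higher_pderiv)
    then show ?thesis by (simp add: pderiv_eq_0_iff)
  qed
  then have "P ?K = 0" unfolding P_def by (simp add: vec_eq_iff del: funpow.simps)
  then have "mpow T ?K *v P 0 = 0" by (simp only: pow) simp
  then show ?thesis unfolding P_def by auto
qed

text \<open>
  Over the field of rational functions, an extension that embeds into a system with constant
  coefficients splits. If T were diagonalizable, u2 could be paired with a constant eigenvector;
  in general the pairing is with R exp ((z - z0) T), which is polynomial in z since R kills a
  power of T.
\<close>

lemma constant_system_splits:
  fixes u\<^sub>1 u\<^sub>2 :: "ratfun^'m::finite" and T :: "complex^'m^'m"
  assumes u1: "vec_deriv u\<^sub>1 + const_matrix T *v u\<^sub>1 = 0" "u\<^sub>1 \<noteq> 0"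
    and u2: "vec_deriv u\<^sub>2 + const_matrix T *v u\<^sub>2 = s *s u\<^sub>1 - ratfun_const \<alpha> *s u\<^sub>2"
  shows "\<exists>\<phi>. ratfun_deriv \<phi> + ratfun_const \<alpha> * \<phi> = s"
proof -
  obtain p where p: "\<And>i. u\<^sub>1 $ i = to_fract (p i)"
    using constant_system_polynomial[OF u1(1)] by blast
  have "to_fract (pderiv (p i)) = to_fract (- (\<Sum>j\<in>UNIV. smult (T $ i $ j) (p j)))" for i
  proof -
    have "ratfun_deriv (u\<^sub>1 $ i) = - (\<Sum>j\<in>UNIV. ratfun_const (T $ i $ j) * u\<^sub>1 $ j)"
      using u1(1) by (simp add: vec_eq_iff const_matrix_vector_nth add_eq_0_iff2)
    also have "\<dots> = - to_fract (\<Sum>j\<in>UNIV. [:T $ i $ j:] * p j)"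
      by (simp only: p to_fract_sum to_fract_mult)
    finally show ?thesis by (simp add: p)
  qed
  then have p': "pderiv (p i) = - (\<Sum>j\<in>UNIV. smult (T $ i $ j) (p j))" for i
    by (simp only: to_fract_eq_iff)
  obtain i\<^sub>0 where "u\<^sub>1 $ i\<^sub>0 \<noteq> 0" using u1(2) by (auto simp: vec_eq_iff)
  then have "p i\<^sub>0 \<noteq> 0" using p by auto
  then obtain z\<^sub>0 where z0: "poly (p i\<^sub>0) z\<^sub>0 \<noteq> 0" using poly_all_0_iff_0 by blast
  define x where "x = (\<chi> i. poly (p i) z\<^sub>0)"
  have "x \<noteq> 0" using z0 by (auto simp: x_def vec_eq_iff)
  obtain K where "mpow T K *v x = 0"
    using constant_system_nilpotent[OF p'] unfolding x_def by blast
  then obtain M R where R: "R ** mpow T M = 0" "R *v x = x"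
    by (rule fitting_projection[OF \<open>x \<noteq> 0\<close>])
  \<comment> \<open>With \<open>a k\<close> equal to (z - z0)^k / k!, the functional
    \<open>\<psi>\<close> takes u to the entry \<open>i\<^sub>0\<close> of R exp ((z - z0) T) u; the
    series stops at M because R T^M = 0.\<close>
  define \<tau> where "\<tau> = to_fract [:- z\<^sub>0, 1:]"
  define a where "a = (\<lambda>k. \<tau> ^ k * ratfun_const (1 / fact k))"
  define l where "l = (\<lambda>k (u :: ratfun^'m). (const_matrix (R ** mpow T k) *v u) $ i\<^sub>0)"
  define \<psi> where "\<psi> = (\<lambda>u. \<Sum>k<M. a k * l k u)"
  have a0: "ratfun_deriv (a 0) = 0" by (simp add: a_def one_pCons[symmetric])
  have aSuc: "ratfun_deriv (a (Suc k)) = a k" for k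
  proof -
    have "ratfun_deriv \<tau> = 1" by (simp add: \<tau>_def pderiv_pCons one_pCons[symmetric])
    then have "ratfun_deriv (a (Suc k)) = of_nat (Suc k) * \<tau> ^ k * ratfun_const (1 / fact (Suc k))"
      by (simp add: a_def ratfun_deriv_mult ratfun_deriv_power del: of_nat_Suc power_Suc)
    also have "of_nat (Suc k) = ratfun_const (of_nat (Suc k))"
      by (simp add: of_nat_fract to_fract_def of_nat_poly)
    also have "ratfun_const (of_nat (Suc k)) * \<tau> ^ k * ratfun_const (1 / fact (Suc k))
        = \<tau> ^ k * to_fract ([:of_nat (Suc k):] * [:1 / fact (Suc k):])"
      by (simp only: to_fract_mult mult_ac)
    also have "[:of_nat (Suc k):] * [:1 / fact (Suc k):] = [:1 / fact k :: complex:]"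
      by (simp add: fact_Suc del: of_nat_Suc)
    finally show ?thesis by (simp add: a_def)
  qed
  have l_add: "l k (u + w) = l k u + l k w" for k u w
    by (simp add: l_def vec.add)
  have l_scale: "l k (c *s u) = c * l k u" for k c u
    by (simp add: l_def vec.scale)
  have l_deriv: "ratfun_deriv (l k u) = l k (vec_deriv u)" for k u
    by (simp add: l_def const_matrix_vector_nth ratfun_deriv_sum ratfun_deriv_const_mult)
  have lT: "l k (const_matrix T *v u) = l (Suc k) u" for k u
  proof -
    have "evm (const_matrix (R ** mpow T k) ** const_matrix T) z = evm (const_matrix (R ** mpow T (Suc k))) z"
      if "evm (const_matrix (R ** mpow T k) ** const_matrix T) z
        = evm (const_matrix (R ** mpow T k)) z ** evm (const_matrix T) z" for z
      using that by (simp add: mpow_Suc2 matrix_mul_assoc)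
    then have "const_matrix (R ** mpow T k) ** const_matrix T = const_matrix (R ** mpow T (Suc k))"
      by (intro evm_eqI eventually_mono[OF evm_mult])
    then show ?thesis by (simp add: l_def matrix_vector_mul_assoc)
  qed
  have lM: "l M u = 0" for u
    unfolding l_def R(1) by (simp add: const_matrix_vector_nth)
  have \<psi>_add: "\<psi> (u + w) = \<psi> u + \<psi> w" for u w
    by (simp add: \<psi>_def l_add distrib_left sum.distrib)
  have \<psi>_scale: "\<psi> (c *s u) = c * \<psi> u" for c u
    by (simp add: \<psi>_def l_scale sum_distrib_left mult.left_commute)
  \<comment> \<open>Differentiating the exponential produces the factor T, so \<open>\<psi>\<close>
    carries the connection d/dz + T to d/dz. The sum may be extended to k = M for the shift because
    \<open>l M\<close> is zero.\<close>
  have D\<psi>: "ratfun_deriv (\<psi> u) = \<psi> (vec_deriv u + const_matrix T *v u)" for u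
  proof -
    have "(\<Sum>k<M. ratfun_deriv (a k) * l k u) = (\<Sum>k<Suc M. ratfun_deriv (a k) * l k u)"
      by (simp add: lM)
    also have "\<dots> = (\<Sum>k<M. a k * l k (const_matrix T *v u))"
      by (subst sum.lessThan_Suc_shift) (simp add: a0 aSuc lT)
    finally show ?thesis
      by (simp add: \<psi>_def ratfun_deriv_sum ratfun_deriv_mult l_deriv l_add distrib_left sum.distrib)
  qed
  have "ratfun_deriv (\<psi> u\<^sub>1) = 0" unfolding D\<psi> u1(1) by (simp add: \<psi>_def l_def)
  then obtain c where c: "\<psi> u\<^sub>1 = ratfun_const c" unfolding ratfun_deriv_eq_0_iff by blast
  have "M \<noteq> 0"
    using R \<open>x \<noteq> 0\<close> by (metis matrix_vector_mult_0 mpow_0 matrix_mul_rid)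
  then obtain M' where M': "M = Suc M'" by (cases M) auto
  \<comment> \<open>The constant is found at z0, where only k = 0 survives. It equals the entry
    \<open>i\<^sub>0\<close> of R x = x, which is nonzero by the choice of z0.\<close>
  have "c = x $ i\<^sub>0"
  proof -
    define q where "q = (\<lambda>k. [:- z\<^sub>0, 1:] ^ k * [:1 / fact k:] *
      (\<Sum>j\<in>UNIV. [:(R ** mpow T k) $ i\<^sub>0 $ j:] * p j))"
    have "\<psi> u\<^sub>1 = to_fract (\<Sum>k<M. q k)"
      unfolding \<psi>_def a_def l_def const_matrix_vector_nth p \<tau>_def q_def to_fract_sum to_fract_mult to_fract_power ..
    then have "[:c:] = (\<Sum>k<M. q k)" by (simp only: c to_fract_eq_iff)
    then have "poly [:c:] z\<^sub>0 = poly (\<Sum>k<M. q k) z\<^sub>0" by (rule arg_cong)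
    also have "\<dots> = poly (q 0) z\<^sub>0"
      unfolding M' by (subst sum.lessThan_Suc_shift) (simp add: poly_sum q_def)
    also have "\<dots> = (R *v x) $ i\<^sub>0"
      by (simp add: q_def poly_sum matrix_vector_mult_def x_def)
    finally show ?thesis by (simp add: R(2))
  qed
  then have "c \<noteq> 0" using z0 by (simp add: x_def)
  \<comment> \<open>Applying \<open>\<psi>\<close> to the second equation leaves a scalar equation
    with right-hand side c s; dividing by c gives the solution.\<close>
  have "ratfun_deriv (\<psi> u\<^sub>2) = \<psi> (s *s u\<^sub>1 + (- ratfun_const \<alpha>) *s u\<^sub>2)"
    unfolding D\<psi> u2 by (simp add: vec.scale_minus_left)
  also have "\<dots> = s * ratfun_const c - ratfun_const \<alpha> * \<psi> u\<^sub>2"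
    unfolding \<psi>_add \<psi>_scale c by simp
  finally have eq: "ratfun_deriv (\<psi> u\<^sub>2) = s * ratfun_const c - ratfun_const \<alpha> * \<psi> u\<^sub>2" .
  have cc: "ratfun_const (1 / c) * ratfun_const c = 1"
    using \<open>c \<noteq> 0\<close> unfolding to_fract_mult[symmetric] by (simp add: one_pCons[symmetric])
  have "ratfun_deriv (ratfun_const (1 / c) * \<psi> u\<^sub>2) + ratfun_const \<alpha> * (ratfun_const (1 / c) * \<psi> u\<^sub>2)
      = s * (ratfun_const (1 / c) * ratfun_const c)"
    unfolding ratfun_deriv_const_mult eq by (simp add: algebra_simps del: to_fract_mult)
  then show ?thesis unfolding cc by auto
qed

section \<open>Differentiating representations\<close>

lemma rep_deriv_add: "rep_deriv id \<rho> (X + Y) = rep_deriv id \<rho> X + rep_deriv id \<rho> Y"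
  by (simp add: rep_deriv_def vec_eq_iff gl_deriv_linear)

lemma rep_deriv_smat: "rep_deriv id \<rho> (smat a X) = smat a (rep_deriv id \<rho> X)"
  by (simp add: rep_deriv_def vec_eq_iff gl_deriv_linear)

lemma rep_deriv_0 [simp]: "rep_deriv id \<rho> 0 = 0"
  using rep_deriv_smat[of \<rho> 0 0] by simp

lemma rep_deriv_sum: "rep_deriv id \<rho> (\<Sum>i\<in>I. f i) = (\<Sum>i\<in>I. rep_deriv id \<rho> (f i))"
  using sum_comp_morphism[of "rep_deriv id \<rho>" f I] by (simp add: rep_deriv_add o_def)

lemma matrix_eq_sum_units:
  fixes A :: "'a::semiring_1^'n::finite^'m::finite"
  shows "A = (\<Sum>i\<in>UNIV. \<Sum>j\<in>UNIV. smat (A $ i $ j) (\<chi> k l. if k = i \<and> l = j then 1 else 0))"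
proof -
  have "(\<Sum>i\<in>UNIV. \<Sum>j\<in>UNIV. A $ i $ j * (if k = i \<and> l = j then 1 else 0)) = A $ k $ l" for k l
  proof -
    have "(\<Sum>i\<in>UNIV. \<Sum>j\<in>UNIV. A $ i $ j * (if k = i \<and> l = j then 1 else 0))
        = (\<Sum>i\<in>UNIV. \<Sum>j\<in>UNIV. if j = l then (if i = k then A $ i $ j else 0) else 0)"
      by (intro sum.cong refl) auto
    then show ?thesis by simp
  qed
  then show ?thesis by (simp add: vec_eq_iff)
qed

text \<open>As \<open>rep_deriv\<close> is linear, expansion in matrix units turns it into a sum
  with constant coefficient matrices.\<close>

lemma entry_deriv_rep_deriv:
  assumes c: "entry_deriv c C t"
  shows "entry_deriv (\<lambda>s. rep_deriv id \<rho> (c s)) (rep_deriv id \<rho> C) t"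
proof -
  define U where "U = (\<lambda>i j. rep_deriv id \<rho> (\<chi> k l. if k = i \<and> l = j then 1 else 0))"
  have *: "rep_deriv id \<rho> A = (\<Sum>i\<in>UNIV. \<Sum>j\<in>UNIV. smat (A $ i $ j) (U i j))" for A
    using arg_cong[OF matrix_eq_sum_units[of A], of "rep_deriv id \<rho>"]
    unfolding rep_deriv_sum rep_deriv_smat U_def .
  show ?thesis
    unfolding entry_deriv_def *[of "c _"] *[of C] sum_component smat_nth
    using c unfolding entry_deriv_def by (intro allI DERIV_sum DERIV_cmult_right) blast
qed

lemma entry_deriv_vector:
  "entry_deriv c C t \<Longrightarrow> ((\<lambda>s. (c s *v w) $ i) has_field_derivative (C *v w) $ i) (at t)"
  unfolding entry_deriv_def matrix_vector_mult_def
  by (auto intro!: DERIV_sum DERIV_cmult_right)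

context one_parameter_curve
begin

text \<open>Multiplication by \<gamma>(- t) moves the curve through the identity at time t, where
  \<open>gl_deriv\<close> applies; multiplicativity on G moves it back.\<close>

lemma rep_eval_deriv:
  assumes \<rho>: "rational_representation G \<rho>" and G: "group (matrix_group G)" "\<And>t. \<gamma> t \<in> G"
  shows "entry_deriv (\<lambda>s. rep_eval id \<rho> (\<gamma> s)) (rep_eval id \<rho> (\<gamma> t) ** rep_deriv id \<rho> X) t"
proof -
  have inv': "\<gamma> (- s) ** \<gamma> s = mat 1" for s using inv[of "- s"] by simp
  let ?c = "\<lambda>s. \<gamma> (- t) ** \<gamma> s" and ?d = "\<lambda>s. \<gamma> (- s) ** \<gamma> t"
  have "entry_deriv ?c (\<gamma> (- t) ** (\<gamma> t ** X)) t"
    using entry_deriv_mult[OF entry_deriv_const[of "\<gamma> (- t)"] deriv[of t]] by simp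
  then have c: "entry_deriv ?c X t" by (simp add: matrix_mul_assoc inv')
  have "entry_deriv ?d (- (X ** \<gamma> (- t)) ** \<gamma> t) t"
    using entry_deriv_mult[OF deriv_inv[of t] entry_deriv_const[of "\<gamma> t"]] by simp
  then have d: "entry_deriv ?d (- X) t"
    by (simp add: matrix_mult_uminus matrix_mul_assoc[symmetric] inv')
  have cd: "?c s ** ?d s = mat 1" for s
  proof -
    have "?c s ** ?d s = \<gamma> (- t) ** (\<gamma> s ** \<gamma> (- s)) ** \<gamma> t" by (simp only: matrix_mul_assoc)
    then show ?thesis by (simp add: inv inv')
  qed
  have c': "entry_deriv (\<lambda>s. rep_eval id \<rho> (?c s)) (rep_deriv id \<rho> X) t"
    unfolding entry_deriv_def rep_eval_def rep_deriv_def
    using gl_deriv_curve[OF c _ d] by (simp add: inv' gl_eval_pair[OF cd])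
  have eq: "rep_eval id \<rho> (\<gamma> s) = rep_eval id \<rho> (\<gamma> t) ** rep_eval id \<rho> (?c s)" for s
  proof -
    have "?c s \<in> G" by (rule matrix_groupD(2)[OF G(1) G(2) G(2)])
    then have "rep_eval id \<rho> (\<gamma> t ** ?c s) = rep_eval id \<rho> (\<gamma> t) ** rep_eval id \<rho> (?c s)"
      using \<rho> G(2)[of t] unfolding rational_representation_def by blast
    moreover have "\<gamma> t ** ?c s = \<gamma> s" by (simp add: matrix_mul_assoc inv)
    ultimately show ?thesis by simp
  qed
  have "(\<lambda>s. rep_eval id \<rho> (\<gamma> s)) = (\<lambda>s. rep_eval id \<rho> (\<gamma> t) ** rep_eval id \<rho> (?c s))"
    using eq by (rule ext)
  moreover have "entry_deriv (\<lambda>s. rep_eval id \<rho> (\<gamma> t) ** rep_eval id \<rho> (?c s))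
      (rep_eval id \<rho> (\<gamma> t) ** rep_deriv id \<rho> X) t"
    using entry_deriv_mult[OF entry_deriv_const[of "rep_eval id \<rho> (\<gamma> t)"] c'] by simp
  ultimately show ?thesis by (simp only:)
qed

text \<open>The image of w along the curve solves M' = \<mu> M with M(0) = w, so exp (- \<mu> t) M
  is constant.\<close>

lemma rep_eval_eigen:
  assumes \<rho>: "rational_representation G \<rho>" and G: "group (matrix_group G)" "\<And>t. \<gamma> t \<in> G"
    and w: "rep_deriv id \<rho> X *v w = \<mu> *s w"
  shows "rep_eval id \<rho> (\<gamma> t) *v w = exp (t * \<mu>) *s w"
proof -
  define M where "M = (\<lambda>t. rep_eval id \<rho> (\<gamma> t) *v w)"
  have D: "((\<lambda>s. M s $ i) has_field_derivative \<mu> * M t $ i) (at t)" for i t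
  proof -
    have "((\<lambda>s. M s $ i) has_field_derivative
        ((rep_eval id \<rho> (\<gamma> t) ** rep_deriv id \<rho> X) *v w) $ i) (at t)"
      unfolding M_def by (rule entry_deriv_vector[OF rep_eval_deriv[OF \<rho> G]])
    also have "((rep_eval id \<rho> (\<gamma> t) ** rep_deriv id \<rho> X) *v w) $ i = \<mu> * M t $ i"
      by (simp add: matrix_vector_mul_assoc[symmetric] w vec.scale M_def del: id_apply)
    finally show ?thesis .
  qed
  have "exp (- (t * \<mu>)) * M t $ i = w $ i" for i
  proof -
    have "((\<lambda>s. exp (- (s * \<mu>)) * M s $ i) has_field_derivative 0) (at s within UNIV)" for s
      using D[of i s] by (auto intro!: derivative_eq_intros)
    then obtain c where "\<And>s. exp (- (s * \<mu>)) * M s $ i = c"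
      using has_field_derivative_zero_constant[of UNIV "\<lambda>s. exp (- (s * \<mu>)) * M s $ i"] by auto
    moreover have "M 0 = w"
      using \<rho> by (simp add: M_def zero rational_representation_def)
    ultimately show ?thesis by (metis exp_zero minus_zero mult_1 mult_zero_left)
  qed
  then have "M t $ i = exp (t * \<mu>) * w $ i" for i
    by (metis exp_minus_inverse mult.assoc mult_1)
  then show ?thesis by (simp add: M_def vec_eq_iff)
qed

lemma rep_eval_unipotent:
  assumes \<rho>: "rational_representation G \<rho>" and G: "group (matrix_group G)" "\<And>t. \<gamma> t \<in> G"
    and w: "rep_deriv id \<rho> X *v w = w'" "rep_deriv id \<rho> X *v w' = 0"
  shows "rep_eval id \<rho> (\<gamma> t) *v w = w + t *s w'"
proof -
  have w': "rep_eval id \<rho> (\<gamma> t) *v w' = w'" for t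
    using rep_eval_eigen[OF \<rho> G, of w' 0] w(2) by simp
  define M where "M = (\<lambda>t. rep_eval id \<rho> (\<gamma> t) *v w)"
  have D: "((\<lambda>s. M s $ i) has_field_derivative w' $ i) (at t)" for i t
  proof -
    have "((\<lambda>s. M s $ i) has_field_derivative
        ((rep_eval id \<rho> (\<gamma> t) ** rep_deriv id \<rho> X) *v w) $ i) (at t)"
      unfolding M_def by (rule entry_deriv_vector[OF rep_eval_deriv[OF \<rho> G]])
    also have "((rep_eval id \<rho> (\<gamma> t) ** rep_deriv id \<rho> X) *v w) $ i = w' $ i"
      by (simp add: matrix_vector_mul_assoc[symmetric] w(1) w')
    finally show ?thesis .
  qed
  have "M t $ i - t * w' $ i = w $ i" for i
  proof -
    have "((\<lambda>s. M s $ i - s * w' $ i) has_field_derivative 0) (at s within UNIV)" for s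
      using D[of i s] by (auto intro!: derivative_eq_intros)
    then obtain c where c: "\<And>s. M s $ i - s * w' $ i = c"
      using has_field_derivative_zero_constant[of UNIV "\<lambda>s. M s $ i - s * w' $ i"] by auto
    moreover have "M 0 = w"
      using \<rho> by (simp add: M_def zero rational_representation_def)
    ultimately show ?thesis using c[of 0] c[of t] by simp
  qed
  then show ?thesis by (simp add: M_def vec_eq_iff diff_eq_eq)
qed

end

text \<open>The standard derivation of ad from Ad: conjugation by \<gamma>(t) is differentiated
  first in the direction Y and then in t at 0, on the group and in the representation. It needs
  curves in G, so it is stated for X and Y with such curves.\<close>

lemma rep_deriv_bracket:
  assumes \<rho>: "rational_representation G \<rho>" and G: "group (matrix_group G)"
    and X: "one_parameter_curve X \<gamma>" "\<And>t. \<gamma> t \<in> G"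
    and Y: "one_parameter_curve Y \<eta>" "\<And>t. \<eta> t \<in> G"
  shows "rep_deriv id \<rho> (bracket X Y) = bracket (rep_deriv id \<rho> X) (rep_deriv id \<rho> Y)"
proof -
  interpret X: one_parameter_curve X \<gamma> by fact
  interpret Y: one_parameter_curve Y \<eta> by fact
  let ?r = "rep_eval id \<rho>" and ?r' = "rep_deriv id \<rho>"
  have mult: "?r (A ** B) = ?r A ** ?r B" if "A \<in> G" "B \<in> G" for A B
    using \<rho> that unfolding rational_representation_def by blast
  have conj: "?r' (\<gamma> t ** Y ** \<gamma> (- t)) = ?r (\<gamma> t) ** ?r' Y ** ?r (\<gamma> (- t))" for t
  proof -
    let ?c = "\<lambda>s. \<gamma> t ** \<eta> s ** \<gamma> (- t)" and ?d = "\<lambda>s. \<gamma> t ** \<eta> (- s) ** \<gamma> (- t)"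
    have inv': "\<gamma> (- t) ** \<gamma> t = mat 1" using X.inv[of "- t"] by simp
    have c: "entry_deriv ?c (\<gamma> t ** Y ** \<gamma> (- t)) 0"
      using entry_deriv_mult[OF entry_deriv_mult[OF entry_deriv_const[of "\<gamma> t"] Y.deriv[of 0]]
          entry_deriv_const[of "\<gamma> (- t)"]] by (simp add: Y.zero)
    have d: "entry_deriv ?d (- (\<gamma> t ** Y ** \<gamma> (- t))) 0"
      using entry_deriv_mult[OF entry_deriv_mult[OF entry_deriv_const[of "\<gamma> t"] Y.deriv_inv[of 0]]
          entry_deriv_const[of "\<gamma> (- t)"]] by (simp add: Y.zero matrix_mult_uminus)
    have cd: "?c s ** ?d s = mat 1" for s
    proof -
      have "?c s ** ?d s = \<gamma> t ** (\<eta> s ** (\<gamma> (- t) ** \<gamma> t) ** \<eta> (- s)) ** \<gamma> (- t)"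
        by (simp only: matrix_mul_assoc)
      then show ?thesis by (simp add: X.inv Y.inv inv')
    qed
    have c': "entry_deriv (\<lambda>s. ?r (?c s)) (?r' (\<gamma> t ** Y ** \<gamma> (- t))) 0"
      unfolding entry_deriv_def rep_eval_def rep_deriv_def
      using gl_deriv_curve[OF c _ d] by (simp add: X.inv Y.zero gl_eval_pair[OF cd])
    have "?r (?c s) = ?r (\<gamma> t) ** ?r (\<eta> s) ** ?r (\<gamma> (- t))" for s
      using X(2) Y(2) matrix_groupD(2)[OF G] by (simp add: mult)
    then have "entry_deriv (\<lambda>s. ?r (?c s)) (?r (\<gamma> t) ** ?r' Y ** ?r (\<gamma> (- t))) 0"
      using entry_deriv_mult[OF entry_deriv_mult[OF entry_deriv_const[of "?r (\<gamma> t)"]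
            Y.rep_eval_deriv[OF \<rho> G Y(2), of 0]] entry_deriv_const[of "?r (\<gamma> (- t))"]] \<rho>
      by (simp add: Y.zero rational_representation_def)
    then show ?thesis using c' entry_deriv_unique by blast
  qed
  have "entry_deriv (\<lambda>t. \<gamma> t ** Y ** \<gamma> (- t)) (bracket X Y) 0"
    using entry_deriv_mult[OF entry_deriv_mult[OF X.deriv[of 0] entry_deriv_const[of Y]] X.deriv_inv[of 0]]
    by (simp add: X.zero bracket_def matrix_mult_uminus)
  then have 1: "entry_deriv (\<lambda>t. ?r' (\<gamma> t ** Y ** \<gamma> (- t))) (?r' (bracket X Y)) 0"
    by (rule entry_deriv_rep_deriv)
  have r: "entry_deriv (\<lambda>t. ?r (\<gamma> t)) (?r' X) 0" "?r (\<gamma> 0) = mat 1"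
    using X.rep_eval_deriv[OF \<rho> G X(2), of 0] \<rho> by (simp_all add: X.zero rational_representation_def)
  have "entry_deriv (\<lambda>t. ?r (\<gamma> t) ** ?r' Y ** ?r (\<gamma> (- t))) (bracket (?r' X) (?r' Y)) 0"
    using entry_deriv_mult[OF entry_deriv_mult[OF r(1) entry_deriv_const[of "?r' Y"]]
        entry_deriv_reflect[of "\<lambda>t. ?r (\<gamma> t)" "?r' X" 0]] r
    by (simp add: bracket_def matrix_mult_uminus)
  then show ?thesis using 1 entry_deriv_unique unfolding conj by blast
qed

section \<open>Rational points of one-parameter subgroups\<close>

text \<open>Here w is the inverse of v, as its values are the curve at - t; this supplies the
  invertibility over C(z) demanded of a rational point.\<close>

lemma (in one_parameter_curve) ratfun_point_of_curve:
  assumes "\<And>t. \<gamma> t \<in> S"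
    and vw: "\<forall>\<^sub>F z in cofinite. \<exists>t. evm v z = \<gamma> t \<and> evm w z = \<gamma> (- t)"
  shows "v \<in> ratfun_points S"
proof (rule ratfun_pointsI)
  have "\<forall>\<^sub>F z in cofinite. evm (v ** w) z = evm (mat 1) z"
    using vw evm_mult[of v w] by eventually_elim (auto simp: inv)
  then show "invertible v" by (rule matrix_inv_eqI(2)[OF evm_eqI])
  show "\<forall>\<^sub>F z in cofinite. evm v z \<in> S"
    using vw by eventually_elim (use assms(1) in auto)
qed

lemma rep_eval_ratfun_vector:
  assumes "invertible v" "\<forall>\<^sub>F z in cofinite. rep_eval id \<rho> (evm v z) *v w = evv u z"
  shows "rep_eval ratfun_const \<rho> v *v const_vector w = u"
proof (rule evv_eqI)
  show "\<forall>\<^sub>F z in cofinite. evv (rep_eval ratfun_const \<rho> v *v const_vector w) z = evv u z"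
    using assms(2) evm_rep_eval[OF assms(1), of \<rho>]
      evv_mult[of "rep_eval ratfun_const \<rho> v" "const_vector w"]
    by eventually_elim simp
qed

text \<open>Integral exponents turn exp (t k_i) into y^(k_i), so the matrix with these eigenvalues
  has rational entries. Its value at z is the curve at a logarithm of y(z).\<close>

lemma cocharacter_ratfun_point:
  fixes P R :: "complex^'n::finite^'n" and k :: "'n \<Rightarrow> int"
  assumes PR: "P ** R = mat 1" "R ** P = mat 1" and y: "y \<noteq> 0"
    and mem: "\<And>t. R ** diag_mat (\<lambda>i. exp (t * of_int (k i))) ** P \<in> S"
    and S: "S \<subseteq> G" and \<rho>: "rational_representation G \<rho>" and G: "group (matrix_group G)"
  obtains v where "v \<in> ratfun_points S"
    "\<And>w m. rep_deriv id \<rho> (R ** diag_mat (\<lambda>i. of_int (k i)) ** P) *v w = of_int m *s w \<Longrightarrow>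
       rep_eval ratfun_const \<rho> v *v const_vector w = (y powi m) *s const_vector w"
proof -
  let ?\<gamma> = "\<lambda>t. R ** diag_mat (\<lambda>i. exp (t * of_int (k i))) ** P"
  interpret one_parameter_curve "R ** diag_mat (\<lambda>i. of_int (k i)) ** P" ?\<gamma>
    by (rule diag_exp_curve[OF PR])
  define v where "v = (\<lambda>y. const_matrix R ** diag_mat (\<lambda>i. y powi k i) ** const_matrix P)"
  have ev_v: "\<forall>\<^sub>F z in cofinite. \<forall>t. exp t = ev y z \<longrightarrow> evm (v y) z = ?\<gamma> t" for y
  proof -
    have "\<forall>\<^sub>F z in cofinite. \<forall>i. ev (y powi k i) z = ev y z powi k i"
      by (intro eventually_all_finite ev_powi)
    then show ?thesis
      using evm_mult[of "const_matrix R ** diag_mat (\<lambda>i. y powi k i)" "const_matrix P"]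
        evm_mult[of "const_matrix R" "diag_mat (\<lambda>i. y powi k i)"]
    proof eventually_elim
      case (elim z)
      have "evm (diag_mat (\<lambda>i. y powi k i)) z = diag_mat (\<lambda>i. exp (t * of_int (k i)))"
        if "exp t = ev y z" for t
        using elim(1) that[symmetric] by (simp add: vec_eq_iff diag_mat_def exp_power_int mult.commute)
      then show ?case using elim by (simp add: v_def)
    qed
  qed
  \<comment> \<open>Any logarithm will do, since only integral powers of exp t occur; negating it
    handles the inverse.\<close>
  have t: "\<forall>\<^sub>F z in cofinite. \<exists>t. exp t = ev y z \<and> evm (v y) z = ?\<gamma> t \<and> evm (v (inverse y)) z = ?\<gamma> (- t)"
    using ev_v[of y] ev_v[of "inverse y"] ev_inverse[of y] ev_nonzero[OF y]
  proof eventually_elim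
    case (elim z)
    then have "exp (Ln (ev y z)) = ev y z" "exp (- Ln (ev y z)) = ev (inverse y) z"
      by (simp_all add: exp_minus)
    then show ?case using elim by blast
  qed
  have vS: "v y \<in> ratfun_points S"
    by (rule ratfun_point_of_curve[OF mem, of _ "v (inverse y)"])
      (rule eventually_mono[OF t], blast)
  have "rep_eval ratfun_const \<rho> (v y) *v const_vector w = (y powi m) *s const_vector w"
    if w: "rep_deriv id \<rho> (R ** diag_mat (\<lambda>i. of_int (k i)) ** P) *v w = of_int m *s w" for w m
  proof (rule rep_eval_ratfun_vector)
    show "invertible (v y)" using vS by (simp add: ratfun_points_def)
    show "\<forall>\<^sub>F z in cofinite. rep_eval id \<rho> (evm (v y) z) *v w = evv ((y powi m) *s const_vector w) z"
      using t ev_powi[of y m] evv_scale[of "y powi m" "const_vector w"]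
    proof eventually_elim
      case (elim z)
      then obtain t where t: "exp t = ev y z" "evm (v y) z = ?\<gamma> t" by blast
      have "\<And>t. ?\<gamma> t \<in> G" using mem S by blast
      then have "rep_eval id \<rho> (evm (v y) z) *v w = exp (t * of_int m) *s w"
        unfolding t(2) by (rule rep_eval_eigen[OF \<rho> G _ w])
      then show ?case using elim t(1)[symmetric] by (simp add: exp_power_int mult.commute)
    qed
  qed
  then show thesis using that vS by blast
qed

text \<open>The point is exp (\<beta> X), whose value at z is the curve at time \<beta>(z). On w the
  series ends after the linear term because X kills w'.\<close>

lemma unipotent_ratfun_point:
  fixes X :: "complex^'n::finite^'n"
  assumes X: "mpow X N = 0" and mem: "\<And>t. nil_exp N X t \<in> S"
    and S: "S \<subseteq> G" and \<rho>: "rational_representation G \<rho>" and G: "group (matrix_group G)"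
  obtains v where "v \<in> ratfun_points S"
    "\<And>w w'. rep_deriv id \<rho> X *v w = w' \<Longrightarrow> rep_deriv id \<rho> X *v w' = 0 \<Longrightarrow>
       rep_eval ratfun_const \<rho> v *v const_vector w = const_vector w + \<beta> *s const_vector w'"
proof -
  interpret one_parameter_curve X "nil_exp N X" by (rule nil_exp_curve[OF X])
  define v where "v = (\<lambda>\<beta>. \<Sum>k<N. smat (\<beta> ^ k * ratfun_const (1 / fact k)) (const_matrix (mpow X k)))"
  have ev_v: "\<forall>\<^sub>F z in cofinite. evm (v \<beta>) z = nil_exp N X (ev \<beta> z)" for \<beta>
  proof -
    have "\<forall>\<^sub>F z in cofinite. \<forall>k\<in>{..<N}. evm (smat (\<beta> ^ k * ratfun_const (1 / fact k)) (const_matrix (mpow X k))) z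
        = smat (ev \<beta> z ^ k / fact k) (mpow X k)"
    proof (intro eventually_ball_finite ballI)
      fix k
      show "\<forall>\<^sub>F z in cofinite. evm (smat (\<beta> ^ k * ratfun_const (1 / fact k)) (const_matrix (mpow X k))) z
        = smat (ev \<beta> z ^ k / fact k) (mpow X k)"
        using evm_smat[of "\<beta> ^ k * ratfun_const (1 / fact k)" "const_matrix (mpow X k)"]
          ev_mult[of "\<beta> ^ k" "ratfun_const (1 / fact k)"] ev_power[of \<beta> k]
        by eventually_elim simp
    qed simp
    then show ?thesis
      using evm_sum[of "\<lambda>k. smat (\<beta> ^ k * ratfun_const (1 / fact k)) (const_matrix (mpow X k))" "{..<N}"]
      by eventually_elim (simp add: v_def nil_exp_def)
  qed
  have vS: "v \<beta> \<in> ratfun_points S"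
  proof (rule ratfun_point_of_curve[OF mem])
    show "\<forall>\<^sub>F z in cofinite. \<exists>t. evm (v \<beta>) z = nil_exp N X t \<and> evm (v (- \<beta>)) z = nil_exp N X (- t)"
      using ev_v[of \<beta>] ev_v[of "- \<beta>"] ev_uminus[of \<beta>] by eventually_elim auto
  qed
  have "rep_eval ratfun_const \<rho> (v \<beta>) *v const_vector w = const_vector w + \<beta> *s const_vector w'"
    if w: "rep_deriv id \<rho> X *v w = w'" "rep_deriv id \<rho> X *v w' = 0" for w w'
  proof (rule rep_eval_ratfun_vector)
    show "invertible (v \<beta>)" using vS by (simp add: ratfun_points_def)
    have mem': "\<And>t. nil_exp N X t \<in> G" using mem S by blast
    show "\<forall>\<^sub>F z in cofinite. rep_eval id \<rho> (evm (v \<beta>) z) *v w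
        = evv (const_vector w + \<beta> *s const_vector w') z"
      using ev_v[of \<beta>] evv_add[of "const_vector w" "\<beta> *s const_vector w'"]
        evv_scale[of \<beta> "const_vector w'"]
      by eventually_elim (simp add: rep_eval_unipotent[OF \<rho> G mem' w])
  qed
  then show thesis using that vS by blast
qed

section \<open>Chevalley generators acting on the fundamental representations\<close>

lemma zero_in_lie_algebra: "0 \<in> lie_algebra S"
  unfolding lie_algebra_def using gl_deriv_linear(2)[of _ 0 0] by fastforce

lemma lie_algebra_sum:
  "(\<And>i. i \<in> I \<Longrightarrow> f i \<in> lie_algebra S) \<Longrightarrow> (\<Sum>i\<in>I. smat (c i) (f i)) \<in> lie_algebra S"
proof (induction I rule: infinite_finite_induct)
  case (insert i I)
  then show ?case by (simp add: lie_algebra_def gl_deriv_linear)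
qed (simp_all add: zero_in_lie_algebra)

text \<open>A linear equation satisfied by S passes to tangent vectors. It is applied with P
  diagonalising the maximal torus, to make the \<open>h j\<close> diagonal in the same
  basis.\<close>

lemma lie_algebra_zero_entry:
  fixes P R :: "complex^'n::finite^'n"
  assumes "\<And>A. A \<in> S \<Longrightarrow> (P ** A ** R) $ i $ j = 0" "X \<in> lie_algebra S"
  shows "(P ** X ** R) $ i $ j = 0"
proof -
  let ?c = "\<lambda>s. mat 1 + smat s X" and ?d = "\<lambda>s. mat 1 + smat s (- X)"
  have c: "entry_deriv ?c X 0" "?c 0 = mat 1" and d: "entry_deriv ?d (- X) 0" "?d 0 = mat 1"
    using entry_deriv_line by simp_all
  have "regular (\<lambda>A B. (P ** A ** R) $ i $ j)"
    unfolding matrix_matrix_mult_def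
    by (auto intro!: regular_sum regular_mult regular_const regular_fst)
  from lie_algebra_regular[OF this assms(1) assms(2) c d]
  have "((\<lambda>s. (P ** ?c s ** R) $ i $ j) has_field_derivative 0) (at 0)" by simp
  moreover have "entry_deriv (\<lambda>s. P ** ?c s ** R) (P ** X ** R) 0"
    using entry_deriv_mult[OF entry_deriv_mult[OF entry_deriv_const[of P] c(1)] entry_deriv_const[of R]]
    by simp
  then have "((\<lambda>s. (P ** ?c s ** R) $ i $ j) has_field_derivative (P ** X ** R) $ i $ j) (at 0)"
    unfolding entry_deriv_def by blast
  ultimately show ?thesis using DERIV_unique by blast
qed

lemma closed_connected_subgroupD:
  assumes "closed_connected_subgroup G K" "group (matrix_group G)"
  shows "K \<subseteq> G" "zariski_closed K" "group (matrix_group K)"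
proof -
  have sub: "subgroup K (matrix_group G)" "zariski_closed K"
    using assms(1) by (auto simp: closed_connected_subgroup_def)
  then show "zariski_closed K" "K \<subseteq> G"
    using subgroup.subset[OF sub(1)] by (auto simp: matrix_group_def)
  show "group (matrix_group K)"
    using subgroup.subgroup_is_group[OF sub(1) assms(2)] by (simp add: matrix_group_def)
qed

lemma nilradical_subset:
  assumes "group (matrix_group B)"
  shows "nilradical B \<subseteq> lie_algebra B"
proof -
  have "derived (matrix_group B) B \<subseteq> B"
    using group.derived_in_carrier[OF assms, of B] by (simp add: matrix_group_def)
  then show ?thesis unfolding nilradical_def by (rule lie_algebra_mono)
qed

lemma bracket_add_left: "bracket (X + Y) W = bracket X W + bracket Y W"
  by (simp add: bracket_def vec_eq_iff matrix_matrix_mult_def sum.distrib algebra_simps)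

lemma bracket_smat_left: "bracket (smat c X) W = smat c (bracket X W)"
  by (simp add: bracket_def smat_matrix_mult) (simp add: vec_eq_iff algebra_simps)

lemma bracket_sum_left: "bracket (\<Sum>i\<in>I. f i) W = (\<Sum>i\<in>I. bracket (f i) W)"
  by (induction I rule: infinite_finite_induct) (simp_all add: bracket_add_left bracket_def[of 0])

locale chevalley_setup =
  fixes G Bp Bm :: "(complex^'n::finite^'n) set"
    and \<alpha> :: "'r::finite \<Rightarrow> complex^'n^'n \<Rightarrow> complex"
    and e f h :: "'r \<Rightarrow> complex^'n^'n"
    and a :: "'r \<Rightarrow> 'r \<Rightarrow> int"
    and \<rho> :: "('n gl_fun)^'m::finite^'m"
    and V :: "'r \<Rightarrow> (complex^'m) set"
    and \<nu> :: "'r \<Rightarrow> complex^'m"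
  assumes algebraic: "algebraic_group G"
    and opposite: "opposite_borels G Bp Bm"
    and chevalley: "chevalley_generators G Bp Bm \<alpha> e f h"
    and cartan: "cartan_matrix \<alpha> h a"
    and fundamental: "fundamental_representations G Bp h \<rho> V \<nu>"
begin

lemma group_G: "group (matrix_group G)"
  using algebraic by (simp add: algebraic_group_def)

lemma closed_subgroups:
  "closed_connected_subgroup G Bp" "closed_connected_subgroup G Bm"
  "closed_connected_subgroup G (Bp \<inter> Bm)"
  using opposite
  by (auto simp: opposite_borels_def borel_subgroup_def maximal_torus_def torus_def)

lemmas Bp = closed_connected_subgroupD[OF closed_subgroups(1) group_G]
lemmas Bm = closed_connected_subgroupD[OF closed_subgroups(2) group_G]
lemmas H = closed_connected_subgroupD[OF closed_subgroups(3) group_G]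

lemma generators_mem:
  "e i \<in> lie_algebra Bp" "f i \<in> lie_algebra Bm" "h i \<in> lie_algebra (Bp \<inter> Bm)"
  using chevalley nilradical_subset[OF Bp(3)] nilradical_subset[OF Bm(3)]
  by (auto simp: chevalley_generators_def cartan_subalgebra_def)

lemma alpha_h: "\<alpha> j (h i) = of_int (a i j)"
  using cartan by (simp add: cartan_matrix_def)

lemma a_diag: "a i i = 2"
proof -
  have "\<alpha> i (h i) = 2" using chevalley by (simp add: chevalley_generators_def)
  then have "of_int (a i i) = (of_int 2 :: complex)" by (simp add: alpha_h)
  then show ?thesis by (simp only: of_int_eq_iff)
qed

lemma brackets:
  "bracket (h i) (e j) = smat (of_int (a i j)) (e j)"
  "bracket (h i) (f j) = smat (- of_int (a i j)) (f j)"
  "bracket (e i) (f j) = (if i = j then h i else 0)"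
proof -
  have "h i \<in> cartan_subalgebra Bp Bm" using generators_mem by (simp add: cartan_subalgebra_def)
  then show "bracket (h i) (e j) = smat (of_int (a i j)) (e j)"
    "bracket (h i) (f j) = smat (- of_int (a i j)) (f j)"
    using chevalley by (simp_all add: chevalley_generators_def alpha_h[symmetric])
  show "bracket (e i) (f j) = (if i = j then h i else 0)"
    using chevalley by (simp add: chevalley_generators_def)
qed

text \<open>The torus makes the coroots simultaneously diagonalisable. Their eigenvalues are
  integers because e_j, f_j, h_j form an sl2-triple of matrices acting on the defining space, so
  every eigenvector of h_j has integral weight.\<close>

lemma integral_diagonalization:
  obtains P R :: "complex^'n^'n" and k :: "'r \<Rightarrow> 'n \<Rightarrow> int" where "P ** R = mat 1" "R ** P = mat 1"
    "\<And>j. h j = R ** diag_mat (\<lambda>i. of_int (k j i)) ** P"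
proof -
  have "torus G (Bp \<inter> Bm)"
    using opposite unfolding opposite_borels_def maximal_torus_def by (elim conjE)
  then have "\<exists>P :: complex^'n^'n. invertible P \<and>
      (\<forall>A\<in>Bp \<inter> Bm. \<forall>i j. i \<noteq> j \<longrightarrow> (P ** A ** matrix_inv P) $ i $ j = 0)"
    unfolding torus_def by (elim conjE)
  then obtain P :: "complex^'n^'n" where P: "invertible P"
    "\<forall>A\<in>Bp \<inter> Bm. \<forall>i j. i \<noteq> j \<longrightarrow> (P ** A ** matrix_inv P) $ i $ j = 0"
    by (elim exE conjE)
  define R where "R = matrix_inv P"
  have PR: "P ** R = mat 1" "R ** P = mat 1" using matrix_inv_right[OF P(1)] by (simp_all add: R_def)
  define d where "d = (\<lambda>j i. (P ** h j ** R) $ i $ i)"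
  have "P ** h j ** R = diag_mat (d j)" for j
  proof -
    have "(P ** h j ** R) $ i $ l = 0" if "i \<noteq> l" for i l
    proof (rule lie_algebra_zero_entry[OF _ generators_mem(3)])
      show "(P ** A ** R) $ i $ l = 0" if "A \<in> Bp \<inter> Bm" for A
        using P(2) that \<open>i \<noteq> l\<close> unfolding R_def by blast
    qed
    then show ?thesis by (auto simp: vec_eq_iff diag_mat_def d_def)
  qed
  moreover have hd: "R ** (P ** h j ** R) ** P = h j" for j
  proof -
    have "R ** (P ** h j ** R) ** P = (R ** P) ** h j ** (R ** P)" by (simp only: matrix_mul_assoc)
    then show ?thesis by (simp add: PR)
  qed
  ultimately have h: "h j = R ** diag_mat (d j) ** P" for j by metis
  have "\<exists>n::int. d j i = of_int n" for j i
  proof (rule sl2_weight_int)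
    show "bracket (e j) (f j) = h j" by (simp add: brackets)
    show "bracket (h j) (e j) = smat 2 (e j)" "bracket (h j) (f j) = smat (- 2) (f j)"
      by (simp_all add: brackets a_diag)
    show "R *v axis i 1 \<noteq> 0" by (rule diag_eigenvector(2)[OF PR(1)])
    show "h j *v (R *v axis i 1) = d j i *s (R *v axis i 1)"
      unfolding h by (rule diag_eigenvector(1)[OF PR(1)])
  qed
  then have "\<forall>j. \<exists>k. \<forall>i. d j i = of_int (k i)" by (auto intro: choice)
  then obtain k where k: "\<And>j i. d j i = of_int (k j i)" by (auto dest!: choice)
  have "d j = (\<lambda>i. of_int (k j i))" for j using k by blast
  then have "h j = R ** diag_mat (\<lambda>i. of_int (k j i)) ** P" for j using h by metis
  then show thesis using that PR by blast
qed

lemma nilpotent: "\<exists>N. mpow (e j) N = 0" "\<exists>N. mpow (f j) N = 0"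
proof -
  obtain P R :: "complex^'n^'n" and k :: "'r \<Rightarrow> 'n \<Rightarrow> int" where PR: "P ** R = mat 1" "R ** P = mat 1"
    and h: "\<And>j. h j = R ** diag_mat (\<lambda>i. of_int (k j i)) ** P"
    by (rule integral_diagonalization) blast
  show "\<exists>N. mpow (e j) N = 0"
    using ad_eigenvector_nilpotent[OF PR, of _ "e j" 2] brackets(1)[of j j] h[of j]
    by (simp add: a_diag)
  show "\<exists>N. mpow (f j) N = 0"
    using ad_eigenvector_nilpotent[OF PR, of _ "f j" "- 2"] brackets(2)[of j j] h[of j]
    by (simp add: a_diag)
qed

section \<open>The sl2-relations on the spaces W i\<close>

lemma rep: "rational_representation G \<rho>"
  using fundamental by (simp add: fundamental_representations_def)

text \<open>Supplies the curves in G demanded by \<open>rep_deriv_bracket\<close>, so that the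
  relations of the Chevalley generators hold for their images.\<close>

lemma curves:
  "\<exists>\<gamma>. one_parameter_curve (e j) \<gamma> \<and> (\<forall>t. \<gamma> t \<in> G)"
  "\<exists>\<gamma>. one_parameter_curve (f j) \<gamma> \<and> (\<forall>t. \<gamma> t \<in> G)"
  "\<exists>\<gamma>. one_parameter_curve (h j) \<gamma> \<and> (\<forall>t. \<gamma> t \<in> G)"
proof -
  show "\<exists>\<gamma>. one_parameter_curve (e j) \<gamma> \<and> (\<forall>t. \<gamma> t \<in> G)"
    using nilpotent(1)[of j] nil_exp_curve
      one_parameter_curve.mem_closed_group[OF _ Bp(2,3) generators_mem(1)] Bp(1) by blast
  show "\<exists>\<gamma>. one_parameter_curve (f j) \<gamma> \<and> (\<forall>t. \<gamma> t \<in> G)"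
    using nilpotent(2)[of j] nil_exp_curve
      one_parameter_curve.mem_closed_group[OF _ Bm(2,3) generators_mem(2)] Bm(1) by blast
  obtain P R :: "complex^'n^'n" and k :: "'r \<Rightarrow> 'n \<Rightarrow> int" where PR: "P ** R = mat 1" "R ** P = mat 1"
    and h: "\<And>j. h j = R ** diag_mat (\<lambda>i. of_int (k j i)) ** P"
    by (rule integral_diagonalization) blast
  have "one_parameter_curve (h j) (\<lambda>t. R ** diag_mat (\<lambda>i. exp (t * of_int (k j i))) ** P)"
    unfolding h by (rule diag_exp_curve[OF PR])
  then show "\<exists>\<gamma>. one_parameter_curve (h j) \<gamma> \<and> (\<forall>t. \<gamma> t \<in> G)"
    using one_parameter_curve.mem_closed_group[OF _ H(2,3) generators_mem(3)] H(1) by blast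
qed

abbreviation "E j \<equiv> rep_deriv id \<rho> (e j)"
abbreviation "F j \<equiv> rep_deriv id \<rho> (f j)"
abbreviation "T j \<equiv> rep_deriv id \<rho> (h j)"

lemma rep_brackets:
  "bracket (T i) (E j) = smat (of_int (a i j)) (E j)"
  "bracket (T i) (F j) = smat (- of_int (a i j)) (F j)"
  "bracket (E i) (F j) = (if i = j then T i else 0)"
proof -
  have hom: "bracket (rep_deriv id \<rho> X) (rep_deriv id \<rho> Y) = rep_deriv id \<rho> (bracket X Y)"
    if "\<exists>\<gamma>. one_parameter_curve X \<gamma> \<and> (\<forall>t. \<gamma> t \<in> G)" "\<exists>\<gamma>. one_parameter_curve Y \<gamma> \<and> (\<forall>t. \<gamma> t \<in> G)"
    for X Y
    using that rep_deriv_bracket[OF rep group_G] by metis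
  show "bracket (T i) (E j) = smat (of_int (a i j)) (E j)"
    "bracket (T i) (F j) = smat (- of_int (a i j)) (F j)"
    "bracket (E i) (F j) = (if i = j then T i else 0)"
    by (simp_all add: hom[OF curves(3) curves(1)] hom[OF curves(3) curves(2)]
        hom[OF curves(1) curves(2)] brackets rep_deriv_smat)
qed

definition \<phi> :: "'r \<Rightarrow> complex^'m" where
  "\<phi> i = F i *v \<nu> i"

lemma nu_nonzero: "\<nu> i \<noteq> 0"
  and E_nu: "E j *v \<nu> i = 0"
  and T_nu: "T j *v \<nu> i = (if j = i then 1 else 0) *s \<nu> i"
  using fundamental chevalley
  by (auto simp: fundamental_representations_def chevalley_generators_def)

lemma T_phi: "T j *v \<phi> i = ((if j = i then 1 else 0) - of_int (a j i)) *s \<phi> i"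
  using bracket_eigen[OF rep_brackets(2)[of j i] T_nu[of j i]] by (simp add: \<phi>_def)

lemma E_phi: "E j *v \<phi> i = (if j = i then \<nu> i else 0)"
  using bracket_vector[of "E j" "F i" "\<nu> i"]
  by (auto simp: rep_brackets(3) E_nu T_nu \<phi>_def)

lemma phi_nonzero: "\<phi> i \<noteq> 0"
  using E_phi[of i i] nu_nonzero[of i] by auto

text \<open>Since [e_j, f_i] = 0, the vector f_i \<nu>_i is a highest weight vector for the j-th
  sl2, of weight - a_ji. This is what makes the exponents \<open>nat (- a j i)\<close> in the
  qq-system genuine.\<close>

lemma a_offdiag_nonpos:
  assumes "i \<noteq> j"
  shows "a j i \<le> 0"
proof -
  have "\<exists>n::nat. - of_int (a j i) = (of_nat n :: complex)"
  proof (rule sl2_highest_weight)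
    show "bracket (E j) (F j) = T j" by (simp add: rep_brackets)
    show "bracket (T j) (F j) = smat (- 2) (F j)" by (simp add: rep_brackets a_diag)
    show "\<phi> i \<noteq> 0" by (rule phi_nonzero)
    show "E j *v \<phi> i = 0" "T j *v \<phi> i = - of_int (a j i) *s \<phi> i"
      using assms by (simp_all add: E_phi T_phi)
  qed
  then obtain n :: nat where "- of_int (a j i) = (of_nat n :: complex)" ..
  then have "of_int (- a j i) = (of_int (int n) :: complex)" by simp
  then have "- a j i = int n" by (simp only: of_int_eq_iff)
  then show ?thesis by simp
qed

lemma cartan_coordinates_unique:
  assumes "(\<Sum>i\<in>UNIV. smat (c i) (h i)) = (\<Sum>i\<in>UNIV. smat (d i) (h i))"
  shows "c = d"
proof -
  have "(\<Sum>i\<in>UNIV. smat (c i) (h i)) \<in> cartan_subalgebra Bp Bm"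
    unfolding cartan_subalgebra_def by (rule lie_algebra_sum) (rule generators_mem(3))
  then have "\<exists>!c'. (\<Sum>i\<in>UNIV. smat (c i) (h i)) = (\<Sum>i\<in>UNIV. smat (c' i) (h i))"
    using chevalley by (simp add: chevalley_generators_def)
  then show ?thesis using assms by blast
qed

text \<open>Linearity of \<alpha>_i is not part of the definitions. It is read off from the bracket
  with e_i, which is nonzero because h_i = [e_i, f_i] acts as 1 on \<nu>_i.\<close>

lemma alpha_Z:
  assumes "Z \<in> cartan_subalgebra Bp Bm" "Z = (\<Sum>j\<in>UNIV. smat (\<zeta> j) (h j))"
  shows "\<alpha> i Z = (\<Sum>j\<in>UNIV. \<zeta> j * of_int (a j i))"
proof -
  have "e i \<noteq> 0"
  proof
    assume "e i = 0"
    then have "h i = 0" using brackets(3)[of i i] by (simp add: bracket_def)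
    then show False using T_nu[of i i] nu_nonzero[of i] by simp
  qed
  then obtain k l where kl: "e i $ k $ l \<noteq> 0" by (auto simp: vec_eq_iff)
  have "smat (\<alpha> i Z) (e i) = bracket Z (e i)"
    using assms(1) chevalley by (simp add: chevalley_generators_def)
  also have "\<dots> = (\<Sum>j\<in>UNIV. smat (\<zeta> j) (smat (of_int (a j i)) (e i)))"
    by (simp add: assms(2) bracket_sum_left bracket_smat_left brackets)
  finally have "\<alpha> i Z * e i $ k $ l = (\<Sum>j\<in>UNIV. \<zeta> j * of_int (a j i)) * e i $ k $ l"
    by (simp add: vec_eq_iff sum_distrib_right mult.assoc)
  then show ?thesis using kl by simp
qed

section \<open>Explicit rational points of B_+ and their action on W i\<close>

lemma identity_point:
  "mat 1 \<in> ratfun_points Bp" "rep_eval ratfun_const \<rho> (mat 1) *v const_vector w = const_vector w"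
proof -
  have inv: "invertible (mat 1 :: ratfun^'n^'n)" by (rule matrix_inv_eqI(2)) simp
  show "mat 1 \<in> ratfun_points Bp"
    using matrix_groupD(1)[OF Bp(3)] by (intro ratfun_pointsI inv) simp
  show "rep_eval ratfun_const \<rho> (mat 1) *v const_vector w = const_vector w"
    using rep by (intro rep_eval_ratfun_vector inv) (simp add: rational_representation_def)
qed

lemma rep_eval_point_mult:
  assumes "v \<in> ratfun_points Bp" "u \<in> ratfun_points Bp"
  shows "v ** u \<in> ratfun_points Bp"
    "rep_eval ratfun_const \<rho> (v ** u) *v w
       = rep_eval ratfun_const \<rho> v *v (rep_eval ratfun_const \<rho> u *v w)"
  using ratfun_points_mult[OF assms Bp(2,3)] rep_eval_ratfun_mult[OF assms Bp(2,1) rep]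
  by (simp_all add: matrix_vector_mul_assoc)

lemma coroot_point:
  assumes "y \<noteq> 0"
  obtains v where "v \<in> ratfun_points Bp"
    "\<And>w m. T j *v w = of_int m *s w \<Longrightarrow>
       rep_eval ratfun_const \<rho> v *v const_vector w = (y powi m) *s const_vector w"
proof -
  obtain P R :: "complex^'n^'n" and k :: "'r \<Rightarrow> 'n \<Rightarrow> int" where PR: "P ** R = mat 1" "R ** P = mat 1"
    and h: "\<And>j. h j = R ** diag_mat (\<lambda>i. of_int (k j i)) ** P"
    by (rule integral_diagonalization) blast
  have "one_parameter_curve (h j) (\<lambda>t. R ** diag_mat (\<lambda>i. exp (t * of_int (k j i))) ** P)"
    unfolding h by (rule diag_exp_curve[OF PR])
  then have "R ** diag_mat (\<lambda>i. exp (t * of_int (k j i))) ** P \<in> Bp" for t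
    using one_parameter_curve.mem_closed_group[OF _ H(2,3) generators_mem(3)] by blast
  from cocharacter_ratfun_point[OF PR assms this Bp(1) rep group_G]
  show thesis unfolding h[symmetric] using that by blast
qed

lemma root_point:
  obtains v where "v \<in> ratfun_points Bp"
    "\<And>w w'. E j *v w = w' \<Longrightarrow> E j *v w' = 0 \<Longrightarrow>
       rep_eval ratfun_const \<rho> v *v const_vector w = const_vector w + \<beta> *s const_vector w'"
proof -
  obtain N where N: "mpow (e j) N = 0" using nilpotent(1) by blast
  have "nil_exp N (e j) t \<in> Bp" for t
    by (rule one_parameter_curve.mem_closed_group[OF nil_exp_curve[OF N] Bp(2,3) generators_mem(1)])
  from unipotent_ratfun_point[OF N this Bp(1) rep group_G]
  show thesis using that by blast
qed

text \<open>The point is the product of the coroots evaluated at the \<open>y j\<close>. The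
  exponents are the weights under h_j: \<delta>_ji for \<nu>_i and \<delta>_ji - a_ji for f_i
  \<nu>_i.\<close>

lemma torus_point:
  fixes y :: "'r \<Rightarrow> ratfun"
  assumes y: "\<And>j. y j \<noteq> 0"
  obtains v where "v \<in> ratfun_points Bp"
    "\<And>i. rep_eval ratfun_const \<rho> v *v const_vector (\<nu> i) = y i *s const_vector (\<nu> i)"
    "\<And>i. rep_eval ratfun_const \<rho> v *v const_vector (\<phi> i)
       = (y i * (\<Prod>j\<in>UNIV. y j powi (- a j i))) *s const_vector (\<phi> i)"
proof -
  let ?\<delta> = "\<lambda>j i. (if j = i then 1 else 0 :: int)"
  have "\<exists>v\<in>ratfun_points Bp. \<forall>i.
      rep_eval ratfun_const \<rho> v *v const_vector (\<nu> i)
        = (\<Prod>j\<in>J. y j powi ?\<delta> j i) *s const_vector (\<nu> i) \<and>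
      rep_eval ratfun_const \<rho> v *v const_vector (\<phi> i)
        = (\<Prod>j\<in>J. y j powi (?\<delta> j i - a j i)) *s const_vector (\<phi> i)"
    if "finite J" for J
    using that
  proof (induction J)
    case empty
    then show ?case using identity_point by (intro bexI[of _ "mat 1"]) auto
  next
    case (insert j J)
    then obtain v where v: "v \<in> ratfun_points Bp"
      "\<And>i. rep_eval ratfun_const \<rho> v *v const_vector (\<nu> i)
        = (\<Prod>j\<in>J. y j powi ?\<delta> j i) *s const_vector (\<nu> i)"
      "\<And>i. rep_eval ratfun_const \<rho> v *v const_vector (\<phi> i)
        = (\<Prod>j\<in>J. y j powi (?\<delta> j i - a j i)) *s const_vector (\<phi> i)"
      by blast
    obtain u where u: "u \<in> ratfun_points Bp"
      "\<And>w m. T j *v w = of_int m *s w \<Longrightarrow>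
       rep_eval ratfun_const \<rho> u *v const_vector w = (y j powi m) *s const_vector w"
      using coroot_point[OF y[of j], of j] by blast
    have "T j *v \<nu> i = of_int (?\<delta> j i) *s \<nu> i" "T j *v \<phi> i = of_int (?\<delta> j i - a j i) *s \<phi> i" for i
      by (simp_all add: T_nu T_phi)
    note u' = this[THEN u(2)]
    show ?case
      using rep_eval_point_mult[OF u(1) v(1)] insert.hyps
      by (intro bexI[of _ "u ** v"]) (simp_all only: v vec.scale u' prod.insert vec.scale_scale
          mult.commute[of "y j powi _"] simp_thms)
  qed
  from this[of UNIV] obtain v where v: "v \<in> ratfun_points Bp"
      "\<And>i. rep_eval ratfun_const \<rho> v *v const_vector (\<nu> i)
        = (\<Prod>j\<in>UNIV. y j powi ?\<delta> j i) *s const_vector (\<nu> i)"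
      "\<And>i. rep_eval ratfun_const \<rho> v *v const_vector (\<phi> i)
        = (\<Prod>j\<in>UNIV. y j powi (?\<delta> j i - a j i)) *s const_vector (\<phi> i)"
    by auto
  have 1: "(\<Prod>j\<in>UNIV. y j powi ?\<delta> j i) = y i" for i
  proof -
    have "(\<Prod>j\<in>UNIV. y j powi ?\<delta> j i) = (\<Prod>j\<in>UNIV. if j = i then y j else 1)"
      by (intro prod.cong) auto
    then show ?thesis by simp
  qed
  have 2: "(\<Prod>j\<in>UNIV. y j powi (?\<delta> j i - a j i)) = y i * (\<Prod>j\<in>UNIV. y j powi (- a j i))" for i
  proof -
    have "(\<Prod>j\<in>UNIV. y j powi (?\<delta> j i - a j i)) = (\<Prod>j\<in>UNIV. y j powi ?\<delta> j i * y j powi (- a j i))"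
      using y by (intro prod.cong refl) (metis power_int_add diff_conv_add_uminus)
    then show ?thesis by (simp only: prod.distrib 1)
  qed
  show thesis using that v unfolding 1 2 by blast
qed

text \<open>The point is a product of the exp (\<beta>_j e_j). On W i only the factor j = i acts
  nontrivially, so all W i are prescribed at once.\<close>

lemma unipotent_point:
  fixes \<beta> :: "'r \<Rightarrow> ratfun"
  obtains v where "v \<in> ratfun_points Bp"
    "\<And>i. rep_eval ratfun_const \<rho> v *v const_vector (\<nu> i) = const_vector (\<nu> i)"
    "\<And>i. rep_eval ratfun_const \<rho> v *v const_vector (\<phi> i)
       = const_vector (\<phi> i) + \<beta> i *s const_vector (\<nu> i)"
proof -
  have "\<exists>v\<in>ratfun_points Bp. \<forall>i.
      rep_eval ratfun_const \<rho> v *v const_vector (\<nu> i) = const_vector (\<nu> i) \<and>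
      rep_eval ratfun_const \<rho> v *v const_vector (\<phi> i)
        = const_vector (\<phi> i) + (if i \<in> J then \<beta> i else 0) *s const_vector (\<nu> i)"
    if "finite J" for J
    using that
  proof (induction J)
    case empty
    then show ?case using identity_point by (intro bexI[of _ "mat 1"]) auto
  next
    case (insert j J)
    then obtain v where v: "v \<in> ratfun_points Bp"
      "\<And>i. rep_eval ratfun_const \<rho> v *v const_vector (\<nu> i) = const_vector (\<nu> i)"
      "\<And>i. rep_eval ratfun_const \<rho> v *v const_vector (\<phi> i)
        = const_vector (\<phi> i) + (if i \<in> J then \<beta> i else 0) *s const_vector (\<nu> i)"
      by blast
    obtain u where u: "u \<in> ratfun_points Bp"
      "\<And>w w'. E j *v w = w' \<Longrightarrow> E j *v w' = 0 \<Longrightarrow>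
       rep_eval ratfun_const \<rho> u *v const_vector w = const_vector w + \<beta> j *s const_vector w'"
      using root_point[of j "\<beta> j"] by blast
    have c0: "const_vector 0 = (0 :: ratfun^'m)" by (simp add: const_vector_def vec_eq_iff)
    have u\<nu>: "rep_eval ratfun_const \<rho> u *v const_vector (\<nu> i) = const_vector (\<nu> i)" for i
      using u(2)[OF E_nu] by (simp add: c0)
    have u\<phi>: "rep_eval ratfun_const \<rho> u *v const_vector (\<phi> i)
        = const_vector (\<phi> i) + (if i = j then \<beta> i else 0) *s const_vector (\<nu> i)" for i
      using u(2)[OF E_phi, of i] by (auto simp: c0 E_nu)
    have "rep_eval ratfun_const \<rho> (u ** v) *v const_vector (\<phi> i)
        = const_vector (\<phi> i) + (if i \<in> insert j J then \<beta> i else 0) *s const_vector (\<nu> i)" for i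
      unfolding rep_eval_point_mult(2)[OF u(1) v(1)] v(3) vec.add vec.scale u\<phi> u\<nu>
      using insert.hyps by auto
    then show ?case
      using rep_eval_point_mult[OF u(1) v(1)] v(2) u\<nu> by (intro bexI[of _ "u ** v"]) simp_all
  qed
  from this[of UNIV] show thesis using that by auto
qed

end

section \<open>Miura opers and the qq-system\<close>

lemma covariant_deriv_alt: "covariant_deriv A w = vec_deriv w + A *v w"
  by (simp add: covariant_deriv_def vec_deriv_def)

lemma covariant_deriv_add: "covariant_deriv A (u + w) = covariant_deriv A u + covariant_deriv A w"
  by (simp add: covariant_deriv_alt vec.add vec_eq_iff ratfun_deriv_add)

lemma covariant_deriv_scale:
  "covariant_deriv A (c *s w) = ratfun_deriv c *s w + c *s covariant_deriv A w"
  by (simp add: covariant_deriv_alt vec.scale vec_eq_iff ratfun_deriv_mult distrib_left)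

lemma covariant_deriv_const_vector: "covariant_deriv A (const_vector w) = A *v const_vector w"
  by (simp add: covariant_deriv_alt vec_eq_iff const_vector_def)

lemma rep_deriv_const_matrix: "rep_deriv ratfun_const \<rho> (const_matrix Z) = const_matrix (rep_deriv id \<rho> Z)"
  by (rule evm_eqI, rule eventually_mono[OF evm_rep_deriv[of \<rho> "const_matrix Z"]]) simp

lemma const_matrix_const_vector: "const_matrix A *v const_vector w = const_vector (A *v w)"
  by (rule evv_eqI, rule eventually_mono[OF evv_mult[of "const_matrix A" "const_vector w"]]) simp

lemma const_vector_scale: "const_vector (c *s w) = ratfun_const c *s const_vector w"
  by (simp add: vec_eq_iff const_vector_def to_fract_mult[symmetric] del: to_fract_mult)

lemma const_vector_0 [simp]: "const_vector 0 = 0"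
  by (simp add: vec_eq_iff const_vector_def)

lemma const_vector_eq_0_iff: "const_vector w = 0 \<longleftrightarrow> w = 0"
  by (simp add: vec_eq_iff const_vector_def)

lemma evm_miura_connection:
  "\<forall>\<^sub>F z in cofinite. evm (miura_connection \<Lambda> e h g) z =
     (\<Sum>i\<in>UNIV. smat (poly (\<Lambda> i) z) (e i)) + (\<Sum>i\<in>UNIV. smat (ev (g i) z) (h i))"
proof -
  have smat: "\<forall>\<^sub>F z in cofinite. \<forall>i. evm (smat (c i) (const_matrix (X i))) z = smat (ev (c i) z) (X i)"
    for c and X :: "'i::finite \<Rightarrow> complex^'k::finite^'k"
    using evm_smat[of _ "const_matrix _"] by (intro eventually_all_finite) simp
  show ?thesis
    using smat[of "\<lambda>i. to_fract (\<Lambda> i)" e] smat[of g h]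
      evm_sum[of "\<lambda>i. smat (to_fract (\<Lambda> i)) (const_matrix (e i))" UNIV]
      evm_sum[of "\<lambda>i. smat (g i) (const_matrix (h i))" UNIV]
      evm_add[of "\<Sum>i\<in>UNIV. smat (to_fract (\<Lambda> i)) (const_matrix (e i))"
        "\<Sum>i\<in>UNIV. smat (g i) (const_matrix (h i))"]
    by eventually_elim (simp add: miura_connection_def)
qed

lemma evv_sum_scale:
  "\<forall>\<^sub>F z in cofinite. evv (\<Sum>i\<in>(UNIV::'i::finite set). c i *s const_vector (w i)) z
     = (\<Sum>i\<in>UNIV. ev (c i) z *s w i)"
proof -
  have "\<forall>\<^sub>F z in cofinite. \<forall>j. ev (\<Sum>i\<in>UNIV. c i * const_vector (w i) $ j) z
      = (\<Sum>i\<in>UNIV. ev (c i) z * ev (const_vector (w i) $ j) z)"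
    by (intro eventually_all_finite ev_sum_mult)
  then show ?thesis
    by (rule eventually_mono) (simp add: vec_eq_iff const_vector_def)
qed

lemma matrix_vector_mult_sum_left:
  fixes f :: "'i \<Rightarrow> 'a::comm_ring_1^'n::finite^'m::finite"
  shows "(\<Sum>i\<in>I. f i) *v w = (\<Sum>i\<in>I. f i *v w)"
  by (induction I rule: infinite_finite_induct)
    (simp_all add: matrix_vector_mult_add_rdistrib)

lemma rep_miura_connection:
  "rep_deriv ratfun_const \<rho> (miura_connection \<Lambda> e h g) *v const_vector w =
     (\<Sum>i\<in>UNIV. to_fract (\<Lambda> i) *s const_vector (rep_deriv id \<rho> (e i) *v w)) +
     (\<Sum>i\<in>UNIV. g i *s const_vector (rep_deriv id \<rho> (h i) *v w))"
proof (rule evv_eqI)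
  let ?u1 = "\<Sum>i\<in>UNIV. to_fract (\<Lambda> i) *s const_vector (rep_deriv id \<rho> (e i) *v w)"
  let ?u2 = "\<Sum>i\<in>UNIV. g i *s const_vector (rep_deriv id \<rho> (h i) *v w)"
  show "\<forall>\<^sub>F z in cofinite.
     evv (rep_deriv ratfun_const \<rho> (miura_connection \<Lambda> e h g) *v const_vector w) z = evv (?u1 + ?u2) z"
    using evm_miura_connection[of \<Lambda> e h g] evm_rep_deriv[of \<rho> "miura_connection \<Lambda> e h g"]
      evv_mult[of "rep_deriv ratfun_const \<rho> (miura_connection \<Lambda> e h g)" "const_vector w"]
      evv_add[of ?u1 ?u2]
      evv_sum_scale[of "\<lambda>i. to_fract (\<Lambda> i)" "\<lambda>i. rep_deriv id \<rho> (e i) *v w"]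
      evv_sum_scale[of g "\<lambda>i. rep_deriv id \<rho> (h i) *v w"]
    by eventually_elim
      (simp add: rep_deriv_add rep_deriv_sum rep_deriv_smat matrix_vector_mult_add_rdistrib
        matrix_vector_mult_sum_left smat_vector_mult)
qed

locale twisted_setup = chevalley_setup G Bp Bm \<alpha> e f h a \<rho> V \<nu>
  for G Bp Bm :: "(complex^'n::finite^'n) set"
    and \<alpha> :: "'r::finite \<Rightarrow> complex^'n^'n \<Rightarrow> complex"
    and e f h :: "'r \<Rightarrow> complex^'n^'n"
    and a :: "'r \<Rightarrow> 'r \<Rightarrow> int"
    and \<rho> :: "('n gl_fun)^'m::finite^'m"
    and V :: "'r \<Rightarrow> (complex^'m) set"
    and \<nu> :: "'r \<Rightarrow> complex^'m" +
  fixes \<Lambda> :: "'r \<Rightarrow> complex poly" and Z :: "complex^'n^'n" and \<zeta> :: "'r \<Rightarrow> complex"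
  assumes Z_cartan: "Z \<in> cartan_subalgebra Bp Bm"
    and Z_eq: "Z = (\<Sum>i\<in>UNIV. smat (\<zeta> i) (h i))"
begin

definition oper_of :: "('r \<Rightarrow> complex poly) \<Rightarrow> ratfun^'n^'n" where
  "oper_of y = miura_connection \<Lambda> e h
     (\<lambda>i. ratfun_const (\<zeta> i) - inverse (to_fract (y i)) * ratfun_deriv (to_fract (y i)))"

text \<open>The Cartan part of the connection recovers the logarithmic derivatives of the
  \<open>y i\<close>, and these determine monic polynomials.\<close>

lemma oper_of_inj:
  assumes "oper_of y = oper_of w" "\<And>i. lead_coeff (y i) = 1" "\<And>i. lead_coeff (w i) = 1"
  shows "y = w"
proof
  fix i
  let ?g = "\<lambda>y i. ratfun_const (\<zeta> i) - inverse (to_fract (y i)) * ratfun_deriv (to_fract (y i))"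
  \<comment> \<open>Uniqueness of coordinates in the coroots is known over the complex numbers, so
    the coefficients are compared at almost every z.\<close>
  have "\<forall>\<^sub>F z in cofinite. ev (?g y i) z = ev (?g w i) z"
    using evm_miura_connection[of \<Lambda> e h "?g y"] evm_miura_connection[of \<Lambda> e h "?g w"]
  proof eventually_elim
    case (elim z)
    then have "(\<Sum>i\<in>UNIV. smat (ev (?g y i) z) (h i)) = (\<Sum>i\<in>UNIV. smat (ev (?g w i) z) (h i))"
      using assms(1) unfolding oper_of_def by simp
    then have "(\<lambda>i. ev (?g y i) z) = (\<lambda>i. ev (?g w i) z)" by (rule cartan_coordinates_unique)
    then show ?case by (rule fun_cong)
  qed
  then have "?g y i = ?g w i" by (rule ev_eqI')
  then have "ratfun_ldiff (to_fract (y i)) = ratfun_ldiff (to_fract (w i))"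
    by (simp add: ratfun_ldiff_def field_simps)
  then show "y i = w i" by (rule ldiff_monic_unique[OF _ assms(2,3)])
qed

definition qq_rhs :: "('r \<Rightarrow> complex poly) \<Rightarrow> 'r \<Rightarrow> complex poly" where
  "qq_rhs y i = \<Lambda> i * (\<Prod>j\<in>UNIV - {i}. y j ^ nat (- a j i))"

text \<open>
  The eigenvalues of the diagonal part of the gauge transformation are y i on the highest weight
  vector and phi_coeff y i on its neighbour; n and p are the corresponding rescaled basis of W i.
\<close>

definition phi_coeff :: "('r \<Rightarrow> complex poly) \<Rightarrow> 'r \<Rightarrow> ratfun" where
  "phi_coeff y i = to_fract (y i) * (\<Prod>j\<in>UNIV. to_fract (y j) powi (- a j i))"

definition n_vec :: "('r \<Rightarrow> complex poly) \<Rightarrow> 'r \<Rightarrow> ratfun^'m" where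
  "n_vec y i = to_fract (y i) *s const_vector (\<nu> i)"

definition p_vec :: "('r \<Rightarrow> complex poly) \<Rightarrow> 'r \<Rightarrow> ratfun^'m" where
  "p_vec y i = phi_coeff y i *s const_vector (\<phi> i)"

abbreviation "oper_rep y \<equiv> rep_deriv ratfun_const \<rho> (oper_of y)"

lemma phi_coeff_nonzero: "(\<And>j. y j \<noteq> 0) \<Longrightarrow> phi_coeff y i \<noteq> 0"
  by (simp add: phi_coeff_def)

text \<open>The origin of the right-hand side of the qq-system: the diagonal gauge transformation
  multiplies the entry \<open>\<Lambda> i\<close> by the ratio of its two eigenvalues, the product
  of all y_j^(- a_ji). The factor j = i is y_i^(-2) as a_ii = 2; the others form
  \<open>qq_rhs\<close>.\<close>

lemma phi_coeff_rhs:
  assumes y: "\<And>j. y j \<noteq> 0"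
  shows "phi_coeff y i * to_fract (\<Lambda> i) = to_fract (y i) * (to_fract (qq_rhs y i) / to_fract (y i) ^ 2)"
proof -
  have tp: "to_fract (\<Prod>j\<in>J. q j) = (\<Prod>j\<in>J. to_fract (q j))" for J and q :: "'r \<Rightarrow> complex poly"
    by (induction J rule: infinite_finite_induct) simp_all
  have "(\<Prod>j\<in>UNIV. to_fract (y j) powi (- a j i))
      = to_fract (y i) powi (- a i i) * (\<Prod>j\<in>UNIV - {i}. to_fract (y j) powi (- a j i))"
    by (rule prod.remove) auto
  also have "to_fract (y i) powi (- a i i) = inverse (to_fract (y i) ^ 2)"
    by (simp add: a_diag power_int_minus)
  also have "(\<Prod>j\<in>UNIV - {i}. to_fract (y j) powi (- a j i))
      = to_fract (\<Prod>j\<in>UNIV - {i}. y j ^ nat (- a j i))"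
    unfolding tp by (intro prod.cong refl) (use a_offdiag_nonpos in \<open>auto simp: to_fract_power power_int_def\<close>)
  finally show ?thesis
    by (simp add: phi_coeff_def qq_rhs_def field_simps)
qed

lemma covariant_n_vec:
  assumes y: "\<And>j. y j \<noteq> 0"
  shows "covariant_deriv (oper_rep y) (n_vec y i) = ratfun_const (\<zeta> i) *s n_vec y i"
proof -
  let ?Y = "to_fract (y i)"
  let ?g = "\<lambda>i. ratfun_const (\<zeta> i) - inverse (to_fract (y i)) * ratfun_deriv (to_fract (y i))"
  have "(\<Sum>j\<in>UNIV. ?g j *s const_vector (T j *v \<nu> i)) = (\<Sum>j\<in>UNIV. if j = i then ?g j *s const_vector (\<nu> i) else 0)"
    by (intro sum.cong) (auto simp: T_nu)
  then have act: "oper_rep y *v const_vector (\<nu> i) = ?g i *s const_vector (\<nu> i)"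
    unfolding oper_of_def rep_miura_connection by (simp add: E_nu)
  show ?thesis
    using y[of i] unfolding n_vec_def covariant_deriv_scale covariant_deriv_const_vector act
    by (simp add: vec_eq_iff field_simps)
qed

text \<open>With \<open>covariant_n_vec\<close> this is the triangular form of the oper on W i, with
  constant diagonal and a single rational off-diagonal entry.\<close>

lemma covariant_p_vec:
  assumes y: "\<And>j. y j \<noteq> 0"
  shows "covariant_deriv (oper_rep y) (p_vec y i) =
    ratfun_const (\<zeta> i - \<alpha> i Z) *s p_vec y i
    + (to_fract (qq_rhs y i) / to_fract (y i) ^ 2) *s n_vec y i"
proof -
  let ?Y = "\<lambda>i. to_fract (y i)" and ?d = "phi_coeff y i"
  let ?g = "\<lambda>i. ratfun_const (\<zeta> i) - inverse (?Y i) * ratfun_deriv (?Y i)"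
  let ?ld = "\<lambda>j. ratfun_ldiff (?Y j)"
  have g: "?g j = ratfun_const (\<zeta> j) - ?ld j" for j by (simp add: ratfun_ldiff_def field_simps)
  have const_int: "ratfun_const (of_int n) = of_int n" for n
  proof (cases n)
    case (nonneg m)
    then show ?thesis by (simp add: of_nat_fract to_fract_def of_nat_poly)
  next
    case (neg m)
    have "ratfun_const (of_nat (Suc m)) = of_nat (Suc m)"
      by (simp add: of_nat_fract to_fract_def of_nat_poly del: of_nat_Suc)
    then have "- ratfun_const (of_nat (Suc m)) = - of_nat (Suc m)" by simp
    moreover have "ratfun_const (of_int n) = - ratfun_const (of_nat (Suc m))"
      unfolding to_fract_uminus[symmetric] neg by simp
    ultimately show ?thesis unfolding neg by simp
  qed
  let ?\<delta> = "\<lambda>j. (if j = i then 1 else 0 :: ratfun)"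
  \<comment> \<open>The eigenvalue of the Cartan part of the oper on f_i \<nu>_i.\<close>
  define K where "K = (\<Sum>j\<in>UNIV. ?g j * (?\<delta> j - of_int (a j i)))"
  have "T j *v \<phi> i = of_int ((if j = i then 1 else 0) - a j i) *s \<phi> i" for j
    by (simp add: T_phi)
  then have "const_vector (T j *v \<phi> i) = (?\<delta> j - of_int (a j i)) *s const_vector (\<phi> i)" for j
    by (simp only: const_vector_scale const_int) (auto simp: vec_eq_iff)
  then have "(\<Sum>j\<in>UNIV. ?g j *s const_vector (T j *v \<phi> i)) = K *s const_vector (\<phi> i)"
    unfolding K_def by (simp only: vec.scale_sum_left vec.scale_scale)
  moreover have "(\<Sum>j\<in>UNIV. to_fract (\<Lambda> j) *s const_vector (E j *v \<phi> i))
      = to_fract (\<Lambda> i) *s const_vector (\<nu> i)"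
  proof -
    have "(\<Sum>j\<in>UNIV. to_fract (\<Lambda> j) *s const_vector (E j *v \<phi> i))
      = (\<Sum>j\<in>UNIV. if j = i then to_fract (\<Lambda> j) *s const_vector (\<nu> i) else 0)"
      by (intro sum.cong) (auto simp: E_phi)
    then show ?thesis by simp
  qed
  ultimately have act: "oper_rep y *v const_vector (\<phi> i)
      = to_fract (\<Lambda> i) *s const_vector (\<nu> i) + K *s const_vector (\<phi> i)"
    unfolding oper_of_def rep_miura_connection by simp
  have "K = ?g i - (\<Sum>j\<in>UNIV. ?g j * of_int (a j i))"
  proof -
    have "K = (\<Sum>j\<in>UNIV. (if j = i then ?g j else 0) - ?g j * of_int (a j i))"
      unfolding K_def by (intro sum.cong) (auto simp: algebra_simps)
    then show ?thesis by (simp add: sum_subtractf)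
  qed
  moreover have "ratfun_ldiff ?d = ?ld i - (\<Sum>j\<in>UNIV. ?ld j * of_int (a j i))"
    using y unfolding phi_coeff_def
    by (simp add: ratfun_ldiff_mult ratfun_ldiff_prod ratfun_ldiff_powi sum_negf mult.commute)
  \<comment> \<open>The rescaling was chosen for this cancellation: its logarithmic derivative
    removes all the y_j'/y_j from K.\<close>
  ultimately have "K + ratfun_ldiff ?d
      = ratfun_const (\<zeta> i) - (\<Sum>j\<in>UNIV. ratfun_const (\<zeta> j) * of_int (a j i))"
    unfolding g by (simp add: left_diff_distrib sum_subtractf)
  also have "(\<Sum>j\<in>UNIV. ratfun_const (\<zeta> j) * of_int (a j i)) = ratfun_const (\<alpha> i Z)"
  proof -
    have "[:\<alpha> i Z:] = (\<Sum>j\<in>UNIV. [:\<zeta> j:] * [:of_int (a j i):])"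
      unfolding alpha_Z[OF Z_cartan Z_eq] by (simp add: sum_to_poly mult.commute)
    then have "ratfun_const (\<alpha> i Z) = (\<Sum>j\<in>UNIV. ratfun_const (\<zeta> j) * ratfun_const (of_int (a j i)))"
      by (simp only: to_fract_sum to_fract_mult)
    then show ?thesis by (simp add: const_int)
  qed
  finally have K: "K + ratfun_ldiff ?d = ratfun_const (\<zeta> i - \<alpha> i Z)"
    unfolding to_fract_diff[symmetric] by simp
  have d: "ratfun_deriv ?d = ratfun_ldiff ?d * ?d"
    using phi_coeff_nonzero[of y i] y by (simp add: ratfun_ldiff_def)
  have "covariant_deriv (oper_rep y) (p_vec y i)
      = (?d * (K + ratfun_ldiff ?d)) *s const_vector (\<phi> i) + (?d * to_fract (\<Lambda> i)) *s const_vector (\<nu> i)"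
    unfolding p_vec_def covariant_deriv_scale covariant_deriv_const_vector act d
    by (simp add: vec_eq_iff algebra_simps)
  then show ?thesis
    unfolding K phi_coeff_rhs[OF y] p_vec_def n_vec_def by (simp add: vec_eq_iff algebra_simps)
qed

section \<open>Gauge equivalence with the constant connection\<close>

abbreviation "Z_rep \<equiv> rep_deriv ratfun_const \<rho> (const_matrix Z)"

lemma Z_nu: "covariant_deriv Z_rep (const_vector (\<nu> i)) = ratfun_const (\<zeta> i) *s const_vector (\<nu> i)"
proof -
  have "rep_deriv id \<rho> Z *v \<nu> i = (\<Sum>j\<in>UNIV. if j = i then \<zeta> j *s \<nu> i else 0)"
    unfolding Z_eq rep_deriv_sum rep_deriv_smat matrix_vector_mult_sum_left smat_vector_mult T_nu
    by (intro sum.cong) auto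
  then show ?thesis
    by (simp add: covariant_deriv_const_vector rep_deriv_const_matrix const_matrix_const_vector
        const_vector_scale)
qed

lemma Z_phi:
  "covariant_deriv Z_rep (const_vector (\<phi> i)) = ratfun_const (\<zeta> i - \<alpha> i Z) *s const_vector (\<phi> i)"
proof -
  have "rep_deriv id \<rho> Z *v \<phi> i
      = (\<Sum>j\<in>UNIV. \<zeta> j * ((if j = i then 1 else 0) - of_int (a j i))) *s \<phi> i"
    unfolding Z_eq rep_deriv_sum rep_deriv_smat matrix_vector_mult_sum_left smat_vector_mult T_phi
    by (simp only: vec.scale_sum_left vec.scale_scale)
  also have "(\<Sum>j\<in>UNIV. \<zeta> j * ((if j = i then 1 else 0) - of_int (a j i)))
      = (\<Sum>j\<in>UNIV. (if j = i then \<zeta> j else 0) - \<zeta> j * of_int (a j i))"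
    by (intro sum.cong) (auto simp: algebra_simps)
  also have "\<dots> = \<zeta> i - \<alpha> i Z"
    unfolding alpha_Z[OF Z_cartan Z_eq] by (simp add: sum_subtractf)
  finally show ?thesis
    by (simp only: covariant_deriv_const_vector rep_deriv_const_matrix const_matrix_const_vector
        const_vector_scale)
qed

lemma plucker_space_eq: "plucker_space f \<rho> \<nu> i = vec.span {const_vector (\<nu> i), const_vector (\<phi> i)}"
  by (simp add: plucker_space_def \<phi>_def)

lemma solution_miura_plucker:
  assumes y: "\<And>i. y i \<noteq> 0"
    and qq: "\<And>i. wronskian (y i) (q i) + smult (\<alpha> i Z) (y i * q i) = qq_rhs y i"
  shows "miura_plucker Bp f \<rho> \<nu> Z (oper_of y)"
proof -
  let ?Y = "\<lambda>i. to_fract (y i)" and ?\<alpha> = "\<lambda>i. ratfun_const (\<alpha> i Z)"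
  \<comment> \<open>The equation shown next says that p + \<beta> n is an eigenvector of the oper's
    covariant derivative with eigenvalue \<zeta>_i - \<alpha>_i(Z). The quotient rule turns it into
    the qq-equation, with the sign absorbed in \<beta>.\<close>
  define \<beta> where "\<beta> = (\<lambda>i. - (to_fract (q i) / ?Y i))"
  have \<beta>: "ratfun_deriv (\<beta> i) + ?\<alpha> i * \<beta> i + to_fract (qq_rhs y i) / ?Y i ^ 2 = 0" for i
  proof -
    have eq: "?Y i * ratfun_deriv (to_fract (q i)) - to_fract (q i) * to_fract (pderiv (y i))
        + ?\<alpha> i * (?Y i * to_fract (q i)) = to_fract (qq_rhs y i)"
      using qq[of i] unfolding wronskian_ratfun_iff .
    have "ratfun_deriv (to_fract (q i) / ?Y i)
        = (ratfun_deriv (to_fract (q i)) * ?Y i - to_fract (q i) * to_fract (pderiv (y i))) / ?Y i ^ 2"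
      using y[of i] ratfun_deriv_Fract[of "y i" "q i"] by (simp add: Fract_conv_to_fract power2_eq_square)
    then show ?thesis
      using y[of i] unfolding \<beta>_def ratfun_deriv_uminus eq[symmetric]
      by (simp add: field_simps power2_eq_square)
  qed
  obtain t where t: "t \<in> ratfun_points Bp"
    "\<And>i. rep_eval ratfun_const \<rho> t *v const_vector (\<nu> i) = n_vec y i"
    "\<And>i. rep_eval ratfun_const \<rho> t *v const_vector (\<phi> i) = p_vec y i"
    using torus_point[of ?Y] y unfolding n_vec_def p_vec_def phi_coeff_def by auto
  obtain u where u: "u \<in> ratfun_points Bp"
    "\<And>i. rep_eval ratfun_const \<rho> u *v const_vector (\<nu> i) = const_vector (\<nu> i)"
    "\<And>i. rep_eval ratfun_const \<rho> u *v const_vector (\<phi> i)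
       = const_vector (\<phi> i) + \<beta> i *s const_vector (\<nu> i)"
    using unipotent_point[of \<beta>] by blast
  define v where "v = t ** u"
  let ?N = "rep_eval ratfun_const \<rho> v"
  have v: "v \<in> ratfun_points Bp" unfolding v_def by (rule rep_eval_point_mult(1)[OF t(1) u(1)])
  have N: "?N *v const_vector (\<nu> i) = n_vec y i"
    "?N *v const_vector (\<phi> i) = p_vec y i + \<beta> i *s n_vec y i" for i
    unfolding v_def rep_eval_point_mult(2)[OF t(1) u(1)] u vec.add vec.scale t by simp_all
  have invN: "matrix_inv ?N *v (?N *v w) = w" for w
    using matrix_inv_right(2)[OF invertible_rep_eval_ratfun[OF v Bp(2,1,3) rep]]
    by (simp add: matrix_vector_mul_assoc)
  have Ninv: "?N *v (matrix_inv ?N *v w) = w" for w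
    using matrix_inv_right(1)[OF invertible_rep_eval_ratfun[OF v Bp(2,1,3) rep]]
    by (simp add: matrix_vector_mul_assoc)
  \<comment> \<open>Both sides obey the same Leibniz rule, so the vectors where they agree form a
    subspace over C(z), and two vectors spanning each W i suffice.\<close>
  define W where "W = {w. covariant_deriv (oper_rep y) w
      = ?N *v covariant_deriv Z_rep (matrix_inv ?N *v w)}"
  have subW: "vec.subspace W"
    unfolding vec.subspace_def W_def
    by (auto simp: covariant_deriv_add covariant_deriv_scale vec.add vec.scale Ninv)
      (simp add: covariant_deriv_alt vec_deriv_def vec_eq_iff matrix_vector_mult_def)
  have nW: "n_vec y i \<in> W" for i
  proof -
    have "matrix_inv ?N *v n_vec y i = const_vector (\<nu> i)" using invN[of "const_vector (\<nu> i)"] by (simp add: N)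
    then show ?thesis by (simp add: W_def covariant_n_vec[OF y] Z_nu vec.scale N)
  qed
  have pW: "p_vec y i + \<beta> i *s n_vec y i \<in> W" for i
  proof -
    have inv: "matrix_inv ?N *v (p_vec y i + \<beta> i *s n_vec y i) = const_vector (\<phi> i)"
      using invN[of "const_vector (\<phi> i)"] by (simp add: N)
    have "covariant_deriv (oper_rep y) (p_vec y i + \<beta> i *s n_vec y i)
      = ratfun_const (\<zeta> i - \<alpha> i Z) *s p_vec y i
        + (to_fract (qq_rhs y i) / ?Y i ^ 2 + ratfun_deriv (\<beta> i) + \<beta> i * ratfun_const (\<zeta> i)) *s n_vec y i"
      unfolding covariant_deriv_add covariant_deriv_scale covariant_n_vec[OF y] covariant_p_vec[OF y]
      by (simp add: vec_eq_iff algebra_simps)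
    also have "to_fract (qq_rhs y i) / ?Y i ^ 2 + ratfun_deriv (\<beta> i) + \<beta> i * ratfun_const (\<zeta> i)
      = ratfun_const (\<zeta> i - \<alpha> i Z) * \<beta> i"
    proof -
      have 1: "to_fract (qq_rhs y i) / ?Y i ^ 2 + ratfun_deriv (\<beta> i) = - (?\<alpha> i * \<beta> i)"
        using \<beta>[of i] by (simp add: eq_neg_iff_add_eq_0 add_ac)
      have 2: "ratfun_const (\<zeta> i - \<alpha> i Z) = ratfun_const (\<zeta> i) - ?\<alpha> i"
        unfolding to_fract_diff[symmetric] by simp
      show ?thesis unfolding 1 2 by (simp add: left_diff_distrib right_diff_distrib mult.commute)
    qed
    also have "ratfun_const (\<zeta> i - \<alpha> i Z) *s p_vec y i + (ratfun_const (\<zeta> i - \<alpha> i Z) * \<beta> i) *s n_vec y i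
      = ?N *v covariant_deriv Z_rep (const_vector (\<phi> i))"
      unfolding Z_phi vec.scale N by (simp add: vec_eq_iff algebra_simps)
    finally show ?thesis by (simp add: W_def inv)
  qed
  have "plucker_space f \<rho> \<nu> i \<subseteq> W" for i
  proof -
    have "inverse (?Y i) *s n_vec y i \<in> W" by (rule vec.subspace_scale[OF subW nW])
    then have "const_vector (\<nu> i) \<in> W" using y[of i] by (simp add: n_vec_def)
    moreover have "p_vec y i \<in> W"
      using vec.subspace_diff[OF subW pW[of i] vec.subspace_scale[OF subW nW[of i], of "\<beta> i"]] by simp
    then have "inverse (phi_coeff y i) *s p_vec y i \<in> W" by (rule vec.subspace_scale[OF subW])
    then have "const_vector (\<phi> i) \<in> W" using phi_coeff_nonzero[of y i] y by (simp add: p_vec_def)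
    ultimately show ?thesis
      unfolding plucker_space_eq by (intro vec.span_minimal[OF _ subW]) simp
  qed
  then show ?thesis
    unfolding miura_plucker_def using v by (intro bexI[of _ v]) (auto simp: W_def)
qed

lemma miura_plucker_solution:
  assumes y: "\<And>i. rsquarefree (y i)" and mp: "miura_plucker Bp f \<rho> \<nu> Z (oper_of y)"
  shows "\<exists>q. wronskian (y i) q + smult (\<alpha> i Z) (y i * q) = qq_rhs y i"
proof -
  have y0: "y j \<noteq> 0" for j using y[of j] by (auto simp: rsquarefree_def)
  obtain v where v: "v \<in> ratfun_points Bp"
    and eq: "\<And>i w. w \<in> plucker_space f \<rho> \<nu> i \<Longrightarrow> covariant_deriv (oper_rep y) w
      = rep_eval ratfun_const \<rho> v *v covariant_deriv Z_rep (matrix_inv (rep_eval ratfun_const \<rho> v) *v w)"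
    using mp unfolding miura_plucker_def by blast
  let ?N = "rep_eval ratfun_const \<rho> v"
  let ?R = "to_fract (qq_rhs y i) / to_fract (y i) ^ 2"
  have invN: "matrix_inv ?N *v (?N *v w) = w" for w
    using matrix_inv_right(2)[OF invertible_rep_eval_ratfun[OF v Bp(2,1,3) rep]]
    by (simp add: matrix_vector_mul_assoc)
  have Ninv: "?N *v (matrix_inv ?N *v w) = w" for w
    using matrix_inv_right(1)[OF invertible_rep_eval_ratfun[OF v Bp(2,1,3) rep]]
    by (simp add: matrix_vector_mul_assoc)
  have eq': "covariant_deriv Z_rep (matrix_inv ?N *v w) = matrix_inv ?N *v covariant_deriv (oper_rep y) w"
    if "w \<in> plucker_space f \<rho> \<nu> i" for w
    using eq[OF that] by (simp add: invN)
  \<comment> \<open>The images need not lie in W i. It is enough that they satisfy the triangular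
    equations inside the constant system on the whole representation space.\<close>
  define u\<^sub>1 u\<^sub>2 where "u\<^sub>1 = matrix_inv ?N *v n_vec y i" and "u\<^sub>2 = matrix_inv ?N *v p_vec y i"
  have "n_vec y i \<in> plucker_space f \<rho> \<nu> i" "p_vec y i \<in> plucker_space f \<rho> \<nu> i"
    unfolding plucker_space_eq n_vec_def p_vec_def by (simp_all add: vec.span_scale vec.span_base)
  from this[THEN eq'] have u: "covariant_deriv Z_rep u\<^sub>1 = ratfun_const (\<zeta> i) *s u\<^sub>1"
    "covariant_deriv Z_rep u\<^sub>2 = ratfun_const (\<zeta> i - \<alpha> i Z) *s u\<^sub>2 + ?R *s u\<^sub>1"
    unfolding covariant_n_vec[OF y0] covariant_p_vec[OF y0] u\<^sub>1_def u\<^sub>2_def vec.add vec.scale by simp_all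
  \<comment> \<open>Subtracting \<zeta>_i makes \<open>u\<^sub>1\<close> horizontal, the form
    required by \<open>constant_system_splits\<close>, and leaves - \<alpha>_i(Z) as the second
    diagonal entry.\<close>
  define S where "S = rep_deriv id \<rho> Z - smat (\<zeta> i) (mat 1)"
  have S: "const_matrix S *v w = Z_rep *v w - ratfun_const (\<zeta> i) *s w" for w
  proof -
    have "const_matrix S = Z_rep - smat (ratfun_const (\<zeta> i)) (mat 1)"
      unfolding rep_deriv_const_matrix S_def
      by (auto simp: vec_eq_iff const_matrix_def map_matrix_def mat_def to_fract_diff[symmetric]
          simp del: to_fract_diff)
    then show ?thesis by (simp add: matrix_vector_mult_diff_rdistrib smat_vector_mult)
  qed
  have "vec_deriv u\<^sub>1 + const_matrix S *v u\<^sub>1 = 0"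
    using u(1) by (simp add: S covariant_deriv_alt add_diff_eq)
  moreover have "u\<^sub>1 \<noteq> 0"
  proof
    assume "u\<^sub>1 = 0"
    then have "n_vec y i = 0" using Ninv[of "n_vec y i"] by (simp add: u\<^sub>1_def)
    then show False using y0[of i] nu_nonzero[of i] by (simp add: n_vec_def const_vector_eq_0_iff)
  qed
  moreover have "vec_deriv u\<^sub>2 + const_matrix S *v u\<^sub>2 = ?R *s u\<^sub>1 - ratfun_const (\<alpha> i Z) *s u\<^sub>2"
  proof -
    have c: "ratfun_const (\<zeta> i - \<alpha> i Z) = ratfun_const (\<zeta> i) - ratfun_const (\<alpha> i Z)"
      unfolding to_fract_diff[symmetric] by simp
    show ?thesis
      using u(2) unfolding c by (simp add: S covariant_deriv_alt vec.scale_left_diff_distrib algebra_simps)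
  qed
  ultimately obtain \<phi> where \<phi>: "ratfun_deriv \<phi> + ratfun_const (\<alpha> i Z) * \<phi> = ?R"
    using constant_system_splits by blast
  \<comment> \<open>Multiplying by y_i turns the solution of the off-diagonal equation into a
    rational solution q of the qq-equation, to which the pole argument applies.\<close>
  define \<psi> where "\<psi> = to_fract (y i) * \<phi>"
  have \<psi>: "to_fract (y i) * ratfun_deriv \<psi> - \<psi> * to_fract (pderiv (y i))
      + ratfun_const (\<alpha> i Z) * (to_fract (y i) * \<psi>) = to_fract (qq_rhs y i)"
  proof -
    have "to_fract (y i) * ratfun_deriv \<psi> - \<psi> * to_fract (pderiv (y i))
      + ratfun_const (\<alpha> i Z) * (to_fract (y i) * \<psi>)
      = to_fract (y i) ^ 2 * (ratfun_deriv \<phi> + ratfun_const (\<alpha> i Z) * \<phi>)"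
      unfolding \<psi>_def ratfun_deriv_mult by (simp add: algebra_simps power2_eq_square)
    then show ?thesis unfolding \<phi> using y0 by simp
  qed
  then obtain q where "\<psi> = to_fract q" using wronskian_solution_polynomial[OF y] by blast
  then have "wronskian (y i) q + smult (\<alpha> i Z) (y i * q) = qq_rhs y i"
    using \<psi> unfolding wronskian_ratfun_iff by simp
  then show ?thesis by blast
qed

section \<open>Surjectivity and fibres of the correspondence\<close>

lemma nondegenerate_polys_nonzero: "nondegenerate_polys a \<Lambda> y \<Longrightarrow> y i \<noteq> 0"
  unfolding nondegenerate_polys_def by (metis coeff_0 zero_neq_one)

lemma qq_solution_iff:
  "(y, q) \<in> nondegenerate_qq_solutions a \<alpha> \<Lambda> Z \<longleftrightarrow>
     (\<forall>i. wronskian (y i) (q i) + smult (\<alpha> i Z) (y i * q i) = qq_rhs y i) \<and> nondegenerate_polys a \<Lambda> y"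
  by (simp add: nondegenerate_qq_solutions_def qq_rhs_def)

lemma nondegenerate_oper_iff:
  "nondegenerate_oper a \<Lambda> e h Z A \<longleftrightarrow> (\<exists>y. nondegenerate_polys a \<Lambda> y \<and> A = oper_of y)"
  unfolding nondegenerate_oper_def oper_of_def
proof
  assume "\<exists>\<zeta>' y. Z = (\<Sum>i\<in>UNIV. smat (\<zeta>' i) (h i)) \<and> nondegenerate_polys a \<Lambda> y \<and>
    A = miura_connection \<Lambda> e h (\<lambda>i. ratfun_const (\<zeta>' i) -
          inverse (to_fract (y i)) * ratfun_deriv (to_fract (y i)))"
  then obtain \<zeta>' y where \<zeta>': "Z = (\<Sum>i\<in>UNIV. smat (\<zeta>' i) (h i))" and y: "nondegenerate_polys a \<Lambda> y"
    "A = miura_connection \<Lambda> e h (\<lambda>i. ratfun_const (\<zeta>' i) -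
          inverse (to_fract (y i)) * ratfun_deriv (to_fract (y i)))"
    by (elim exE conjE)
  \<comment> \<open>The coordinates quantified in \<open>nondegenerate_oper\<close> can only be the
    fixed ones, as each element of the Cartan subalgebra has unique coordinates in the
    coroots.\<close>
  have "\<zeta>' = \<zeta>" by (rule cartan_coordinates_unique) (rule trans[OF \<zeta>'[symmetric] Z_eq])
  then show "\<exists>y. nondegenerate_polys a \<Lambda> y \<and> A = miura_connection \<Lambda> e h (\<lambda>i. ratfun_const (\<zeta> i) -
          inverse (to_fract (y i)) * ratfun_deriv (to_fract (y i)))"
    using y by blast
qed (use Z_eq in blast)

lemma correspondence:
  "(\<lambda>s. oper_of (fst s)) ` nondegenerate_qq_solutions a \<alpha> \<Lambda> Z
     = nondegenerate_miura_plucker_opers Bp a e f h \<rho> \<nu> \<Lambda> Z"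
proof (intro equalityI subsetI)
  fix A assume "A \<in> (\<lambda>s. oper_of (fst s)) ` nondegenerate_qq_solutions a \<alpha> \<Lambda> Z"
  then obtain y q where yq: "(y, q) \<in> nondegenerate_qq_solutions a \<alpha> \<Lambda> Z" "A = oper_of y" by auto
  then have nd: "nondegenerate_polys a \<Lambda> y" by (simp add: qq_solution_iff)
  have "miura_plucker Bp f \<rho> \<nu> Z (oper_of y)"
    using solution_miura_plucker[of y q] nondegenerate_polys_nonzero[OF nd] yq(1)
    by (simp add: qq_solution_iff)
  moreover have "A \<in> miura_opers \<Lambda> e h"
    unfolding miura_opers_def yq(2) oper_of_def by blast
  ultimately show "A \<in> nondegenerate_miura_plucker_opers Bp a e f h \<rho> \<nu> \<Lambda> Z"
    using nd yq(2) by (auto simp: nondegenerate_miura_plucker_opers_def nondegenerate_oper_iff)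
next
  fix A assume "A \<in> nondegenerate_miura_plucker_opers Bp a e f h \<rho> \<nu> \<Lambda> Z"
  then obtain y where y: "nondegenerate_polys a \<Lambda> y" "A = oper_of y" "miura_plucker Bp f \<rho> \<nu> Z A"
    by (auto simp: nondegenerate_miura_plucker_opers_def nondegenerate_oper_iff)
  then have "\<forall>i. \<exists>q. wronskian (y i) q + smult (\<alpha> i Z) (y i * q) = qq_rhs y i"
    using miura_plucker_solution[of y] by (auto simp: nondegenerate_polys_def)
  then obtain q where "\<And>i. wronskian (y i) (q i) + smult (\<alpha> i Z) (y i * q i) = qq_rhs y i"
    by (auto dest!: choice)
  then have "(y, q) \<in> nondegenerate_qq_solutions a \<alpha> \<Lambda> Z" using y(1) by (simp add: qq_solution_iff)
  then show "A \<in> (\<lambda>s. oper_of (fst s)) ` nondegenerate_qq_solutions a \<alpha> \<Lambda> Z"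
    unfolding y(2) by (force intro: rev_image_eqI)
qed

lemma fibers:
  assumes "s \<in> nondegenerate_qq_solutions a \<alpha> \<Lambda> Z" "t \<in> nondegenerate_qq_solutions a \<alpha> \<Lambda> Z"
  shows "oper_of (fst s) = oper_of (fst t) \<longleftrightarrow> fst s = fst t"
proof -
  have "lead_coeff (fst s i) = 1" "lead_coeff (fst t i) = 1" for i
    using assms by (auto simp: nondegenerate_qq_solutions_def nondegenerate_polys_def)
  then show ?thesis using oper_of_inj[of "fst s" "fst t"] by auto
qed

end

theorem corollary5p9:
  fixes G Bp Bm :: "(complex^'n::finite^'n) set"
    and \<alpha> :: "'r::finite \<Rightarrow> complex^'n^'n \<Rightarrow> complex"
    and e f h :: "'r \<Rightarrow> complex^'n^'n"
    and a :: "'r \<Rightarrow> 'r \<Rightarrow> int"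
    and \<rho> :: "('n gl_fun)^'m::finite^'m"
    and V :: "'r \<Rightarrow> (complex^'m) set"
    and \<nu> :: "'r \<Rightarrow> complex^'m"
    and \<Lambda> :: "'r \<Rightarrow> complex poly"
    and Z :: "complex^'n^'n"
  assumes "simple_algebraic_group G"
    and "simply_connected G"
    and "opposite_borels G Bp Bm"
    and "simple_roots Bp Bm \<alpha>"
    and "chevalley_generators G Bp Bm \<alpha> e f h"
    and "cartan_matrix \<alpha> h a"
    and "fundamental_representations G Bp h \<rho> V \<nu>"
    and "Z \<in> cartan_subalgebra Bp Bm"
    and "\<forall>i. lead_coeff (\<Lambda> i) = 1"
  shows "\<exists>\<Phi>. \<Phi> ` nondegenerate_qq_solutions a \<alpha> \<Lambda> Z =
            nondegenerate_miura_plucker_opers Bp a e f h \<rho> \<nu> \<Lambda> Z \<and>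
          (\<forall>s\<in>nondegenerate_qq_solutions a \<alpha> \<Lambda> Z.
             \<forall>t\<in>nondegenerate_qq_solutions a \<alpha> \<Lambda> Z. \<Phi> s = \<Phi> t \<longleftrightarrow> fst s = fst t)"
proof -
  have "\<forall>T\<in>cartan_subalgebra Bp Bm. \<exists>!c. T = (\<Sum>i\<in>UNIV. smat (c i) (h i))"
    using assms(5) unfolding chevalley_generators_def by (elim conjE)
  then obtain \<zeta> where "Z = (\<Sum>i\<in>UNIV. smat (\<zeta> i) (h i))"
    using assms(8) by blast
  then interpret twisted_setup G Bp Bm \<alpha> e f h a \<rho> V \<nu> \<Lambda> Z \<zeta>
    using assms by unfold_locales (simp_all add: simple_algebraic_group_def)
  show ?thesis using correspondence fibers by blast
qed

end
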